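(* Let $\lambda\in P$ and $w\in W$. Let $\Gamma,\Xi$ be alcove paths from $A_\circ$ to $A_\lambda=A_\circ+\lambda$, and assume that $\Xi$ is obtained from $\Gamma$ by a Yang–Baxter transformation (YB). Then there exist a subset $\widetilde{\mathbf{QW}}^{(0)}_{\lambda,w}(\Gamma)\subset\widetilde{\mathbf{QW}}_{\lambda,w}(\Gamma)$ and a subset $\widetilde{\mathbf{QW}}^{(0)}_{\lambda,w}(\Xi)\subset\widetilde{\mathbf{QW}}_{\lambda,w}(\Xi)$ such that the following hold. (1) There exists a bijection $\mathsf{YB}:\widetilde{\mathbf{QW}}^{(0)}_{\lambda,w}(\Gamma)\to\widetilde{\mathbf{QW}}^{(0)}_{\lambda,w}(\Xi)$ such that for all $(\mathbf{w},\mathbf{b})\in\widetilde{\mathbf{QW}}^{(0)}_{\lambda,w}(\Gamma)$: $(-1)^{\mathsf{YB}(\mathbf{w},\mathbf{b})}=(-1)^{(\mathbf{w},\mathbf{b})}$, $\mathrm{end}(\mathsf{YB}(\mathbf{w},\mathbf{b}))=\mathrm{end}(\mathbf{w},\mathbf{b})$, $\mathrm{qwt}(\mathsf{YB}(\mathbf{w},\mathbf{b}))=\mathrm{qwt}(\mathbf{w},\mathbf{b})$, $\mathrm{qwt}^\vee(\mathsf{YB}(\mathbf{w},\mathbf{b}))=\mathrm{qwt}^\vee(\mathbf{w},\mathbf{b})$, $\mathrm{wt}(\mathsf{YB}(\mathbf{w},\mathbf{b}))=\mathrm{wt}(\mathbf{w},\mathbf{b})$, $\deg(\mathsf{YB}(\mathbf{w},\mathbf{b}))=\deg(\mathbf{w},\mathbf{b})$.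 (2) There exists an involution $\mathsf{YB}$ on $\widetilde{\mathbf{QW}}_{\lambda,w}(\Gamma)\setminus\widetilde{\mathbf{QW}}^{(0)}_{\lambda,w}(\Gamma)$ such that for all $(\mathbf{w},\mathbf{b})$ in this set: $(-1)^{\mathsf{YB}(\mathbf{w},\mathbf{b})}=-(-1)^{(\mathbf{w},\mathbf{b})}$, $\mathrm{end}(\mathsf{YB}(\mathbf{w},\mathbf{b}))=\mathrm{end}(\mathbf{w},\mathbf{b})$, $\mathrm{qwt}(\mathsf{YB}(\mathbf{w},\mathbf{b}))=\mathrm{qwt}(\mathbf{w},\mathbf{b})$, $\mathrm{qwt}^\vee(\mathsf{YB}(\mathbf{w},\mathbf{b}))=\mathrm{qwt}^\vee(\mathbf{w},\mathbf{b})$, $\mathrm{wt}(\mathsf{YB}(\mathbf{w},\mathbf{b}))=\mathrm{wt}(\mathbf{w},\mathbf{b})$, $\deg(\mathsf{YB}(\mathbf{w},\mathbf{b}))=\deg(\mathbf{w},\mathbf{b})$. (3) There exists an involution $\mathsf{YB}$ on $\widetilde{\mathbf{QW}}_{\lambda,w}(\Xi)\setminus\widetilde{\mathbf{QW}}^{(0)}_{\lambda,w}(\Xi)$ satisfying the same six conditions as in (2) for all of its elements (sign is reversed; $\mathrm{end}$, $\mathrm{qwt}$, $\mathrm{qwt}^\vee$, $\mathrm{wt}$, $\deg$ are preserved).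
   Context: **Root data.** $G$ is a simply-connected simple algebraic group over $\mathbb{C}$ of simply-laced type, not of type $E_8$, with maximal torus $H$, $\mathfrak{h}=\mathrm{Lie}(H)$, $\langle\cdot,\cdot\rangle:\mathfrak{h}^*\times\mathfrak{h}\to\mathbb{C}$ the pairing. $\Delta$ is the root system, $\Delta^+$ the positive roots, $\Delta^-=-\Delta^+$, $\alpha^\vee$ the coroot of $\alpha$, $\rho=\frac12\sum_{\alpha\in\Delta^+}\alpha$, $Q$ and $Q^\vee$ the root and coroot lattices, $P$ the weight lattice, $\mathfrak{h}^*_{\mathbb{R}}=\mathbb{R}\otimes P$. For $\alpha\in\Delta$: $\mathrm{sgn}(\alpha)=\pm1$ if $\alpha\in\Delta^{\pm}$, $|\alpha|=\mathrm{sgn}(\alpha)\alpha$, $s_\alpha\nu=\nu-\langle\nu,\alpha^\vee\rangle\alpha$. $W$ is the Weyl group, $\ell$ its length function, $<$ its Bruhat order. **Quantum Bruhat graph.** $\mathrm{QBG}(W)$ is the directed graph with vertex set $W$ and edges $x\xrightarrow{\alpha}y$, labeled by $\alpha\in\Delta^+$, whenever $y=xs_\alpha$ and either $\ell(y)=\ell(x)+1$ (Bruhat edge) or $\ell(y)=\ell(x)-2\langle\rho,\alpha^\vee\rangle+1$ (quantum edge). **Alcove paths.** For $\alpha\in\Delta$, $k\in\mathbb{Z}$: $H_{\alpha,k}=\{\nu\in\mathfrak{h}^*_{\mathbb{R}}\mid\langle\nu,\alpha^\vee\rangle=k\}$, and $\hat r_{\alpha,k}(\nu)=s_\alpha\nu+k\alpha$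 is the affine reflection in it. Alcoves are the open regions cut out by all the $H_{\alpha,k}$; $A_\circ=\{\nu\mid 0<\langle\nu,\alpha^\vee\rangle<1\ \forall\alpha\in\Delta^+\}$. For adjacent (distinct, sharing a wall) alcoves, $A\xrightarrow{\alpha}B$ means the common wall is orthogonal to $\alpha\in\Delta$ and $\alpha$ points in the direction from $A$ to $B$. An alcove path from $A_\circ$ to $A_\lambda:=A_\circ+\lambda$ is a sequence of successively adjacent alcoves $A_\circ=A_0\xrightarrow{\gamma_1}A_1\xrightarrow{\gamma_2}\cdots\xrightarrow{\gamma_m}A_m=A_\lambda$, written $\Gamma=(\gamma_1,\dots,\gamma_m)$. $H_{\gamma_t,l_t}$ denotes the hyperplane between $A_{t-1}$ and $A_t$, and $l_t'=\langle\lambda,\gamma_t^\vee\rangle-l_t$. **Yang–Baxter transformation (YB).** For $\alpha,\beta\in\Delta$ with $\langle\alpha,\beta^\vee\rangle\le0$ (equivalently $\langle\beta,\alpha^\vee\rangle\le0$), replace a segment $\alpha,s_\alpha\beta,s_\alpha s_\beta\alpha,\dots,s_\beta\alpha,\beta$ of consecutive roots of the path by the reversed segment $\beta,s_\beta\alpha,\dots,s_\alpha s_\beta\alpha,s_\alpha\beta,\alpha$. In the simply-laced case this means: if $\langle\alpha,\beta^\vee\rangle=0$, replace $\alpha,\beta$ by $\beta,\alpha$; if $\langle\alpha,\beta^\vee\rangle=-1$, replace $\alpha,\alpha+\beta,\beta$ by $\beta,\alpha+\beta,\alpha$. **Decorated quantum walks.** For $w\in W$ and $\Gamma=(\gamma_1,\dots,\gamma_m)$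 an alcove path from $A_\circ$ to $A_\lambda$, $\mathbf{QW}_{\lambda,w}(\Gamma)$ is the set of sequences $\mathbf{w}=(w_0,\dots,w_m)$ in $W$ with $w_0=w$, $w_t\in\{w_{t-1},s_{\gamma_t}w_{t-1}\}$ for $1\le t\le m$, and such that whenever $w_t=s_{\gamma_t}w_{t-1}$, $w_{t-1}\to w_t$ is an edge of $\mathrm{QBG}(W)$. Set $T(\mathbf{w})=\{t\mid w_t=s_{\gamma_t}w_{t-1}\}$, $T^-(\mathbf{w})=\{t\mid w_{t-1}>w_t\}$, $S(\mathbf{w})=\{t\mid w_t=w_{t-1}\text{ and }-w_t^{-1}\gamma_t\text{ is a simple root}\}$. $\widetilde{\mathbf{QW}}_{\lambda,w}(\Gamma)$ is the set of pairs $(\mathbf{w},\mathbf{b})$ with $\mathbf{w}\in\mathbf{QW}_{\lambda,w}(\Gamma)$ and $\mathbf{b}:S(\mathbf{w})\to\{0,1\}$. For such a pair: - $\mathrm{end}(\mathbf{w},\mathbf{b})=\mathrm{end}(\mathbf{w})=w_m$; - $(-1)^{(\mathbf{w},\mathbf{b})}=\prod_{t\in T(\mathbf{w}),\,w_{t-1}^{-1}\gamma_t\in\Delta^+}(-1)\cdot\prod_{t\in S(\mathbf{w})}(-1)^{\mathbf{b}(t)}$; - $\mathrm{qwt}_t(\mathbf{w},\mathbf{b})=\sum_{u\le t,\,u\in T^-(\mathbf{w})}|w_u^{-1}\gamma_u|-\sum_{u\le t,\,u\in S(\mathbf{w})}\mathbf{b}(u)w_u^{-1}\gamma_u\in Q$,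 $\mathrm{qwt}=\mathrm{qwt}_m$; $\mathrm{qwt}^\vee_t(\mathbf{w},\mathbf{b})=\sum_{u\le t,\,u\in T^-(\mathbf{w})}|w_u^{-1}\gamma_u|^\vee-\sum_{u\le t,\,u\in S(\mathbf{w})}\mathbf{b}(u)w_u^{-1}\gamma_u^\vee\in Q^\vee$, $\mathrm{qwt}^\vee=\mathrm{qwt}^\vee_m$; - $\hat r_0(\mathbf{w})=w^{-1}$, $\hat r_t(\mathbf{w})=\hat r_{t-1}(\mathbf{w})\hat r_{\gamma_t,l_t}$ if $t\in T(\mathbf{w})$ and $\hat r_t(\mathbf{w})=\hat r_{t-1}(\mathbf{w})$ otherwise; $\mathrm{wt}_t(\mathbf{w})=\hat r_t(\mathbf{w})\lambda-\hat r_{t-1}(\mathbf{w})\lambda$ for $1\le t\le m$; $\mathrm{wt}(\mathbf{w},\mathbf{b})=\mathrm{wt}(\mathbf{w})=\hat r_m(\mathbf{w})\lambda\in P$; - $\deg(\mathbf{w},\mathbf{b})=\frac12\langle\mathrm{qwt}(\mathbf{w},\mathbf{b}),\mathrm{qwt}^\vee(\mathbf{w},\mathbf{b})\rangle+\sum_{t=1}^m\langle\mathrm{wt}_t(\mathbf{w}),\mathrm{qwt}_t^\vee(\mathbf{w},\mathbf{b})\rangle-\sum_{t\in T^-(\mathbf{w})}\mathrm{sgn}(\gamma_t)l_t'-\sum_{t\in S(\mathbf{w})}\mathbf{b}(t)l_t'$. *)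

theory Defs
  imports "HOL-Analysis.Analysis"
begin

section \<open>Root systems\<close>

text \<open>
  The ambient Euclidean space is the real form of the dual of the Cartan subalgebra, with a
  Weyl-group invariant inner product of arbitrary scale.  The real form of the Cartan subalgebra is
  identified with it through that inner product.  Hence the pairing of a weight with an element of
  the Cartan subalgebra is the inner product, and the coroot of \<open>\<alpha>\<close> is \<open>2\<alpha>/(\<alpha>,\<alpha>)\<close>.
\<close>

definition coroot :: "'a::euclidean_space \<Rightarrow> 'a" where
  "coroot \<alpha> = (2 / (\<alpha> \<bullet> \<alpha>)) *\<^sub>R \<alpha>"

definition root_refl :: "'a::euclidean_space \<Rightarrow> 'a \<Rightarrow> 'a" where
  "root_refl \<alpha> \<nu> = \<nu> - (\<nu> \<bullet> coroot \<alpha>) *\<^sub>R \<alpha>"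

definition root_system :: "'a::euclidean_space set \<Rightarrow> bool" where
  "root_system \<Delta> \<longleftrightarrow>
     finite \<Delta> \<and> span \<Delta> = UNIV \<and> 0 \<notin> \<Delta> \<and>
     (\<forall>\<alpha>\<in>\<Delta>. \<forall>\<beta>\<in>\<Delta>. root_refl \<alpha> \<beta> \<in> \<Delta>) \<and>
     (\<forall>\<alpha>\<in>\<Delta>. \<forall>\<beta>\<in>\<Delta>. \<beta> \<bullet> coroot \<alpha> \<in> \<int>) \<and>
     (\<forall>\<alpha>\<in>\<Delta>. \<forall>c. c *\<^sub>R \<alpha> \<in> \<Delta> \<longrightarrow> c = 1 \<or> c = - 1)"

definition irreducible_roots :: "'a::euclidean_space set \<Rightarrow> bool" where
  "irreducible_roots \<Delta> \<longleftrightarrow>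
     \<Delta> \<noteq> {} \<and>
     \<not> (\<exists>X Y. X \<noteq> {} \<and> Y \<noteq> {} \<and> X \<union> Y = \<Delta> \<and> (\<forall>\<alpha>\<in>X. \<forall>\<beta>\<in>Y. \<alpha> \<bullet> \<beta> = 0))"

definition simply_laced :: "'a::euclidean_space set \<Rightarrow> bool" where
  "simply_laced \<Delta> \<longleftrightarrow> (\<forall>\<alpha>\<in>\<Delta>. \<forall>\<beta>\<in>\<Delta>. norm \<alpha> = norm \<beta>)"

definition pos_roots :: "'a::euclidean_space set \<Rightarrow> 'a set \<Rightarrow> 'a set" where
  "pos_roots \<Delta> B = {\<alpha>\<in>\<Delta>. \<exists>c::'a \<Rightarrow> nat. \<alpha> = (\<Sum>\<beta>\<in>B. real (c \<beta>) *\<^sub>R \<beta>)}"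

definition root_base :: "'a::euclidean_space set \<Rightarrow> 'a set \<Rightarrow> bool" where
  "root_base \<Delta> B \<longleftrightarrow>
     B \<subseteq> \<Delta> \<and> independent B \<and> span B = UNIV \<and>
     (\<forall>\<alpha>\<in>\<Delta>. \<alpha> \<in> pos_roots \<Delta> B \<or> - \<alpha> \<in> pos_roots \<Delta> B)"

text \<open>Bourbaki numbering: the chain 1-3-4-5-6-7-8 with node 2 attached to node 4.\<close>

definition E8_edges :: "nat set set" where
  "E8_edges = {{1,3}, {3,4}, {2,4}, {4,5}, {5,6}, {6,7}, {7,8}}"

definition type_E8 :: "'a::euclidean_space set \<Rightarrow> bool" where
  "type_E8 B \<longleftrightarrow>
     (\<exists>a :: nat \<Rightarrow> 'a. bij_betw a {1..8} B \<and>
       (\<forall>i\<in>{1..8}. \<forall>j\<in>{1..8}.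
          a i \<bullet> coroot (a j) = (if i = j then 2 else if {i, j} \<in> E8_edges then - 1 else 0)))"

definition root_sgn :: "'a::euclidean_space set \<Rightarrow> 'a set \<Rightarrow> 'a \<Rightarrow> real" where
  "root_sgn \<Delta> B \<alpha> = (if \<alpha> \<in> pos_roots \<Delta> B then 1 else - 1)"

definition root_abs :: "'a::euclidean_space set \<Rightarrow> 'a set \<Rightarrow> 'a \<Rightarrow> 'a" where
  "root_abs \<Delta> B \<alpha> = root_sgn \<Delta> B \<alpha> *\<^sub>R \<alpha>"

definition weyl_vector :: "'a::euclidean_space set \<Rightarrow> 'a set \<Rightarrow> 'a" where
  "weyl_vector \<Delta> B = (1/2) *\<^sub>R (\<Sum>\<alpha>\<in>pos_roots \<Delta> B. \<alpha>)"

definition weight_lattice :: "'a::euclidean_space set \<Rightarrow> 'a set" where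
  "weight_lattice \<Delta> = {\<nu>. \<forall>\<alpha>\<in>\<Delta>. \<nu> \<bullet> coroot \<alpha> \<in> \<int>}"


section \<open>The Weyl group and its quantum Bruhat graph\<close>

definition refl_word :: "'a::euclidean_space list \<Rightarrow> 'a \<Rightarrow> 'a" where
  "refl_word as = foldr (\<lambda>\<alpha> f. root_refl \<alpha> \<circ> f) as id"

definition weyl_group :: "'a::euclidean_space set \<Rightarrow> ('a \<Rightarrow> 'a) set" where
  "weyl_group \<Delta> = {refl_word as | as. set as \<subseteq> \<Delta>}"

definition weyl_length :: "'a::euclidean_space set \<Rightarrow> ('a \<Rightarrow> 'a) \<Rightarrow> nat" where
  "weyl_length B w = (LEAST n. \<exists>as. length as = n \<and> set as \<subseteq> B \<and> w = refl_word as)"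

definition bruhat_less ::
    "'a::euclidean_space set \<Rightarrow> 'a set \<Rightarrow> ('a \<Rightarrow> 'a) \<Rightarrow> ('a \<Rightarrow> 'a) \<Rightarrow> bool" where
  "bruhat_less \<Delta> B =
     (\<lambda>x y. x \<in> weyl_group \<Delta> \<and> (\<exists>\<alpha>\<in>\<Delta>. y = x \<circ> root_refl \<alpha>) \<and> weyl_length B x < weyl_length B y)\<^sup>+\<^sup>+"

definition qbg_edge ::
    "'a::euclidean_space set \<Rightarrow> 'a set \<Rightarrow> ('a \<Rightarrow> 'a) \<Rightarrow> 'a \<Rightarrow> ('a \<Rightarrow> 'a) \<Rightarrow> bool" where
  "qbg_edge \<Delta> B x \<alpha> y \<longleftrightarrow>
     x \<in> weyl_group \<Delta> \<and> y \<in> weyl_group \<Delta> \<and> \<alpha> \<in> pos_roots \<Delta> B \<and> y = x \<circ> root_refl \<alpha> \<and>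
     (weyl_length B y = weyl_length B x + 1 \<or>
      real (weyl_length B y) = real (weyl_length B x) - 2 * (weyl_vector \<Delta> B \<bullet> coroot \<alpha>) + 1)"


section \<open>Alcove paths\<close>

definition root_hyperplane :: "'a::euclidean_space \<Rightarrow> int \<Rightarrow> 'a set" where
  "root_hyperplane \<alpha> k = {\<nu>. \<nu> \<bullet> coroot \<alpha> = of_int k}"

definition aff_refl :: "'a::euclidean_space \<Rightarrow> int \<Rightarrow> 'a \<Rightarrow> 'a" where
  "aff_refl \<alpha> k \<nu> = root_refl \<alpha> \<nu> + of_int k *\<^sub>R \<alpha>"

definition alcoves :: "'a::euclidean_space set \<Rightarrow> 'a set set" where
  "alcoves \<Delta> = components (UNIV - (\<Union>\<alpha>\<in>\<Delta>. \<Union>k. root_hyperplane \<alpha> k))"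

definition fund_alcove :: "'a::euclidean_space set \<Rightarrow> 'a set \<Rightarrow> 'a set" where
  "fund_alcove \<Delta> B = {\<nu>. \<forall>\<alpha>\<in>pos_roots \<Delta> B. 0 < \<nu> \<bullet> coroot \<alpha> \<and> \<nu> \<bullet> coroot \<alpha> < 1}"

text \<open>
  \<open>alcove_cross \<Delta> C \<gamma> k D\<close>: the alcoves \<open>C\<close> and \<open>D\<close> share a wall (a common face of codimension one),
  this wall lies in \<open>root_hyperplane \<gamma> k\<close>, and \<open>\<gamma>\<close> points from \<open>C\<close> to \<open>D\<close>.
\<close>

definition alcove_cross ::
    "'a::euclidean_space set \<Rightarrow> 'a set \<Rightarrow> 'a \<Rightarrow> int \<Rightarrow> 'a set \<Rightarrow> bool" where
  "alcove_cross \<Delta> C \<gamma> k D \<longleftrightarrow>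
     C \<in> alcoves \<Delta> \<and> D \<in> alcoves \<Delta> \<and> C \<noteq> D \<and> \<gamma> \<in> \<Delta> \<and>
     aff_dim (closure C \<inter> closure D) = int DIM('a) - 1 \<and>
     closure C \<inter> closure D \<subseteq> root_hyperplane \<gamma> k \<and>
     (\<forall>\<nu>\<in>C. \<nu> \<bullet> coroot \<gamma> < of_int k) \<and> (\<forall>\<nu>\<in>D. of_int k < \<nu> \<bullet> coroot \<gamma>)"

definition alcove_arrow :: "'a::euclidean_space set \<Rightarrow> 'a set \<Rightarrow> 'a \<Rightarrow> 'a set \<Rightarrow> bool" where
  "alcove_arrow \<Delta> C \<gamma> D \<longleftrightarrow> (\<exists>k. alcove_cross \<Delta> C \<gamma> k D)"

text \<open>
  A path is given by its list of roots \<open>\<Gamma>\<close>.  As an alcove has at most one wall with outward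
  direction \<open>\<gamma>\<close>, the list determines the alcoves: \<open>alcove_at \<Delta> B \<Gamma> t\<close> is the one reached after \<open>t\<close>
  steps, and it is meaningful only when such a path exists, which \<open>alcove_path\<close> requires.  Steps are
  numbered from 1, whereas lists are indexed from 0, so the root of step \<open>t\<close> is \<open>\<Gamma> ! (t - 1)\<close>.
\<close>

primrec alcove_at :: "'a::euclidean_space set \<Rightarrow> 'a set \<Rightarrow> 'a list \<Rightarrow> nat \<Rightarrow> 'a set" where
  "alcove_at \<Delta> B \<Gamma> 0 = fund_alcove \<Delta> B"
| "alcove_at \<Delta> B \<Gamma> (Suc t) = (THE D. alcove_arrow \<Delta> (alcove_at \<Delta> B \<Gamma> t) (\<Gamma> ! t) D)"

definition alcove_path ::
    "'a::euclidean_space set \<Rightarrow> 'a set \<Rightarrow> 'a \<Rightarrow> 'a list \<Rightarrow> bool" where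
  "alcove_path \<Delta> B lam \<Gamma> \<longleftrightarrow>
     (\<forall>t<length \<Gamma>. alcove_arrow \<Delta> (alcove_at \<Delta> B \<Gamma> t) (\<Gamma> ! t) (alcove_at \<Delta> B \<Gamma> (Suc t))) \<and>
     alcove_at \<Delta> B \<Gamma> (length \<Gamma>) = (\<lambda>\<nu>. \<nu> + lam) ` fund_alcove \<Delta> B"

definition path_root :: "'a::euclidean_space list \<Rightarrow> nat \<Rightarrow> 'a" where
  "path_root \<Gamma> t = \<Gamma> ! (t - 1)"

definition path_level :: "'a::euclidean_space set \<Rightarrow> 'a set \<Rightarrow> 'a list \<Rightarrow> nat \<Rightarrow> int" where
  "path_level \<Delta> B \<Gamma> t =
     (THE k. alcove_cross \<Delta> (alcove_at \<Delta> B \<Gamma> (t - 1)) (path_root \<Gamma> t) k (alcove_at \<Delta> B \<Gamma> t))"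

definition path_colevel ::
    "'a::euclidean_space set \<Rightarrow> 'a set \<Rightarrow> 'a \<Rightarrow> 'a list \<Rightarrow> nat \<Rightarrow> real" where
  "path_colevel \<Delta> B lam \<Gamma> t =
     lam \<bullet> coroot (path_root \<Gamma> t) - of_int (path_level \<Delta> B \<Gamma> t)"

text \<open>
  In simply-laced type the transformation has two forms.
\<close>

definition yang_baxter :: "'a::euclidean_space set \<Rightarrow> 'a list \<Rightarrow> 'a list \<Rightarrow> bool" where
  "yang_baxter \<Delta> \<Gamma> \<Xi> \<longleftrightarrow>
     (\<exists>us vs \<alpha> \<beta>. \<alpha> \<in> \<Delta> \<and> \<beta> \<in> \<Delta> \<and>
        (\<alpha> \<bullet> coroot \<beta> = 0 \<and>
           \<Gamma> = us @ [\<alpha>, \<beta>] @ vs \<and> \<Xi> = us @ [\<beta>, \<alpha>] @ vs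
         \<or> \<alpha> \<bullet> coroot \<beta> = - 1 \<and>
           \<Gamma> = us @ [\<alpha>, \<alpha> + \<beta>, \<beta>] @ vs \<and> \<Xi> = us @ [\<beta>, \<alpha> + \<beta>, \<alpha>] @ vs))"


section \<open>Decorated quantum walks\<close>

definition quantum_walks ::
    "'a::euclidean_space set \<Rightarrow> 'a set \<Rightarrow> ('a \<Rightarrow> 'a) \<Rightarrow> 'a list \<Rightarrow> ('a \<Rightarrow> 'a) list set" where
  "quantum_walks \<Delta> B w \<Gamma> =
     {ws. length ws = length \<Gamma> + 1 \<and> set ws \<subseteq> weyl_group \<Delta> \<and> ws ! 0 = w \<and>
        (\<forall>t\<in>{1..length \<Gamma>}.
           ws ! t = ws ! (t - 1) \<or>
           ws ! t = root_refl (path_root \<Gamma> t) \<circ> ws ! (t - 1) \<and>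
             (\<exists>\<alpha>. qbg_edge \<Delta> B (ws ! (t - 1)) \<alpha> (ws ! t)))}"

definition T_set :: "'a::euclidean_space list \<Rightarrow> ('a \<Rightarrow> 'a) list \<Rightarrow> nat set" where
  "T_set \<Gamma> ws = {t\<in>{1..length \<Gamma>}. ws ! t = root_refl (path_root \<Gamma> t) \<circ> ws ! (t - 1)}"

definition Tminus_set ::
    "'a::euclidean_space set \<Rightarrow> 'a set \<Rightarrow> 'a list \<Rightarrow> ('a \<Rightarrow> 'a) list \<Rightarrow> nat set" where
  "Tminus_set \<Delta> B \<Gamma> ws = {t\<in>{1..length \<Gamma>}. bruhat_less \<Delta> B (ws ! t) (ws ! (t - 1))}"

definition S_set :: "'a::euclidean_space set \<Rightarrow> 'a list \<Rightarrow> ('a \<Rightarrow> 'a) list \<Rightarrow> nat set" where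
  "S_set B \<Gamma> ws =
     {t\<in>{1..length \<Gamma>}. ws ! t = ws ! (t - 1) \<and> - inv (ws ! t) (path_root \<Gamma> t) \<in> B}"

type_synonym 'a decorated_walk = "('a \<Rightarrow> 'a) list \<times> (nat \<Rightarrow> nat)"

definition decorated_walks ::
    "'a::euclidean_space set \<Rightarrow> 'a set \<Rightarrow> ('a \<Rightarrow> 'a) \<Rightarrow> 'a list \<Rightarrow> 'a decorated_walk set" where
  "decorated_walks \<Delta> B w \<Gamma> =
     {(ws, b). ws \<in> quantum_walks \<Delta> B w \<Gamma> \<and> b \<in> S_set B \<Gamma> ws \<rightarrow>\<^sub>E {0, 1}}"

definition walk_end :: "'a decorated_walk \<Rightarrow> 'a \<Rightarrow> 'a" where
  "walk_end = (\<lambda>(ws, b). last ws)"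

definition walk_sign ::
    "'a::euclidean_space set \<Rightarrow> 'a set \<Rightarrow> 'a list \<Rightarrow> 'a decorated_walk \<Rightarrow> int" where
  "walk_sign \<Delta> B \<Gamma> = (\<lambda>(ws, b).
     (\<Prod>t\<in>{t\<in>T_set \<Gamma> ws. inv (ws ! (t - 1)) (path_root \<Gamma> t) \<in> pos_roots \<Delta> B}. - 1) *
     (\<Prod>t\<in>S_set B \<Gamma> ws. (- 1) ^ b t))"

definition qwt_upto ::
    "'a::euclidean_space set \<Rightarrow> 'a set \<Rightarrow> 'a list \<Rightarrow> nat \<Rightarrow> 'a decorated_walk \<Rightarrow> 'a" where
  "qwt_upto \<Delta> B \<Gamma> t = (\<lambda>(ws, b).
     (\<Sum>u\<in>{u\<in>Tminus_set \<Delta> B \<Gamma> ws. u \<le> t}. root_abs \<Delta> B (inv (ws ! u) (path_root \<Gamma> u))) -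
     (\<Sum>u\<in>{u\<in>S_set B \<Gamma> ws. u \<le> t}. real (b u) *\<^sub>R inv (ws ! u) (path_root \<Gamma> u)))"

definition qwt ::
    "'a::euclidean_space set \<Rightarrow> 'a set \<Rightarrow> 'a list \<Rightarrow> 'a decorated_walk \<Rightarrow> 'a" where
  "qwt \<Delta> B \<Gamma> = qwt_upto \<Delta> B \<Gamma> (length \<Gamma>)"

definition qwt_co_upto ::
    "'a::euclidean_space set \<Rightarrow> 'a set \<Rightarrow> 'a list \<Rightarrow> nat \<Rightarrow> 'a decorated_walk \<Rightarrow> 'a" where
  "qwt_co_upto \<Delta> B \<Gamma> t = (\<lambda>(ws, b).
     (\<Sum>u\<in>{u\<in>Tminus_set \<Delta> B \<Gamma> ws. u \<le> t}.
        coroot (root_abs \<Delta> B (inv (ws ! u) (path_root \<Gamma> u)))) -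
     (\<Sum>u\<in>{u\<in>S_set B \<Gamma> ws. u \<le> t}. real (b u) *\<^sub>R inv (ws ! u) (coroot (path_root \<Gamma> u))))"

definition qwt_co ::
    "'a::euclidean_space set \<Rightarrow> 'a set \<Rightarrow> 'a list \<Rightarrow> 'a decorated_walk \<Rightarrow> 'a" where
  "qwt_co \<Delta> B \<Gamma> = qwt_co_upto \<Delta> B \<Gamma> (length \<Gamma>)"

primrec rhat ::
    "'a::euclidean_space set \<Rightarrow> 'a set \<Rightarrow> 'a list \<Rightarrow> ('a \<Rightarrow> 'a) list \<Rightarrow> nat \<Rightarrow> 'a \<Rightarrow> 'a" where
  "rhat \<Delta> B \<Gamma> ws 0 = inv (ws ! 0)"
| "rhat \<Delta> B \<Gamma> ws (Suc t) =
     (if Suc t \<in> T_set \<Gamma> ws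
      then rhat \<Delta> B \<Gamma> ws t \<circ> aff_refl (path_root \<Gamma> (Suc t)) (path_level \<Delta> B \<Gamma> (Suc t))
      else rhat \<Delta> B \<Gamma> ws t)"

definition wt_step ::
    "'a::euclidean_space set \<Rightarrow> 'a set \<Rightarrow> 'a \<Rightarrow> 'a list \<Rightarrow> nat \<Rightarrow> 'a decorated_walk \<Rightarrow> 'a" where
  "wt_step \<Delta> B lam \<Gamma> t = (\<lambda>(ws, b). rhat \<Delta> B \<Gamma> ws t lam - rhat \<Delta> B \<Gamma> ws (t - 1) lam)"

definition wt ::
    "'a::euclidean_space set \<Rightarrow> 'a set \<Rightarrow> 'a \<Rightarrow> 'a list \<Rightarrow> 'a decorated_walk \<Rightarrow> 'a" where
  "wt \<Delta> B lam \<Gamma> = (\<lambda>(ws, b). rhat \<Delta> B \<Gamma> ws (length \<Gamma>) lam)"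

definition walk_deg ::
    "'a::euclidean_space set \<Rightarrow> 'a set \<Rightarrow> 'a \<Rightarrow> 'a list \<Rightarrow> 'a decorated_walk \<Rightarrow> real" where
  "walk_deg \<Delta> B lam \<Gamma> = (\<lambda>(ws, b).
     1/2 * (qwt \<Delta> B \<Gamma> (ws, b) \<bullet> qwt_co \<Delta> B \<Gamma> (ws, b)) +
     (\<Sum>t=1..length \<Gamma>. wt_step \<Delta> B lam \<Gamma> t (ws, b) \<bullet> qwt_co_upto \<Delta> B \<Gamma> t (ws, b)) -
     (\<Sum>t\<in>Tminus_set \<Delta> B \<Gamma> ws. root_sgn \<Delta> B (path_root \<Gamma> t) * path_colevel \<Delta> B lam \<Gamma> t) -
     (\<Sum>t\<in>S_set B \<Gamma> ws. real (b t) * path_colevel \<Delta> B lam \<Gamma> t))"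

text \<open>
  The two walks may live over different paths \<open>\<Gamma>\<close> and \<open>\<Xi>\<close>.
\<close>

definition same_stats ::
    "'a::euclidean_space set \<Rightarrow> 'a set \<Rightarrow> 'a \<Rightarrow> 'a list \<Rightarrow> 'a decorated_walk \<Rightarrow>
     'a list \<Rightarrow> 'a decorated_walk \<Rightarrow> bool" where
  "same_stats \<Delta> B lam \<Gamma> p \<Xi> q \<longleftrightarrow>
     walk_end q = walk_end p \<and>
     qwt \<Delta> B \<Xi> q = qwt \<Delta> B \<Gamma> p \<and>
     qwt_co \<Delta> B \<Xi> q = qwt_co \<Delta> B \<Gamma> p \<and>
     wt \<Delta> B lam \<Xi> q = wt \<Delta> B lam \<Gamma> p \<and>
     walk_deg \<Delta> B lam \<Xi> q = walk_deg \<Delta> B lam \<Gamma> p"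

definition sign_reversing_involution ::
    "'a::euclidean_space set \<Rightarrow> 'a set \<Rightarrow> 'a \<Rightarrow> 'a list \<Rightarrow> 'a decorated_walk set \<Rightarrow>
     ('a decorated_walk \<Rightarrow> 'a decorated_walk) \<Rightarrow> bool" where
  "sign_reversing_involution \<Delta> B lam \<Gamma> X f \<longleftrightarrow>
     (\<forall>p\<in>X. f p \<in> X \<and> f (f p) = p \<and>
        walk_sign \<Delta> B \<Gamma> (f p) = - walk_sign \<Delta> B \<Gamma> p \<and> same_stats \<Delta> B lam \<Gamma> p \<Gamma> (f p))"

end

theory Submission
  imports Defs
begin

text \<open>
  The bijection and the two involutions exist as soon as, for every value of the statistics, the
  signed numbers of decorated walks over \<open>\<Gamma>\<close> and over \<open>\<Xi>\<close> agree: elements of opposite sign with equal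
  statistics are paired off by involutions, and what remains on the two sides has the same sign and the
  same size in each class (\<open>bijection_and_involutions_from_signed_counts\<close>).

  Signed numbers are computed by transfer operators.  A partial walk is described by a state: its
  current element \<open>x\<close> of the Weyl group, its quantum weight \<open>q\<close>, its weight, and the part of
  its degree accumulated so far.  Summing over the ways to take one more step is an operator on
  functions of the state, which depends only on the root of the step and on its colevel, and a path
  amounts to the product of the operators of its steps (\<open>walk_sum_snoc\<close>).  A wall keeps its colevel when a
  segment is reversed, because crossing a wall changes the level of an alcove for no other direction; the
  alcoves after the segment agree as well.  So the theorem reduces to Yang-Baxter equations for the
  operators of two or three steps, where the colevel of \<open>\<alpha> + \<beta>\<close> is the sum of those of \<open>\<alpha>\<close> and \<open>\<beta>\<close>.

  The walls of the segment pass through a common point, and this makes weight and degree redundant inside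
  the segment: up to constants they are functions of \<open>x\<close> and \<open>q\<close>, built from a vector that
  describes the common point (\<open>potential_lift_step_op\<close>).  What is left are operators that involve
  only \<open>x\<close> and \<open>q\<close>.  Those of \<open>\<gamma>\<close> and \<open>- \<gamma>\<close> are mutually inverse
  (\<open>local_op_inverse\<close>), so the equation for one base of the root hexagon spanned by \<open>\<alpha>\<close> and
  \<open>\<beta>\<close> implies it for the rotated bases, and \<open>\<alpha>\<close> and \<open>\<beta>\<close> may be taken positive.

  For positive roots the equation concerns the six elements of a coset of a dihedral group, their
  lengths and the heights of the roots.  The only facts about the Weyl group that enter are these: for a
  positive root \<open>\<delta>\<close> the length of \<open>x s\<^sub>\<delta>\<close> is larger or smaller than that of \<open>x\<close>
  according to the sign of \<open>x \<delta>\<close>, and it differs by at most \<open>2 ht(\<delta>) - 1\<close>.  An edge of the quantum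
  Bruhat graph realises the least possible change of length, namely \<open>1\<close> or \<open>1 - 2 ht(\<delta>)\<close>.  Whether
  two consecutive edges exist is therefore decided by the total change of length, which is the same for
  different ways around the coset, and the equation becomes a matter of linear arithmetic
  (\<open>dihedral_identity\<close>).
\<close>

section \<open>Signed counts and cancellation\<close>

text \<open>
  A bijection is glued from bijections of the classes, which exist because these are finite of equal size.
\<close>

lemma class_preserving_bijection:
  fixes f :: "'p \<Rightarrow> 'k" and g :: "'q \<Rightarrow> 'k"
  assumes "finite X" "finite Y"
    and card_eq: "\<And>v. card {p\<in>X. f p = v} = card {q\<in>Y. g q = v}"
  shows "\<exists>h. bij_betw h X Y \<and> (\<forall>p\<in>X. g (h p) = f p)"
proof -
  have "\<exists>h. bij_betw h {p\<in>X. f p = v} {q\<in>Y. g q = v}" for v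
    using assms by (intro finite_same_card_bij) auto
  then obtain H where H: "\<And>v. bij_betw (H v) {p\<in>X. f p = v} {q\<in>Y. g q = v}"
    by metis
  define h where "h p = H (f p) p" for p
  have in_class: "h p \<in> Y \<and> g (h p) = f p" if "p \<in> X" for p
    using bij_betwE[OF H[of "f p"]] that unfolding h_def by blast
  have "inj_on h X"
  proof (rule inj_onI)
    fix p p' assume "p \<in> X" "p' \<in> X" "h p = h p'"
    moreover from this have "f p = f p'" using in_class by metis
    ultimately show "p = p'"
      using bij_betw_imp_inj_on[OF H[of "f p"]] unfolding h_def inj_on_def by auto
  qed
  moreover have "Y \<subseteq> h ` X"
  proof
    fix q assume "q \<in> Y"
    then have "q \<in> H (g q) ` {p\<in>X. f p = g q}"
      using bij_betw_imp_surj_on[OF H[of "g q"]] by auto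
    then obtain p where "p \<in> X" "f p = g q" "q = H (g q) p" by auto
    then show "q \<in> h ` X" unfolding h_def by (intro image_eqI[of _ _ p]) auto
  qed
  ultimately have "bij_betw h X Y" using in_class unfolding bij_betw_def by auto
  then show ?thesis using in_class by blast
qed

text \<open>
  Pairs of opposite sign in the same class are removed one at a time; the removed elements carry the
  involution, and what is left has constant sign on every class.
\<close>

lemma cancel_opposite_signs:
  fixes f :: "'p \<Rightarrow> 'k" and s :: "'p \<Rightarrow> int"
  assumes "finite X" and "\<forall>p\<in>X. s p = 1 \<or> s p = - 1"
  shows "\<exists>X0\<subseteq>X. (\<forall>p\<in>X0. \<forall>p'\<in>X0. f p = f p' \<longrightarrow> s p = s p') \<and>
     (\<forall>v. (\<Sum>p\<in>{p\<in>X0. f p = v}. s p) = (\<Sum>p\<in>{p\<in>X. f p = v}. s p)) \<and>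
     (\<exists>\<phi>. \<forall>p\<in>X - X0. \<phi> p \<in> X - X0 \<and> \<phi> (\<phi> p) = p \<and> s (\<phi> p) = - s p \<and> f (\<phi> p) = f p)"
  using assms
proof (induction "card X" arbitrary: X rule: less_induct)
  case less
  show ?case
  proof (cases "\<forall>p\<in>X. \<forall>p'\<in>X. f p = f p' \<longrightarrow> s p = s p'")
    case True
    then show ?thesis by (intro exI[of _ X] conjI allI subset_refl refl) (assumption, simp)
  next
    case False
    then obtain p1 p2 where p: "p1 \<in> X" "p2 \<in> X" "f p1 = f p2" "s p1 \<noteq> s p2" by auto
    then have s: "s p2 = - s p1" 
      using bspec[OF less.prems(2) p(1)] bspec[OF less.prems(2) p(2)] by auto
    have ne: "p1 \<noteq> p2" using p by auto
    define Y where "Y = X - {p1, p2}"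
    have "card Y < card X"
      unfolding Y_def using p less.prems(1) by (intro psubset_card_mono) auto
    moreover have "finite Y" unfolding Y_def using less.prems(1) by auto
    moreover have "\<forall>p\<in>Y. s p = 1 \<or> s p = - 1"
      using less.prems(2) unfolding Y_def by auto
    ultimately have "\<exists>X0\<subseteq>Y. (\<forall>p\<in>X0. \<forall>p'\<in>X0. f p = f p' \<longrightarrow> s p = s p') \<and>
        (\<forall>v. (\<Sum>p\<in>{p\<in>X0. f p = v}. s p) = (\<Sum>p\<in>{p\<in>Y. f p = v}. s p)) \<and>
        (\<exists>\<phi>. \<forall>p\<in>Y - X0. \<phi> p \<in> Y - X0 \<and> \<phi> (\<phi> p) = p \<and> s (\<phi> p) = - s p \<and> f (\<phi> p) = f p)"
      by (rule less.hyps)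
    then obtain X0 \<phi> where X0: "X0 \<subseteq> Y" "\<forall>p\<in>X0. \<forall>p'\<in>X0. f p = f p' \<longrightarrow> s p = s p'"
      "\<forall>v. (\<Sum>p\<in>{p\<in>X0. f p = v}. s p) = (\<Sum>p\<in>{p\<in>Y. f p = v}. s p)"
      "\<forall>p\<in>Y - X0. \<phi> p \<in> Y - X0 \<and> \<phi> (\<phi> p) = p \<and> s (\<phi> p) = - s p \<and> f (\<phi> p) = f p"
      by (elim exE conjE) (rule that)
    have sums: "(\<Sum>p\<in>{p\<in>X. f p = v}. s p) = (\<Sum>p\<in>{p\<in>Y. f p = v}. s p)" for v
    proof -
      have "(\<Sum>p\<in>{p\<in>X. f p = v}. s p) = (\<Sum>p\<in>X. if f p = v then s p else 0)"
        using less.prems(1) by (simp add: sum.inter_filter)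
      also have "\<dots> = (\<Sum>p\<in>insert p1 (insert p2 Y). if f p = v then s p else 0)"
        unfolding Y_def using p by (intro sum.cong) auto
      also have "\<dots> = (\<Sum>p\<in>Y. if f p = v then s p else 0)"
        using \<open>finite Y\<close> ne s p(3) by (simp add: Y_def)
      finally show ?thesis using \<open>finite Y\<close> by (simp add: sum.inter_filter)
    qed
    define \<psi> where "\<psi> = \<phi>(p1 := p2, p2 := p1)"
    have inv: "\<forall>p\<in>X - X0. \<psi> p \<in> X - X0 \<and> \<psi> (\<psi> p) = p \<and> s (\<psi> p) = - s p \<and> f (\<psi> p) = f p"
    proof
      fix p assume pX: "p \<in> X - X0"
      show "\<psi> p \<in> X - X0 \<and> \<psi> (\<psi> p) = p \<and> s (\<psi> p) = - s p \<and> f (\<psi> p) = f p"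
      proof (cases "p = p1 \<or> p = p2")
        case True
        then show ?thesis using p s ne X0(1) unfolding \<psi>_def Y_def by auto
      next
        case False
        then have "p \<in> Y - X0" using pX unfolding Y_def by auto
        with X0(4) have "\<phi> p \<in> Y - X0" "\<phi> (\<phi> p) = p" "s (\<phi> p) = - s p" "f (\<phi> p) = f p" by auto
        then show ?thesis using False unfolding \<psi>_def Y_def by auto
      qed
    qed
    have "X0 \<subseteq> X" using X0(1) unfolding Y_def by auto
    moreover have "\<forall>v. (\<Sum>p\<in>{p\<in>X0. f p = v}. s p) = (\<Sum>p\<in>{p\<in>X. f p = v}. s p)"
      using X0(3) sums by simp
    moreover note X0(2)
    moreover have "\<exists>\<phi>. \<forall>p\<in>X - X0. \<phi> p \<in> X - X0 \<and> \<phi> (\<phi> p) = p \<and> s (\<phi> p) = - s p \<and> f (\<phi> p) = f p"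
      using inv by (rule exI[of _ \<psi>])
    ultimately show ?thesis by (intro exI[of _ X0] conjI)
  qed
qed

text \<open>
  After cancellation the signed count of a class is its common sign times its size, so equal signed
  counts leave equally many elements of each sign in each class.
\<close>

lemma bijection_and_involutions_from_signed_counts:
  fixes f :: "'p \<Rightarrow> 'k" and g :: "'q \<Rightarrow> 'k" and s :: "'p \<Rightarrow> int" and r :: "'q \<Rightarrow> int"
  assumes "finite X" "finite Y"
    and "\<forall>p\<in>X. s p = 1 \<or> s p = - 1" "\<forall>q\<in>Y. r q = 1 \<or> r q = - 1"
    and counts: "\<And>v. (\<Sum>p\<in>{p\<in>X. f p = v}. s p) = (\<Sum>q\<in>{q\<in>Y. g q = v}. r q)"
  shows "\<exists>X0 Y0. X0 \<subseteq> X \<and> Y0 \<subseteq> Y \<and>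
     (\<exists>h. bij_betw h X0 Y0 \<and> (\<forall>p\<in>X0. r (h p) = s p \<and> g (h p) = f p)) \<and>
     (\<exists>\<phi>. \<forall>p\<in>X - X0. \<phi> p \<in> X - X0 \<and> \<phi> (\<phi> p) = p \<and> s (\<phi> p) = - s p \<and> f (\<phi> p) = f p) \<and>
     (\<exists>\<psi>. \<forall>q\<in>Y - Y0. \<psi> q \<in> Y - Y0 \<and> \<psi> (\<psi> q) = q \<and> r (\<psi> q) = - r q \<and> g (\<psi> q) = g q)"
proof -
  obtain X0 where X0: "X0 \<subseteq> X" "\<forall>p\<in>X0. \<forall>p'\<in>X0. f p = f p' \<longrightarrow> s p = s p'"
     "\<forall>v. (\<Sum>p\<in>{p\<in>X0. f p = v}. s p) = (\<Sum>p\<in>{p\<in>X. f p = v}. s p)"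
     "\<exists>\<phi>. \<forall>p\<in>X - X0. \<phi> p \<in> X - X0 \<and> \<phi> (\<phi> p) = p \<and> s (\<phi> p) = - s p \<and> f (\<phi> p) = f p"
    using cancel_opposite_signs[OF assms(1,3), of f] by (elim exE conjE) (rule that, assumption+, rule exI)
  obtain Y0 where Y0: "Y0 \<subseteq> Y" "\<forall>p\<in>Y0. \<forall>p'\<in>Y0. g p = g p' \<longrightarrow> r p = r p'"
     "\<forall>v. (\<Sum>p\<in>{p\<in>Y0. g p = v}. r p) = (\<Sum>p\<in>{p\<in>Y. g p = v}. r p)"
     "\<exists>\<phi>. \<forall>p\<in>Y - Y0. \<phi> p \<in> Y - Y0 \<and> \<phi> (\<phi> p) = p \<and> r (\<phi> p) = - r p \<and> g (\<phi> p) = g p"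
    using cancel_opposite_signs[OF assms(2,4), of g] by (elim exE conjE) (rule that, assumption+, rule exI)
  have fin: "finite X0" "finite Y0" using X0 Y0 assms finite_subset by auto
  have size_from_sum: "int (card {p\<in>Z. (u p, t p) = (v, e)}) =
      (if (\<Sum>p\<in>{p\<in>Z. u p = v}. t p) * e > 0 then \<bar>\<Sum>p\<in>{p\<in>Z. u p = v}. t p\<bar> else 0)"
    if Z: "finite Z" "\<And>p. p \<in> Z \<Longrightarrow> t p = 1 \<or> t p = - 1"
      "\<forall>p\<in>Z. \<forall>p'\<in>Z. u p = u p' \<longrightarrow> t p = t p'" "e = 1 \<or> e = - 1"
    for Z :: "'z set" and t :: "'z \<Rightarrow> int" and u :: "'z \<Rightarrow> 'k" and v e
  proof (cases "\<exists>p\<in>Z. u p = v")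
    case True
    then obtain p0 where p0: "p0 \<in> Z" "u p0 = v" by auto
    have t_eq: "t p = t p0" if "p \<in> Z" "u p = v" for p using Z(3) that p0 by metis
    then have "(\<Sum>p\<in>{p\<in>Z. u p = v}. t p) = (\<Sum>p\<in>{p\<in>Z. u p = v}. t p0)"
      by (intro sum.cong) auto
    then have sm: "(\<Sum>p\<in>{p\<in>Z. u p = v}. t p) = int (card {p\<in>Z. u p = v}) * t p0" by simp
    have pos: "card {p\<in>Z. u p = v} > 0" using p0 Z(1) by (subst card_gt_0_iff) auto
    have "{p\<in>Z. (u p, t p) = (v, e)} = (if t p0 = e then {p\<in>Z. u p = v} else {})"
      using t_eq by auto
    then have "int (card {p\<in>Z. (u p, t p) = (v, e)}) =
        (if t p0 = e then int (card {p\<in>Z. u p = v}) else 0)" by simp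
    then show ?thesis using Z(2)[OF p0(1)] Z(4) pos unfolding sm
      by (elim disjE) (simp_all only:, simp_all)
  next
    case False
    then have "{p\<in>Z. u p = v} = {}" "{p\<in>Z. (u p, t p) = (v, e)} = {}" by auto
    then show ?thesis by (simp only:) simp
  qed
  have sgnX: "s p = 1 \<or> s p = - 1" if "p \<in> X0" for p using that X0(1) assms(3) by auto
  have sgnY: "r p = 1 \<or> r p = - 1" if "p \<in> Y0" for p using that Y0(1) assms(4) by auto
  have "card {p\<in>X0. (f p, s p) = k} = card {q\<in>Y0. (g q, r q) = k}" for k
  proof (cases k)
    case (Pair v e)
    show ?thesis
    proof (cases "e = 1 \<or> e = - 1")
      case True
      have "int (card {p\<in>X0. (f p, s p) = (v, e)}) = int (card {q\<in>Y0. (g q, r q) = (v, e)})"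
        using size_from_sum[of X0 s f e v, OF fin(1) sgnX X0(2) True]
          size_from_sum[of Y0 r g e v, OF fin(2) sgnY Y0(2) True] X0(3) Y0(3) counts by simp
      then show ?thesis using Pair by simp
    next
      case False
      then have "{p\<in>X0. (f p, s p) = (v, e)} = {}" "{q\<in>Y0. (g q, r q) = (v, e)} = {}"
        using sgnX sgnY by auto
      then show ?thesis unfolding Pair by (simp only: card.empty)
    qed
  qed
  from class_preserving_bijection[OF fin this]
  obtain h where "bij_betw h X0 Y0" "\<forall>p\<in>X0. (g (h p), r (h p)) = (f p, s p)" by blast
  then have "\<exists>h. bij_betw h X0 Y0 \<and> (\<forall>p\<in>X0. r (h p) = s p \<and> g (h p) = f p)" by auto
  then show ?thesis using X0(1,4) Y0(1,4) by (intro exI[of _ X0] exI[of _ Y0] conjI)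
qed

section \<open>Simply-laced root systems\<close>

locale simply_laced_base =
  fixes \<Delta> B :: "'a::euclidean_space set"
  assumes root_sys: "root_system \<Delta>" and laced: "simply_laced \<Delta>" and base: "root_base \<Delta> B"
begin

abbreviation "P \<equiv> pos_roots \<Delta> B"
abbreviation "W \<equiv> weyl_group \<Delta>"
abbreviation "len \<equiv> weyl_length B"
abbreviation "s \<equiv> root_refl"
abbreviation "coord \<equiv> real_vector.representation B"

text \<open>
  The common ratio between coroots and roots.
\<close>

definition coscale :: real where
  "coscale = 2 / ((SOME \<alpha>. \<alpha> \<in> \<Delta>) \<bullet> (SOME \<alpha>. \<alpha> \<in> \<Delta>))"

text \<open>
  For a simply-laced root system this is the sum of the coefficients with respect to \<open>B\<close>.
\<close>

definition height :: "'a \<Rightarrow> real" where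
  "height \<alpha> = weyl_vector \<Delta> B \<bullet> coroot \<alpha>"

lemma finite_roots: "finite \<Delta>" and zero_notin_roots: "0 \<notin> \<Delta>"
  and refl_root: "\<alpha> \<in> \<Delta> \<Longrightarrow> \<beta> \<in> \<Delta> \<Longrightarrow> s \<alpha> \<beta> \<in> \<Delta>"
  and pairing_Ints: "\<alpha> \<in> \<Delta> \<Longrightarrow> \<beta> \<in> \<Delta> \<Longrightarrow> \<beta> \<bullet> coroot \<alpha> \<in> \<int>"
  and proportional_roots: "\<alpha> \<in> \<Delta> \<Longrightarrow> c *\<^sub>R \<alpha> \<in> \<Delta> \<Longrightarrow> c = 1 \<or> c = - 1"
  using root_sys unfolding root_system_def by simp_all

lemma base_subset: "B \<subseteq> \<Delta>" and base_independent: "independent B" and base_span: "span B = UNIV"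
  using base unfolding root_base_def by auto

lemma finite_base: "finite B"
  using base_subset finite_roots finite_subset by blast

lemma pos_imp_root: "\<alpha> \<in> P \<Longrightarrow> \<alpha> \<in> \<Delta>"
  unfolding pos_roots_def by auto

lemma norm_sq_root: "\<alpha> \<in> \<Delta> \<Longrightarrow> \<alpha> \<bullet> \<alpha> = 2 / coscale" and coscale_pos: "\<alpha> \<in> \<Delta> \<Longrightarrow> coscale > 0"
proof -
  assume \<alpha>: "\<alpha> \<in> \<Delta>"
  define \<alpha>0 where "\<alpha>0 = (SOME \<alpha>. \<alpha> \<in> \<Delta>)"
  have "\<alpha>0 \<in> \<Delta>" unfolding \<alpha>0_def using \<alpha> by (rule someI)
  then have "norm \<alpha> = norm \<alpha>0" "\<alpha>0 \<noteq> 0"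
    using laced \<alpha> zero_notin_roots unfolding simply_laced_def by blast+
  then show "\<alpha> \<bullet> \<alpha> = 2 / coscale" "coscale > 0"
    unfolding coscale_def \<alpha>0_def[symmetric] by (auto simp: dot_square_norm)
qed

text \<open>All roots having the same length, the coroot is the same multiple of every root.\<close>

lemma coroot_eq: "\<alpha> \<in> \<Delta> \<Longrightarrow> coroot \<alpha> = coscale *\<^sub>R \<alpha>"
  unfolding coroot_def by (simp add: norm_sq_root)

lemma inner_coroot: "\<alpha> \<in> \<Delta> \<Longrightarrow> v \<bullet> coroot \<alpha> = coscale * (v \<bullet> \<alpha>)"
  by (simp add: coroot_eq)

lemma refl_eq: "\<alpha> \<in> \<Delta> \<Longrightarrow> s \<alpha> v = v - (v \<bullet> coroot \<alpha>) *\<^sub>R \<alpha>"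
  unfolding root_refl_def by simp

lemma coroot_self: "\<alpha> \<in> \<Delta> \<Longrightarrow> \<alpha> \<bullet> coroot \<alpha> = 2"
  using coscale_pos[of \<alpha>] by (simp add: inner_coroot norm_sq_root)

lemma pairing_sym: "\<alpha> \<in> \<Delta> \<Longrightarrow> \<beta> \<in> \<Delta> \<Longrightarrow> \<alpha> \<bullet> coroot \<beta> = \<beta> \<bullet> coroot \<alpha>"
  by (simp add: inner_coroot inner_commute)

lemma refl_self: "\<alpha> \<in> \<Delta> \<Longrightarrow> s \<alpha> \<alpha> = - \<alpha>"
  by (simp add: refl_eq coroot_self scaleR_2)

lemma uminus_root: "\<alpha> \<in> \<Delta> \<Longrightarrow> - \<alpha> \<in> \<Delta>"
  using refl_root[of \<alpha> \<alpha>] refl_self by simp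

lemma linear_refl: "linear (s \<alpha>)"
  unfolding root_refl_def
  by (intro linearI) (simp_all add: inner_add_left algebra_simps)

lemma refl_uminus: "s (- \<alpha>) = s \<alpha>"
  by (simp add: fun_eq_iff root_refl_def coroot_def)

lemma refl_refl: "\<alpha> \<in> \<Delta> \<Longrightarrow> s \<alpha> (s \<alpha> v) = v"
  by (simp add: refl_eq inner_diff_left coroot_self)

lemma refl_comp_refl: "\<alpha> \<in> \<Delta> \<Longrightarrow> s \<alpha> \<circ> s \<alpha> = id"
  by (simp add: fun_eq_iff refl_refl)

lemma inner_refl: "\<alpha> \<in> \<Delta> \<Longrightarrow> s \<alpha> u \<bullet> s \<alpha> v = u \<bullet> v"
proof -
  assume \<alpha>: "\<alpha> \<in> \<Delta>"
  define a b where "a = u \<bullet> coroot \<alpha>" and "b = v \<bullet> coroot \<alpha>"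
  have N: "\<alpha> \<bullet> \<alpha> = 2 / coscale" "u \<bullet> \<alpha> = a / coscale" "v \<bullet> \<alpha> = b / coscale"
    using \<alpha> coscale_pos[OF \<alpha>] unfolding a_def b_def by (simp_all add: norm_sq_root inner_coroot)
  have "s \<alpha> u \<bullet> s \<alpha> v = u \<bullet> v - b * (u \<bullet> \<alpha>) - a * (v \<bullet> \<alpha>) + a * (b * (\<alpha> \<bullet> \<alpha>))"
    unfolding refl_eq[OF \<alpha>] a_def[symmetric] b_def[symmetric]
    by (simp add: inner_diff_left inner_diff_right inner_commute[of \<alpha> v] algebra_simps)
  then show ?thesis unfolding N by simp
qed

text \<open>
  Roots of equal length that are not proportional pair to less than two in absolute value, since
  \<open>\<alpha> - \<beta>\<close> and \<open>\<alpha> + \<beta>\<close> have positive square norm.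
\<close>

lemma pairing_cases:
  assumes "\<alpha> \<in> \<Delta>" "\<beta> \<in> \<Delta>" "\<alpha> \<noteq> \<beta>" "\<alpha> \<noteq> - \<beta>"
  shows "\<alpha> \<bullet> coroot \<beta> \<in> {-1, 0, 1}"
proof -
  obtain k where k: "\<alpha> \<bullet> coroot \<beta> = of_int k"
    using pairing_Ints[of \<beta> \<alpha>] assms by (auto elim: Ints_cases)
  define N where "N = 2 / coscale"
  have N: "\<alpha> \<bullet> \<alpha> = N" "\<beta> \<bullet> \<beta> = N" "N > 0"
    using norm_sq_root coscale_pos assms unfolding N_def by auto
  have ab: "2 * (\<alpha> \<bullet> \<beta>) = k * N"
    using k assms coscale_pos[of \<beta>] unfolding N_def by (simp add: inner_coroot field_simps)
  have "0 < (\<alpha> - \<beta>) \<bullet> (\<alpha> - \<beta>)" "0 < (\<alpha> + \<beta>) \<bullet> (\<alpha> + \<beta>)"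
    using assms by (auto simp: add_eq_0_iff2)
  then have "0 < 2 * N - k * N" "0 < 2 * N + k * N"
    using N(1,2) ab by (simp_all add: inner_add_left inner_add_right inner_diff_left inner_diff_right inner_commute)
  then have "0 < N * (2 - k)" "0 < N * (2 + k)" by (simp_all add: algebra_simps)
  then have "k < 2" "k > - 2" using N(3) by (simp_all add: zero_less_mult_iff)
  then have "k \<in> {-1, 0, 1}" by auto
  then show ?thesis using k by auto
qed

lemma refl_eq_imp:
  assumes "\<alpha> \<in> \<Delta>" "\<beta> \<in> \<Delta>" "s \<alpha> = s \<beta>"
  shows "\<alpha> = \<beta> \<or> \<alpha> = - \<beta>"
proof (rule ccontr)
  assume ne: "\<not> (\<alpha> = \<beta> \<or> \<alpha> = - \<beta>)"
  have "s \<alpha> \<beta> = - \<beta>" using assms refl_self by simp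
  then have "\<beta> - (\<beta> \<bullet> coroot \<alpha>) *\<^sub>R \<alpha> = - \<beta>" using refl_eq[OF assms(1)] by metis
  then have two: "2 *\<^sub>R \<beta> = (\<beta> \<bullet> coroot \<alpha>) *\<^sub>R \<alpha>" by (simp add: scaleR_2 algebra_simps)
  then have "\<beta> = ((\<beta> \<bullet> coroot \<alpha>) / 2) *\<^sub>R \<alpha>"
    by (metis divide_inverse_commute scaleR_scaleR scaleR_one zero_neq_numeral left_inverse)
  then show False using proportional_roots[of \<alpha> "(\<beta> \<bullet> coroot \<alpha>) / 2"] assms ne by auto
qed

lemma coord_linear:
  "coord (u + v) b = coord u b + coord v b" "coord (u - v) b = coord u b - coord v b"
  "coord (- v) b = - coord v b" "coord (c *\<^sub>R v) b = c * coord v b"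
  using base_independent base_span
  by (simp_all add: real_vector.representation_add real_vector.representation_diff
      real_vector.representation_neg real_vector.representation_scale)

lemma coord_base: "b \<in> B \<Longrightarrow> coord b b' = (if b' = b then 1 else 0)"
  using base_independent by (simp add: real_vector.representation_basis)

lemma coord_sum: "(\<Sum>b\<in>B. coord v b *\<^sub>R b) = v"
  using base_independent base_span finite_base by (intro real_vector.sum_representation_eq) auto

lemma pos_coord: "\<alpha> \<in> P \<Longrightarrow> b \<in> B \<Longrightarrow> \<exists>n::nat. coord \<alpha> b = real n"
proof -
  assume "\<alpha> \<in> P" and b: "b \<in> B"
  then obtain c :: "'a \<Rightarrow> nat" where "\<alpha> = (\<Sum>\<beta>\<in>B. real (c \<beta>) *\<^sub>R \<beta>)"
    unfolding pos_roots_def by auto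
  then have "coord \<alpha> b = (\<Sum>\<beta>\<in>B. coord (real (c \<beta>) *\<^sub>R \<beta>) b)"
    using base_independent base_span by (simp add: real_vector.representation_sum)
  also have "\<dots> = (\<Sum>\<beta>\<in>B. if b = \<beta> then real (c \<beta>) else 0)"
    by (intro sum.cong) (auto simp: coord_linear coord_base)
  also have "\<dots> = real (c b)" using b finite_base by simp
  finally show ?thesis by blast
qed

lemma pos_coord_nonneg: "\<alpha> \<in> P \<Longrightarrow> b \<in> B \<Longrightarrow> coord \<alpha> b \<ge> 0"
  using pos_coord by fastforce

lemma pos_or_neg: "\<alpha> \<in> \<Delta> \<Longrightarrow> \<alpha> \<in> P \<or> - \<alpha> \<in> P"
  using base unfolding root_base_def by auto

lemma not_pos_and_neg: "\<alpha> \<in> P \<Longrightarrow> - \<alpha> \<notin> P"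
proof
  assume \<alpha>: "\<alpha> \<in> P" "- \<alpha> \<in> P"
  have "coord \<alpha> b = 0" if "b \<in> B" for b
    using pos_coord_nonneg[OF \<alpha>(1) that] pos_coord_nonneg[OF \<alpha>(2) that] by (simp add: coord_linear)
  then have "\<alpha> = 0" using coord_sum[of \<alpha>] by simp
  then show False using \<alpha> pos_imp_root zero_notin_roots by blast
qed

lemma neg_pos_iff: "\<alpha> \<in> \<Delta> \<Longrightarrow> - \<alpha> \<in> P \<longleftrightarrow> \<alpha> \<notin> P"
  using pos_or_neg not_pos_and_neg by blast

lemma simple_pos: "b \<in> B \<Longrightarrow> b \<in> P"
proof (rule ccontr)
  assume b: "b \<in> B" "b \<notin> P"
  then have "- b \<in> P" using pos_or_neg base_subset by blast
  from pos_coord_nonneg[OF this b(1)] show False using b by (simp add: coord_linear coord_base)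
qed

lemma pos_add: "\<alpha> \<in> P \<Longrightarrow> \<beta> \<in> P \<Longrightarrow> \<alpha> + \<beta> \<in> \<Delta> \<Longrightarrow> \<alpha> + \<beta> \<in> P"
proof (rule ccontr)
  assume \<alpha>: "\<alpha> \<in> P" and \<beta>: "\<beta> \<in> P" and sum: "\<alpha> + \<beta> \<in> \<Delta>" "\<alpha> + \<beta> \<notin> P"
  then have neg: "- (\<alpha> + \<beta>) \<in> P" using pos_or_neg by blast
  have "coord (\<alpha> + \<beta>) b = 0" if "b \<in> B" for b
    using pos_coord_nonneg[OF \<alpha> that] pos_coord_nonneg[OF \<beta> that] pos_coord_nonneg[OF neg that]
    by (simp only: coord_linear)
  then have "\<alpha> + \<beta> = 0" using coord_sum[of "\<alpha> + \<beta>"] by simp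
  then show False using sum zero_notin_roots by simp
qed

text \<open>
  A simple reflection changes only the coordinate at its own simple root, so every other positive
  coordinate of a positive root survives.
\<close>

lemma simple_refl_pos:
  assumes b: "b \<in> B" and \<beta>: "\<beta> \<in> P" and ne: "\<beta> \<noteq> b"
  shows "s b \<beta> \<in> P"
proof (rule ccontr)
  have roots: "b \<in> \<Delta>" "\<beta> \<in> \<Delta>" using assms base_subset pos_imp_root by auto
  assume "s b \<beta> \<notin> P"
  then have neg: "- s b \<beta> \<in> P" using pos_or_neg refl_root roots by blast
  have zero: "coord \<beta> b' = 0" if "b' \<in> B" "b' \<noteq> b" for b'
    using pos_coord_nonneg[OF neg that(1)] pos_coord_nonneg[OF \<beta> that(1)] that b roots
    by (simp add: refl_eq coord_linear coord_base)
  have "\<beta> = (\<Sum>b'\<in>B. if b' = b then coord \<beta> b *\<^sub>R b else 0)"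
    by (subst coord_sum[of \<beta>, symmetric], intro sum.cong) (auto simp: zero)
  then have eq: "\<beta> = coord \<beta> b *\<^sub>R b" using finite_base b by simp
  then have "coord \<beta> b = 1 \<or> coord \<beta> b = - 1" using proportional_roots[of b] roots by metis
  then show False using eq ne pos_coord_nonneg[OF \<beta> b] by auto
qed

lemma height_add: "\<alpha> \<in> \<Delta> \<Longrightarrow> \<beta> \<in> \<Delta> \<Longrightarrow> \<alpha> + \<beta> \<in> \<Delta> \<Longrightarrow> height (\<alpha> + \<beta>) = height \<alpha> + height \<beta>"
  unfolding height_def by (simp add: inner_coroot inner_add_right algebra_simps)

text \<open>
  The reflection in a simple root \<open>b\<close> permutes the other positive roots, so the sum of these
  is orthogonal to \<open>b\<close>, and only \<open>b\<close> itself contributes to the height of \<open>b\<close>.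
\<close>

lemma height_simple:
  assumes b: "b \<in> B"
  shows "height b = 1"
proof -
  have root: "b \<in> \<Delta>" using b base_subset by auto
  have fin: "finite P" using finite_roots pos_imp_root by (meson finite_subset subsetI)
  have inv: "s b \<beta> \<in> P - {b}" if "\<beta> \<in> P - {b}" for \<beta>
  proof -
    have "s b \<beta> \<noteq> b"
    proof
      assume "s b \<beta> = b"
      then have "\<beta> = - b" using refl_refl[OF root, of \<beta>] refl_self[OF root] by simp
      then show False using that not_pos_and_neg[of b] simple_pos[OF b] by auto
    qed
    then show ?thesis using simple_refl_pos[OF b] that by auto
  qed
  have "(\<Sum>\<beta>\<in>P - {b}. \<beta> \<bullet> coroot b) = (\<Sum>\<beta>\<in>P - {b}. s b \<beta> \<bullet> coroot b)"
    by (rule sum.reindex_bij_witness[of _ "s b" "s b"])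
      (use inv refl_refl[OF root] in auto)
  also have "\<dots> = - (\<Sum>\<beta>\<in>P - {b}. \<beta> \<bullet> coroot b)"
    unfolding sum_negf[symmetric]
    by (intro sum.cong) (auto simp: refl_eq[OF root] inner_diff_left coroot_self[OF root])
  finally have "(\<Sum>\<beta>\<in>P - {b}. \<beta> \<bullet> coroot b) = 0" by simp
  then have "(\<Sum>\<beta>\<in>P. \<beta> \<bullet> coroot b) = 2"
    using fin simple_pos[OF b] coroot_self[OF root] by (simp add: sum.remove[of P b])
  then show ?thesis unfolding height_def weyl_vector_def by (simp add: inner_sum_left)
qed

lemma height_pos_nat:
  assumes \<alpha>: "\<alpha> \<in> P"
  shows "\<exists>n::nat. height \<alpha> = real n \<and> n \<ge> 1"
proof -
  have root: "\<alpha> \<in> \<Delta>" using \<alpha> pos_imp_root by auto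
  obtain c where c: "\<And>b. b \<in> B \<Longrightarrow> coord \<alpha> b = real (c b)" using pos_coord[OF \<alpha>] by metis
  have "height \<alpha> = coscale * (weyl_vector \<Delta> B \<bullet> (\<Sum>b\<in>B. coord \<alpha> b *\<^sub>R b))"
    unfolding height_def coord_sum by (simp add: inner_coroot root)
  also have "\<dots> = (\<Sum>b\<in>B. coord \<alpha> b * height b)"
    unfolding height_def inner_sum_right sum_distrib_left
    using base_subset by (intro sum.cong) (auto simp: inner_coroot subset_iff)
  also have "\<dots> = real (\<Sum>b\<in>B. c b)" by (simp add: height_simple c)
  finally have h: "height \<alpha> = real (\<Sum>b\<in>B. c b)" .
  moreover have "(\<Sum>b\<in>B. c b) \<noteq> 0"
  proof
    assume "(\<Sum>b\<in>B. c b) = 0"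
    then have "\<alpha> = 0" using coord_sum[of \<alpha>] c finite_base by simp
    then show False using root zero_notin_roots by simp
  qed
  ultimately show ?thesis by (metis One_nat_def Suc_leI not_gr_zero)
qed

text \<open>Some simple root has positive inner product with \<open>\<beta>\<close>, as \<open>\<beta>\<close> has with itself.\<close>

lemma descend_height:
  assumes \<beta>: "\<beta> \<in> P" and ns: "\<beta> \<notin> B"
  shows "\<exists>b\<in>B. s b \<beta> = \<beta> - b \<and> \<beta> - b \<in> P \<and> height (\<beta> - b) = height \<beta> - 1"
proof -
  have root: "\<beta> \<in> \<Delta>" using \<beta> pos_imp_root by auto
  have "\<exists>b\<in>B. \<beta> \<bullet> b > 0"
  proof (rule ccontr)
    assume neg: "\<not> (\<exists>b\<in>B. \<beta> \<bullet> b > 0)"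
    have "\<beta> \<bullet> \<beta> = \<beta> \<bullet> (\<Sum>b\<in>B. coord \<beta> b *\<^sub>R b)" by (simp only: coord_sum)
    also have "\<dots> = (\<Sum>b\<in>B. coord \<beta> b * (\<beta> \<bullet> b))" by (simp add: inner_sum_right)
    also have "\<dots> \<le> 0"
      using neg pos_coord_nonneg[OF \<beta>] by (intro sum_nonpos mult_nonneg_nonpos) auto
    finally have "\<beta> = 0" by (metis inner_gt_zero_iff not_less)
    then show False using root zero_notin_roots by simp
  qed
  then obtain b where b: "b \<in> B" "\<beta> \<bullet> b > 0" by auto
  have broot: "b \<in> \<Delta>" using b base_subset by auto
  have "\<beta> \<bullet> coroot b > 0" using b broot coscale_pos by (simp add: inner_coroot)
  moreover have "\<beta> \<noteq> b" "\<beta> \<noteq> - b" using b(1) ns \<beta> not_pos_and_neg[of b] simple_pos[of b] by auto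
  ultimately have "\<beta> \<bullet> coroot b = 1" using pairing_cases[OF root broot] by auto
  then have sb: "s b \<beta> = \<beta> - b" by (simp add: refl_eq broot)
  then have "\<beta> - b \<in> P" using simple_refl_pos[OF b(1) \<beta>] \<open>\<beta> \<noteq> b\<close> by simp
  moreover from this have "height \<beta> = height (\<beta> - b) + height b"
    using height_add[of "\<beta> - b" b] broot root pos_imp_root by simp
  ultimately show ?thesis using sb b(1) height_simple by force
qed

text \<open>
  A positive root that is not simple can be lowered by a simple root, and heights of positive roots are
  at least one.
\<close>

lemma simple_iff_height_one:
  assumes \<beta>: "\<beta> \<in> P"
  shows "\<beta> \<in> B \<longleftrightarrow> height \<beta> = 1"
proof
  assume h: "height \<beta> = 1"
  show "\<beta> \<in> B"
  proof (rule ccontr)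
    assume "\<beta> \<notin> B"
    then obtain b where "\<beta> - b \<in> P" "height (\<beta> - b) = 0" using descend_height[OF \<beta>] h by auto
    then show False using height_pos_nat by fastforce
  qed
qed (rule height_simple)

end

section \<open>Lengths and edges of the quantum Bruhat graph\<close>

context simply_laced_base
begin

lemma refl_word_Nil: "refl_word [] = id"
  and refl_word_Cons: "refl_word (a # as) = s a \<circ> refl_word as"
  unfolding refl_word_def by simp_all

lemma refl_word_append: "refl_word (as @ bs) = refl_word as \<circ> refl_word bs"
  by (induction as) (simp_all add: refl_word_Nil refl_word_Cons comp_assoc)

lemma refl_word_rev: "set as \<subseteq> \<Delta> \<Longrightarrow> refl_word (rev as) \<circ> refl_word as = id"
proof (induction as)
  case (Cons a as)
  have "refl_word (rev (a # as)) \<circ> refl_word (a # as) = refl_word (rev as) \<circ> (s a \<circ> s a) \<circ> refl_word as"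
    by (simp add: refl_word_append refl_word_Nil refl_word_Cons comp_assoc)
  then show ?case using Cons refl_comp_refl by simp
qed (simp add: refl_word_Nil)

lemma weylE:
  assumes "x \<in> W"
  obtains as where "set as \<subseteq> \<Delta>" "x = refl_word as"
  using assms unfolding weyl_group_def by auto

lemma weylI: "set as \<subseteq> \<Delta> \<Longrightarrow> refl_word as \<in> W"
  unfolding weyl_group_def by auto

lemma weyl_comp: "x \<in> W \<Longrightarrow> y \<in> W \<Longrightarrow> x \<circ> y \<in> W"
  by (elim weylE) (simp add: refl_word_append[symmetric] weylI)

lemma weyl_refl: "\<alpha> \<in> \<Delta> \<Longrightarrow> s \<alpha> \<in> W"
  using weylI[of "[\<alpha>]"] by (simp add: refl_word_Nil refl_word_Cons)

lemma weyl_bij: "x \<in> W \<Longrightarrow> bij x" and weyl_inv: "x \<in> W \<Longrightarrow> inv x \<in> W"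
proof -
  assume "x \<in> W"
  then obtain as where as: "set as \<subseteq> \<Delta>" "x = refl_word as" by (rule weylE)
  have "refl_word (rev as) \<circ> x = id" "x \<circ> refl_word (rev as) = id"
    using as refl_word_rev[of as] refl_word_rev[of "rev as"] by simp_all
  then have "bij x" "inv x = refl_word (rev as)" by (auto intro: o_bij inv_unique_comp)
  then show "bij x" "inv x \<in> W" using as weylI[of "rev as"] by auto
qed

lemma weyl_inv_apply: "x \<in> W \<Longrightarrow> inv x (x v) = v" "x \<in> W \<Longrightarrow> x (inv x v) = v"
  using weyl_bij by (auto simp: bij_def surj_f_inv_f)

lemma weyl_linear: "x \<in> W \<Longrightarrow> linear x"
proof (elim weylE)
  fix as assume "x = refl_word as"
  moreover have "linear (refl_word as)"
    by (induction as) (simp_all only: refl_word_Nil refl_word_Cons linear_id linear_compose linear_refl)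
  ultimately show ?thesis by simp
qed

lemma weyl_root: "x \<in> W \<Longrightarrow> \<alpha> \<in> \<Delta> \<Longrightarrow> x \<alpha> \<in> \<Delta>"
proof (elim weylE)
  fix as assume "\<alpha> \<in> \<Delta>" "set as \<subseteq> \<Delta>" "x = refl_word as"
  moreover from this(1,2) have "refl_word as \<alpha> \<in> \<Delta>"
    by (induction as) (simp_all add: refl_word_Nil refl_word_Cons refl_root)
  ultimately show ?thesis by simp
qed

lemma weyl_inner: "x \<in> W \<Longrightarrow> x u \<bullet> x v = u \<bullet> v"
proof (elim weylE)
  fix as assume "set as \<subseteq> \<Delta>" "x = refl_word as"
  moreover from this(1) have "refl_word as u \<bullet> refl_word as v = u \<bullet> v"
    by (induction as) (simp_all add: refl_word_Nil refl_word_Cons inner_refl)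
  ultimately show ?thesis by simp
qed

lemma weyl_pairing: "x \<in> W \<Longrightarrow> \<alpha> \<in> \<Delta> \<Longrightarrow> x v \<bullet> coroot (x \<alpha>) = v \<bullet> coroot \<alpha>"
  by (simp add: inner_coroot weyl_root weyl_inner)

lemma weyl_conj_refl: "x \<in> W \<Longrightarrow> \<alpha> \<in> \<Delta> \<Longrightarrow> x \<circ> s \<alpha> = s (x \<alpha>) \<circ> x"
  by (simp add: fun_eq_iff refl_eq weyl_root weyl_pairing linear_diff[OF weyl_linear] linear_scale[OF weyl_linear])

lemma refl_left_right: "x \<in> W \<Longrightarrow> \<gamma> \<in> \<Delta> \<Longrightarrow> s \<gamma> \<circ> x = x \<circ> s (inv x \<gamma>)"
  using weyl_conj_refl[of x "inv x \<gamma>"] by (simp add: weyl_root weyl_inv weyl_inv_apply)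

text \<open>
  Induction on the height: if \<open>b\<close> is simple and \<open>s\<^sub>b \<beta> = \<beta> - b\<close>, then conjugating a word for the
  reflection in \<open>\<beta> - b\<close> by \<open>s\<^sub>b\<close> gives one for \<open>\<beta>\<close>, two letters longer.
\<close>

lemma refl_simple_word:
  assumes "\<beta> \<in> P"
  shows "\<exists>as. set as \<subseteq> B \<and> s \<beta> = refl_word as \<and> real (length as) + 1 = 2 * height \<beta>"
proof -
  obtain n :: nat where "height \<beta> = real n" using height_pos_nat[OF assms] by auto
  then show ?thesis using assms
  proof (induction n arbitrary: \<beta>)
    case 0
    then show ?case using height_pos_nat by fastforce
  next
    case (Suc n)
    show ?case
    proof (cases "\<beta> \<in> B")
      case True
      then show ?thesis
        by (intro exI[of _ "[\<beta>]"]) (simp add: refl_word_Nil refl_word_Cons height_simple)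
    next
      case False
      then obtain b where b: "b \<in> B" "s b \<beta> = \<beta> - b" "\<beta> - b \<in> P" "height (\<beta> - b) = height \<beta> - 1"
        using descend_height Suc.prems(2) by blast
      then obtain as where as: "set as \<subseteq> B" "s (\<beta> - b) = refl_word as"
        "real (length as) + 1 = 2 * height (\<beta> - b)"
        using Suc.IH[of "\<beta> - b"] Suc.prems(1) by auto
      have "b \<in> \<Delta>" "\<beta> \<in> \<Delta>" using b base_subset Suc.prems(2) pos_imp_root by auto
      then have "s b \<circ> s \<beta> = s (\<beta> - b) \<circ> s b" using weyl_conj_refl[of "s b" \<beta>] weyl_refl b(2) by simp
      then have "s b \<circ> (s b \<circ> s \<beta>) = s b \<circ> (s (\<beta> - b) \<circ> s b)" by simp
      then have "s \<beta> = refl_word (b # as @ [b])"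
        using refl_comp_refl[OF \<open>b \<in> \<Delta>\<close>] as(2)
        by (simp add: refl_word_Cons refl_word_append refl_word_Nil comp_assoc[symmetric])
      then show ?thesis using as b by (intro exI[of _ "b # as @ [b]"]) auto
    qed
  qed
qed

lemma weyl_simple_word:
  assumes "x \<in> W"
  shows "\<exists>as. set as \<subseteq> B \<and> x = refl_word as"
proof -
  obtain as where as: "set as \<subseteq> \<Delta>" "x = refl_word as" using assms by (rule weylE)
  from as(1) have "\<exists>bs. set bs \<subseteq> B \<and> refl_word as = refl_word bs"
  proof (induction as)
    case Nil
    then show ?case by (intro exI[of _ "[]"]) simp
  next
    case (Cons a as)
    then obtain bs where bs: "set bs \<subseteq> B" "refl_word as = refl_word bs" by auto
    obtain cs where "set cs \<subseteq> B" "s a = refl_word cs"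
      using refl_simple_word[of a] refl_simple_word[of "- a"] pos_or_neg[of a] Cons.prems
      by (auto simp: refl_uminus)
    then show ?case using bs by (intro exI[of _ "cs @ bs"]) (simp add: refl_word_Cons refl_word_append)
  qed
  then show ?thesis using as by auto
qed

lemma len_le: "set as \<subseteq> B \<Longrightarrow> len (refl_word as) \<le> length as"
  unfolding weyl_length_def by (rule Least_le) auto

lemma len_word:
  assumes "x \<in> W"
  obtains as where "set as \<subseteq> B" "x = refl_word as" "length as = len x"
proof -
  obtain as where "set as \<subseteq> B" "x = refl_word as" using weyl_simple_word[OF assms] by auto
  then have "\<exists>n as. length as = n \<and> set as \<subseteq> B \<and> x = refl_word as" by blast
  then have "\<exists>as. length as = len x \<and> set as \<subseteq> B \<and> x = refl_word as"
    unfolding weyl_length_def by (rule LeastI_ex)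
  then show thesis using that by blast
qed

lemma len_comp:
  assumes "x \<in> W" "y \<in> W"
  shows "len (x \<circ> y) \<le> len x + len y"
proof -
  obtain as where as: "set as \<subseteq> B" "x = refl_word as" "length as = len x" using assms(1) by (rule len_word)
  obtain bs where bs: "set bs \<subseteq> B" "y = refl_word bs" "length bs = len y" using assms(2) by (rule len_word)
  show ?thesis using len_le[of "as @ bs"] as bs by (simp add: refl_word_append)
qed

text \<open>
  The exchange property.  Reading the word from the right, \<open>\<delta>\<close> becomes negative at some letter
  \<open>a\<close>; at that point it is \<open>a\<close> itself, and multiplication by the reflection in \<open>\<delta>\<close> deletes
  this letter.
\<close>

lemma exchange:
  assumes "set as \<subseteq> B" "\<delta> \<in> P" "refl_word as \<delta> \<notin> P"
  shows "\<exists>bs. set bs \<subseteq> B \<and> refl_word as \<circ> s \<delta> = refl_word bs \<and> length bs + 1 = length as"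
  using assms
proof (induction as)
  case Nil
  then show ?case by (simp add: refl_word_Nil)
next
  case (Cons a as)
  have root: "\<delta> \<in> \<Delta>" "a \<in> \<Delta>" "a \<in> B" "set as \<subseteq> \<Delta>" using Cons.prems pos_imp_root base_subset by auto
  show ?case
  proof (cases "refl_word as \<delta> \<in> P")
    case True
    then have a: "refl_word as \<delta> = a"
      using simple_refl_pos[of a "refl_word as \<delta>"] Cons.prems by (auto simp: refl_word_Cons)
    have "refl_word (a # as) \<circ> s \<delta> = s a \<circ> (refl_word as \<circ> s \<delta>)" by (simp add: refl_word_Cons comp_assoc)
    also have "\<dots> = s a \<circ> s a \<circ> refl_word as"
      using weyl_conj_refl[OF weylI[OF root(4)] root(1)] a by (simp add: comp_assoc)
    also have "\<dots> = refl_word as" using refl_comp_refl[OF root(2)] by simp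
    finally show ?thesis using Cons.prems by (intro exI[of _ as]) auto
  next
    case False
    then obtain bs where "set bs \<subseteq> B" "refl_word as \<circ> s \<delta> = refl_word bs" "length bs + 1 = length as"
      using Cons.IH Cons.prems(2) \<open>set (a # as) \<subseteq> B\<close> by (meson set_subset_Cons subset_trans)
    moreover from this have "refl_word (a # as) \<circ> s \<delta> = refl_word (a # bs)"
      by (metis comp_assoc refl_word_Cons)
    ultimately show ?thesis using root(3) by (intro exI[of _ "a # bs"]) auto
  qed
qed

lemma comp_refl_twice: "\<delta> \<in> \<Delta> \<Longrightarrow> x \<circ> s \<delta> \<circ> s \<delta> = x"
  by (simp add: comp_assoc refl_comp_refl)

lemma len_down:
  assumes x: "x \<in> W" and \<delta>: "\<delta> \<in> P" and neg: "x \<delta> \<notin> P"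
  shows "len (x \<circ> s \<delta>) < len x"
proof -
  obtain as where as: "set as \<subseteq> B" "x = refl_word as" "length as = len x" using x by (rule len_word)
  then obtain bs where "set bs \<subseteq> B" "x \<circ> s \<delta> = refl_word bs" "length bs + 1 = length as"
    using exchange[of as \<delta>] \<delta> neg by auto
  then show ?thesis using len_le[of bs] as by simp
qed

lemma len_up:
  assumes x: "x \<in> W" and \<delta>: "\<delta> \<in> P" and pos: "x \<delta> \<in> P"
  shows "len x < len (x \<circ> s \<delta>)"
proof -
  have root: "\<delta> \<in> \<Delta>" using \<delta> pos_imp_root by auto
  have "(x \<circ> s \<delta>) \<delta> = - x \<delta>" using refl_self[OF root] by (simp add: linear_neg[OF weyl_linear[OF x]])
  then have "(x \<circ> s \<delta>) \<delta> \<notin> P" using not_pos_and_neg pos by auto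
  from len_down[OF weyl_comp[OF x weyl_refl[OF root]] \<delta> this] show ?thesis
    unfolding comp_refl_twice[OF root] .
qed

text \<open>
  A word for the reflection in \<open>\<delta>\<close> has \<open>2 height \<delta> - 1\<close> letters.
\<close>

lemma len_change_bound:
  assumes x: "x \<in> W" and \<delta>: "\<delta> \<in> P"
  shows "real (len x) + 1 \<le> real (len (x \<circ> s \<delta>)) + 2 * height \<delta>"
proof -
  have root: "\<delta> \<in> \<Delta>" using \<delta> pos_imp_root by auto
  obtain as where "set as \<subseteq> B" "s \<delta> = refl_word as" "real (length as) + 1 = 2 * height \<delta>"
    using refl_simple_word[OF \<delta>] by auto
  then have "real (len (s \<delta>)) + 1 \<le> 2 * height \<delta>" using len_le[of as] by auto
  moreover have "len x \<le> len (x \<circ> s \<delta>) + len (s \<delta>)"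
    using len_comp[OF weyl_comp[OF x weyl_refl[OF root]] weyl_refl[OF root]]
    by (simp add: comp_refl_twice root)
  ultimately show ?thesis by linarith
qed

text \<open>
  The label of an edge is determined by its end points and can be dropped.
\<close>

definition edge :: "('a \<Rightarrow> 'a) \<Rightarrow> ('a \<Rightarrow> 'a) \<Rightarrow> bool" where
  "edge x y \<longleftrightarrow> (\<exists>\<alpha>. qbg_edge \<Delta> B x \<alpha> y)"

text \<open>
  Positive roots have height at least one, so a quantum edge never lengthens; hence the sign of \<open>x \<delta>\<close> decides
  which of the two kinds the edge can be.
\<close>

lemma edge_iff:
  assumes x: "x \<in> W" and \<delta>: "\<delta> \<in> P"
  shows "edge x (x \<circ> s \<delta>) \<longleftrightarrow>
    (if x \<delta> \<in> P then len (x \<circ> s \<delta>) = len x + 1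
     else real (len (x \<circ> s \<delta>)) + 2 * height \<delta> = real (len x) + 1)"
proof -
  have root: "\<delta> \<in> \<Delta>" using \<delta> pos_imp_root by auto
  have unique: "\<alpha> = \<delta>" if "\<alpha> \<in> P" "x \<circ> s \<delta> = x \<circ> s \<alpha>" for \<alpha>
  proof -
    have "inv x \<circ> x = id" using weyl_bij[OF x] by (simp add: bij_is_inj)
    then have "s \<delta> = s \<alpha>" using that(2) by (metis comp_assoc id_comp)
    then show ?thesis using refl_eq_imp[of \<delta> \<alpha>] root that(1) \<delta> pos_imp_root not_pos_and_neg by auto
  qed
  have "edge x (x \<circ> s \<delta>) \<longleftrightarrow> (len (x \<circ> s \<delta>) = len x + 1
     \<or> real (len (x \<circ> s \<delta>)) = real (len x) - 2 * height \<delta> + 1)"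
    unfolding edge_def qbg_edge_def height_def
    using x \<delta> weyl_comp[OF x weyl_refl[OF root]] unique by blast
  moreover obtain n :: nat where "height \<delta> = real n" "n \<ge> 1" using height_pos_nat[OF \<delta>] by auto
  ultimately show ?thesis using len_up[OF x \<delta>] len_down[OF x \<delta>] by (cases "x \<delta> \<in> P") auto
qed

lemma bruhat_less_len: "bruhat_less \<Delta> B x y \<Longrightarrow> len x < len y"
  unfolding bruhat_less_def by (induction rule: tranclp_induct) auto

text \<open>
  Lengths increase along a chain of the Bruhat order, and one reflection that lengthens is already a chain.
\<close>

lemma bruhat_less_refl_iff:
  assumes x: "x \<in> W" and \<gamma>: "\<gamma> \<in> \<Delta>"
  shows "bruhat_less \<Delta> B (s \<gamma> \<circ> x) x \<longleftrightarrow> len (s \<gamma> \<circ> x) < len x"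
proof
  assume less: "len (s \<gamma> \<circ> x) < len x"
  define \<delta> where "\<delta> = inv x \<gamma>"
  have \<delta>: "\<delta> \<in> \<Delta>" "s \<gamma> \<circ> x = x \<circ> s \<delta>"
    unfolding \<delta>_def using x \<gamma> by (simp_all add: weyl_root weyl_inv refl_left_right)
  have "x = (s \<gamma> \<circ> x) \<circ> s \<delta>" unfolding \<delta>(2) by (simp add: comp_refl_twice \<delta>)
  then show "bruhat_less \<Delta> B (s \<gamma> \<circ> x) x"
    unfolding bruhat_less_def using less \<delta>(1) weyl_comp[OF weyl_refl[OF \<gamma>] x]
    by (intro tranclp.r_into_trancl) auto
qed (rule bruhat_less_len)

end

section \<open>Yang-Baxter equations for transfer operators\<close>

text \<open>
  The sum over the continuations of a walk by a step along a positive root \<open>\<gamma>\<close>, in terms of numbers: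
  \<open>\<delta> = inv x \<gamma>\<close> has height \<open>\<eta>\<close>, the lengths of \<open>x\<close> and \<open>s\<^sub>\<gamma> x\<close> are \<open>l\<close> and \<open>l'\<close>, and \<open>g\<close> and \<open>g'\<close> evaluate
  the rest of the walk from there.  If \<open>\<delta>\<close> is negative, then a decorated stay and a crossing both add
  \<open>- \<delta>\<close> to the quantum weight \<open>q\<close>, with opposite signs.
\<close>

definition positive_step ::
    "real \<Rightarrow> 'a::ab_group_add \<Rightarrow> real \<Rightarrow> real \<Rightarrow> ('a \<Rightarrow> int) \<Rightarrow> ('a \<Rightarrow> int) \<Rightarrow> 'a \<Rightarrow> int" where
  "positive_step \<eta> \<delta> l l' g g' q =
     (if \<eta> > 0 then g q - (if l' = l + 1 then g' q else 0)
      else g q - (if \<eta> = - 1 then g (q - \<delta>) else 0) + (if l' = l + 2 * \<eta> + 1 then g' (q - \<delta>) else 0))"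

text \<open>
  The bounds on the change of length, with the direction given by the sign of the height.
\<close>

definition length_gap :: "real \<Rightarrow> real \<Rightarrow> real \<Rightarrow> bool" where
  "length_gap \<eta> l l' \<longleftrightarrow> (if \<eta> > 0 then l + 1 \<le> l' \<and> l' + 1 \<le> l + 2 * \<eta>
                                 else l' + 1 \<le> l \<and> l + 1 \<le> l' - 2 * \<eta>)"

text \<open>
  The six functions belong to the elements \<open>x\<close>, \<open>s\<^sub>\<alpha> x\<close>, \<open>s\<^sub>\<beta> x\<close>, \<open>s\<^sub>\<alpha> s\<^sub>\<beta> x\<close>, \<open>s\<^sub>\<beta> s\<^sub>\<alpha> x\<close> and \<open>s\<^sub>\<alpha>\<^sub>+\<^sub>\<beta> x\<close>
  of a coset of a dihedral group, with \<open>a = inv x \<alpha>\<close> and \<open>b = inv x \<beta>\<close>.  The two sides run through \<open>\<alpha>, \<alpha> + \<beta>, \<beta>\<close>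
  and \<open>\<beta>, \<alpha> + \<beta>, \<alpha>\<close>.  The signs of \<open>a\<close>, \<open>b\<close> and \<open>a + b\<close> decide which steps go up.  Once these are
  fixed, the bounds on the gaps show that a pair of consecutive edges exists if and only if another pair with the
  same end points does, because both would realise the same least total change of length.
\<close>

lemma dihedral_identity:
  fixes A B l0 la lb lab lba lw :: real and a b :: "'a::ab_group_add"
    and g0 ga gb gab gba gw :: "'a \<Rightarrow> int"
  assumes heights: "\<bar>A\<bar> \<ge> 1" "\<bar>B\<bar> \<ge> 1" "\<bar>A + B\<bar> \<ge> 1"
    and "length_gap A l0 la" "length_gap B l0 lb" "length_gap (A + B) l0 lw"
      "length_gap B la lab" "length_gap (A + B) la lba"
      "length_gap A lb lba" "length_gap (A + B) lb lab"
      "length_gap A lab lw" "length_gap B lba lw"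
  shows "positive_step A a l0 la
      (positive_step (A + B) (a + b) l0 lw (positive_step B b l0 lb g0 gb) (positive_step (- A) (- a) lw lab gw gab))
      (positive_step B b la lab (positive_step (A + B) (a + b) la lba ga gba) (positive_step A a lab lw gab gw)) q
    = positive_step B b l0 lb
      (positive_step (A + B) (a + b) l0 lw (positive_step A a l0 la g0 ga) (positive_step (- B) (- b) lw lba gw gba))
      (positive_step A a lb lba (positive_step (A + B) (a + b) lb lab gb gab) (positive_step B b lba lw gba gw)) q"
proof -
  consider "A \<ge> 1" "B \<ge> 1" | "A \<le> - 1" "A + B \<ge> 1" | "A \<ge> 1" "B \<le> - 1" "A + B \<ge> 1"
    | "A \<le> - 1" "B \<le> - 1" | "A \<le> - 1" "B \<ge> 1" "A + B \<le> - 1" | "A \<ge> 1" "A + B \<le> - 1"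
    using heights by linarith
  then show ?thesis
  proof cases
    case 1
    then show ?thesis using assms unfolding positive_step_def length_gap_def
      by simp
  next
    case 2
    then show ?thesis using assms unfolding positive_step_def length_gap_def
      by (simp add: algebra_simps)
  next
    case 3
    then show ?thesis using assms unfolding positive_step_def length_gap_def
      by (simp add: algebra_simps)
  next
    case 4
    then show ?thesis using assms unfolding positive_step_def length_gap_def
      by (simp add: algebra_simps)
  next
    case 5
    then show ?thesis using assms unfolding positive_step_def length_gap_def
      by (simp add: algebra_simps)
  next
    case 6
    then show ?thesis using assms unfolding positive_step_def length_gap_def
      by (simp add: algebra_simps)
  qed
qed

context simply_laced_base
begin

text \<open>
  In direction \<open>\<gamma>\<close> at \<open>x\<close> a crossing contributes the following sign and the following increment of the
  quantum weight.
\<close>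

definition crossing_sign :: "'a \<Rightarrow> ('a \<Rightarrow> 'a) \<Rightarrow> int" where
  "crossing_sign \<gamma> x = (if inv x \<gamma> \<in> P then - 1 else 1)"

definition descent_root :: "'a \<Rightarrow> ('a \<Rightarrow> 'a) \<Rightarrow> 'a" where
  "descent_root \<gamma> x = (if len (s \<gamma> \<circ> x) < len x then root_abs \<Delta> B (inv x \<gamma>) else 0)"

text \<open>
  \<open>G x q\<close> evaluates the rest of a walk from its current element and quantum weight; the operator sums this
  over the continuations by one step in direction \<open>\<gamma>\<close>.  The middle term comes from the stay decorated by \<open>1\<close>.
  Outside the Weyl group the operator is the identity, so that equations between operators hold without side
  conditions.
\<close>

definition local_op :: "'a \<Rightarrow> (('a \<Rightarrow> 'a) \<Rightarrow> 'a \<Rightarrow> int) \<Rightarrow> ('a \<Rightarrow> 'a) \<Rightarrow> 'a \<Rightarrow> int" where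
  "local_op \<gamma> G x q =
     (if x \<in> W then
        G x q - (if - inv x \<gamma> \<in> B then G x (q - inv x \<gamma>) else 0)
        + (if edge x (s \<gamma> \<circ> x) then crossing_sign \<gamma> x * G (s \<gamma> \<circ> x) (q + descent_root \<gamma> x) else 0)
      else G x q)"

lemma inv_refl_comp: "x \<in> W \<Longrightarrow> \<gamma> \<in> \<Delta> \<Longrightarrow> inv (s \<gamma> \<circ> x) v = inv x (s \<gamma> v)"
  using weyl_bij[of x] weyl_bij[OF weyl_refl, of \<gamma>] inv_unique_comp[OF refl_comp_refl refl_comp_refl]
  by (simp add: o_inv_distrib)

lemma inv_linear:
  assumes "x \<in> W"
  shows "inv x (u + v) = inv x u + inv x v" "inv x (u - v) = inv x u - inv x v"
    "inv x (- v) = - inv x v" "inv x (c *\<^sub>R v) = c *\<^sub>R inv x v"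
  using weyl_linear[OF weyl_inv[OF assms]]
  by (simp_all add: linear_add linear_diff linear_neg linear_scale)

lemma height_uminus: "\<delta> \<in> \<Delta> \<Longrightarrow> height (- \<delta>) = - height \<delta>"
  unfolding height_def by (simp add: inner_coroot uminus_root)

lemma height_abs: "\<delta> \<in> \<Delta> \<Longrightarrow> \<bar>height \<delta>\<bar> \<ge> 1"
  using height_pos_nat[of \<delta>] height_pos_nat[of "- \<delta>"] height_uminus[of \<delta>] pos_or_neg[of \<delta>] by force

lemma height_pos_iff: "\<delta> \<in> \<Delta> \<Longrightarrow> height \<delta> > 0 \<longleftrightarrow> \<delta> \<in> P"
  using height_pos_nat[of \<delta>] height_pos_nat[of "- \<delta>"] height_uminus[of \<delta>] pos_or_neg[of \<delta>] by force

lemma neg_simple_iff: "\<delta> \<in> \<Delta> \<Longrightarrow> - \<delta> \<in> B \<longleftrightarrow> height \<delta> = - 1"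
  using simple_iff_height_one[of "- \<delta>"] height_uminus[of \<delta>] height_pos_iff[of "- \<delta>"]
    simple_pos[of "- \<delta>"] uminus_root[of \<delta>] by auto

text \<open>
  Crossing in direction \<open>\<gamma>\<close> multiplies \<open>x\<close> on the right by the reflection in the positive one of
  \<open>inv x \<gamma>\<close> and \<open>- inv x \<gamma>\<close>; it shortens
  \<open>x\<close> exactly if \<open>x\<close> maps this root to a negative one.
\<close>

lemma cross_facts:
  assumes x: "x \<in> W" and \<gamma>: "\<gamma> \<in> \<Delta>"
  defines "\<delta> \<equiv> inv x \<gamma>" and "y \<equiv> s \<gamma> \<circ> x"
  shows "\<delta> \<in> \<Delta>"
    and "len y < len x \<longleftrightarrow> (\<delta> \<in> P) \<noteq> (\<gamma> \<in> P)"
    and "if (\<delta> \<in> P) = (\<gamma> \<in> P)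
      then len x < len y \<and> real (len y) + 1 \<le> len x + 2 * \<bar>height \<delta>\<bar>
        \<and> (edge x y \<longleftrightarrow> len y = len x + 1)
      else len y < len x \<and> real (len x) + 1 \<le> len y + 2 * \<bar>height \<delta>\<bar>
        \<and> (edge x y \<longleftrightarrow> real (len y) + 2 * \<bar>height \<delta>\<bar> = real (len x) + 1)"
proof -
  show \<delta>: "\<delta> \<in> \<Delta>" unfolding \<delta>_def using x \<gamma> by (simp add: weyl_root weyl_inv)
  obtain \<epsilon> where \<epsilon>: "\<epsilon> = \<delta> \<or> \<epsilon> = - \<delta>" "\<epsilon> \<in> P" using pos_or_neg[OF \<delta>] by auto
  have y: "y = x \<circ> s \<epsilon>" "y \<in> W" "x = y \<circ> s \<epsilon>"
    using \<epsilon> refl_left_right[OF x \<gamma>] weyl_comp[OF weyl_refl[OF \<gamma>] x] comp_refl_twice[OF \<delta>, of x]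
    unfolding y_def \<delta>_def by (auto simp: refl_uminus)
  have "x \<epsilon> = \<gamma> \<and> \<delta> \<in> P \<or> x \<epsilon> = - \<gamma> \<and> \<delta> \<notin> P"
    using \<epsilon> x not_pos_and_neg[of \<epsilon>] linear_neg[OF weyl_linear[OF x]] unfolding \<delta>_def
    by (auto simp: weyl_inv_apply)
  then have sign: "x \<epsilon> \<in> P \<longleftrightarrow> (\<delta> \<in> P) = (\<gamma> \<in> P)" using neg_pos_iff[OF \<gamma>] by auto
  have h: "height \<epsilon> = \<bar>height \<delta>\<bar>"
    using \<epsilon> height_pos_iff[of \<epsilon>] pos_imp_root[of \<epsilon>] height_uminus[OF \<delta>] by auto
  have facts: "if x \<epsilon> \<in> P then len x < len y else len y < len x"
      "real (len y) + 1 \<le> len x + 2 * height \<epsilon>" "real (len x) + 1 \<le> len y + 2 * height \<epsilon>"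
      "edge x y \<longleftrightarrow> (if x \<epsilon> \<in> P then len y = len x + 1 else real (len y) + 2 * height \<epsilon> = real (len x) + 1)"
    using len_up[OF x \<epsilon>(2)] len_down[OF x \<epsilon>(2)] edge_iff[OF x \<epsilon>(2)]
      len_change_bound[OF x \<epsilon>(2)] len_change_bound[OF y(2) \<epsilon>(2)]
    unfolding y(1)[symmetric] y(3)[symmetric] by simp_all
  show "len y < len x \<longleftrightarrow> (\<delta> \<in> P) \<noteq> (\<gamma> \<in> P)" using facts(1) sign by (auto split: if_splits)
  show "if (\<delta> \<in> P) = (\<gamma> \<in> P)
      then len x < len y \<and> real (len y) + 1 \<le> len x + 2 * \<bar>height \<delta>\<bar>
        \<and> (edge x y \<longleftrightarrow> len y = len x + 1)
      else len y < len x \<and> real (len x) + 1 \<le> len y + 2 * \<bar>height \<delta>\<bar>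
        \<and> (edge x y \<longleftrightarrow> real (len y) + 2 * \<bar>height \<delta>\<bar> = real (len x) + 1)"
    using facts unfolding sign h by presburger
qed

text \<open>
  For a positive \<open>\<gamma>\<close> the crossing goes up exactly if \<open>inv x \<gamma>\<close> is positive, so sign, direction and increment
  of the quantum weight are all governed by the height of \<open>inv x \<gamma>\<close>.
\<close>

lemma local_op_positive:
  assumes x: "x \<in> W" and \<gamma>: "\<gamma> \<in> P"
  shows "local_op \<gamma> G x = positive_step (height (inv x \<gamma>)) (inv x \<gamma>)
      (real (len x)) (real (len (s \<gamma> \<circ> x))) (G x) (G (s \<gamma> \<circ> x))"
    and "length_gap (height (inv x \<gamma>)) (real (len x)) (real (len (s \<gamma> \<circ> x)))"
proof -
  define \<delta> y where "\<delta> = inv x \<gamma>" and "y = s \<gamma> \<circ> x"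
  note facts = cross_facts[OF x pos_imp_root[OF \<gamma>], folded \<delta>_def y_def]
  note signs = height_pos_iff[OF facts(1)] neg_simple_iff[OF facts(1)]
  show "local_op \<gamma> G x = positive_step (height (inv x \<gamma>)) (inv x \<gamma>)
      (real (len x)) (real (len (s \<gamma> \<circ> x))) (G x) (G (s \<gamma> \<circ> x))"
    unfolding \<delta>_def[symmetric] y_def[symmetric]
  proof
    fix q
    show "local_op \<gamma> G x q = positive_step (height \<delta>) \<delta> (real (len x)) (real (len y)) (G x) (G y) q"
    proof (cases "\<delta> \<in> P")
      case True
      then have "height \<delta> > 0" "height \<delta> \<noteq> - 1" "edge x y \<longleftrightarrow> len y = len x + 1" "\<not> len y < len x"
        using facts(3) signs \<gamma> by auto
      then show ?thesis
        unfolding local_op_def positive_step_def \<delta>_def[symmetric] y_def[symmetric]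
          crossing_sign_def descent_root_def signs(2) using True x by auto
    next
      case False
      then have "height \<delta> < 0" using signs height_abs[OF facts(1)] by linarith
      moreover from this have "edge x y \<longleftrightarrow> real (len y) = real (len x) + 2 * height \<delta> + 1" "len y < len x"
        using facts(3) False \<gamma> by auto
      ultimately show ?thesis
        unfolding local_op_def positive_step_def \<delta>_def[symmetric] y_def[symmetric]
          crossing_sign_def descent_root_def signs(2) using False x
        by (auto simp: root_abs_def root_sgn_def)
    qed
  qed
  show "length_gap (height (inv x \<gamma>)) (real (len x)) (real (len (s \<gamma> \<circ> x)))"
    unfolding \<delta>_def[symmetric] y_def[symmetric] length_gap_def signs
    using facts(3) \<gamma> height_abs[OF facts(1)] signs by (cases "\<delta> \<in> P") auto
qed

lemma dihedral_relations:
  assumes "\<alpha> \<in> \<Delta>" "\<beta> \<in> \<Delta>" and pairing: "\<alpha> \<bullet> coroot \<beta> = - 1"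
  shows "\<alpha> + \<beta> \<in> \<Delta>"
    and "s \<alpha> \<beta> = \<alpha> + \<beta>" "s \<beta> \<alpha> = \<alpha> + \<beta>" "s \<alpha> (\<alpha> + \<beta>) = \<beta>" "s \<beta> (\<alpha> + \<beta>) = \<alpha>"
    and "s (\<alpha> + \<beta>) \<alpha> = - \<beta>" "s (\<alpha> + \<beta>) \<beta> = - \<alpha>"
    and "s (\<alpha> + \<beta>) \<circ> s \<alpha> = s \<alpha> \<circ> s \<beta>" "s \<beta> \<circ> s (\<alpha> + \<beta>) = s \<alpha> \<circ> s \<beta>"
    and "s (\<alpha> + \<beta>) \<circ> s \<beta> = s \<beta> \<circ> s \<alpha>" "s \<alpha> \<circ> s (\<alpha> + \<beta>) = s \<beta> \<circ> s \<alpha>"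
proof -
  note p = pairing pairing_sym[OF assms(1,2), unfolded pairing, symmetric] coroot_self[OF assms(1)] coroot_self[OF assms(2)]
  show sab: "s \<alpha> \<beta> = \<alpha> + \<beta>" "s \<beta> \<alpha> = \<alpha> + \<beta>" using p by (simp_all add: refl_eq assms)
  show root: "\<alpha> + \<beta> \<in> \<Delta>" using refl_root[OF assms(1,2)] sab by simp
  show sab2: "s \<alpha> (\<alpha> + \<beta>) = \<beta>" "s \<beta> (\<alpha> + \<beta>) = \<alpha>"
    using refl_refl[OF assms(1)] refl_refl[OF assms(2)] sab by metis+
  have "\<alpha> \<bullet> coroot (\<alpha> + \<beta>) = 1" "\<beta> \<bullet> coroot (\<alpha> + \<beta>) = 1"
    using p assms root by (simp_all add: inner_coroot inner_add_right algebra_simps)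
  then show sw: "s (\<alpha> + \<beta>) \<alpha> = - \<beta>" "s (\<alpha> + \<beta>) \<beta> = - \<alpha>" by (simp_all add: refl_eq root)
  note W = weyl_refl[OF assms(1)] weyl_refl[OF assms(2)] weyl_refl[OF root]
  show "s (\<alpha> + \<beta>) \<circ> s \<alpha> = s \<alpha> \<circ> s \<beta>" using weyl_conj_refl[OF W(1) assms(2)] sab by simp
  show "s \<beta> \<circ> s (\<alpha> + \<beta>) = s \<alpha> \<circ> s \<beta>"
    using weyl_conj_refl[OF W(1) root] weyl_conj_refl[OF W(1) assms(2)] weyl_conj_refl[OF W(2) root] 
      weyl_conj_refl[OF W(3) assms(1)] sab sab2 sw by (simp add: refl_uminus)
  show "s (\<alpha> + \<beta>) \<circ> s \<beta> = s \<beta> \<circ> s \<alpha>" using weyl_conj_refl[OF W(2) assms(1)] sab by simp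
  show "s \<alpha> \<circ> s (\<alpha> + \<beta>) = s \<beta> \<circ> s \<alpha>"
    using weyl_conj_refl[OF W(2) root] weyl_conj_refl[OF W(2) assms(1)] weyl_conj_refl[OF W(1) root] 
      weyl_conj_refl[OF W(3) assms(2)] sab sab2 sw by (simp add: refl_uminus)
qed

text \<open>
  The Yang-Baxter equation for the base \<open>\<alpha>, \<beta>\<close> of a root system of type \<open>A\<^sub>2\<close>.
\<close>

definition braided :: "'a \<Rightarrow> 'a \<Rightarrow> bool" where
  "braided \<alpha> \<beta> \<longleftrightarrow> (\<forall>G. local_op \<alpha> (local_op (\<alpha> + \<beta>) (local_op \<beta> G)) = local_op \<beta> (local_op (\<alpha> + \<beta>) (local_op \<alpha> G)))"

text \<open>
  The roots met along all walks through the segment are listed by \<open>invs\<close> below; they are the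
  arguments of the numerical identity for a dihedral coset.
\<close>

lemma braided_positive:
  assumes pos: "\<alpha> \<in> P" "\<beta> \<in> P" and pairing: "\<alpha> \<bullet> coroot \<beta> = - 1"
  shows "braided \<alpha> \<beta>"
  unfolding braided_def
proof (intro allI ext)
  fix G x q
  have roots: "\<alpha> \<in> \<Delta>" "\<beta> \<in> \<Delta>" using pos pos_imp_root by auto
  note D = dihedral_relations[OF roots pairing]
  have pos': "\<alpha> + \<beta> \<in> P" using pos_add pos D(1) by auto
  show "local_op \<alpha> (local_op (\<alpha> + \<beta>) (local_op \<beta> G)) x q = local_op \<beta> (local_op (\<alpha> + \<beta>) (local_op \<alpha> G)) x q"
  proof (cases "x \<in> W")
    case x: True
    define a b where "a = inv x \<alpha>" and "b = inv x \<beta>"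
    define xa xb xw xab xba where "xa = s \<alpha> \<circ> x" and "xb = s \<beta> \<circ> x" and "xw = s (\<alpha> + \<beta>) \<circ> x"
      and "xab = s \<alpha> \<circ> xb" and "xba = s \<beta> \<circ> xa"
    note xs = xa_def xb_def xw_def xab_def xba_def
    have in_W: "xa \<in> W" "xb \<in> W" "xw \<in> W" "xab \<in> W" "xba \<in> W"
      unfolding xs using x weyl_comp weyl_refl roots D(1) by auto
    have moves: "s \<alpha> \<circ> x = xa" "s \<beta> \<circ> x = xb" "s (\<alpha> + \<beta>) \<circ> x = xw" "s (\<alpha> + \<beta>) \<circ> xa = xab"
      "s (\<alpha> + \<beta>) \<circ> xb = xba" "s \<alpha> \<circ> xb = xab" "s \<beta> \<circ> xa = xba" "s \<beta> \<circ> xw = xab" "s \<alpha> \<circ> xw = xba"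
      unfolding xs comp_assoc[symmetric] D(8-11) by simp_all
    have moves': "s \<beta> \<circ> xab = xw" "s \<alpha> \<circ> xba = xw"
      using moves refl_comp_refl[OF roots(1)] refl_comp_refl[OF roots(2)] by (metis comp_assoc id_comp)+
    have invs: "inv x \<alpha> = a" "inv x \<beta> = b" "inv x (\<alpha> + \<beta>) = a + b"
      "inv xa (\<alpha> + \<beta>) = b" "inv xa \<beta> = a + b" "inv xb (\<alpha> + \<beta>) = a" "inv xb \<alpha> = a + b"
      "inv xw \<alpha> = - b" "inv xw \<beta> = - a" "inv xab \<beta> = a" "inv xba \<alpha> = b"
      unfolding xs a_def b_def using x roots D(1)
      by (simp_all add: inv_refl_comp weyl_comp weyl_refl D(2-7) refl_self inv_linear)
    have ab: "a \<in> \<Delta>" "b \<in> \<Delta>" "a + b \<in> \<Delta>"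
      unfolding invs(3)[symmetric] unfolding a_def b_def
      using roots D(1) weyl_root[OF weyl_inv[OF x]] by auto
    have hts: "height (a + b) = height a + height b" "height (- a) = - height a" "height (- b) = - height b"
      using ab height_add height_uminus by auto
    note step = local_op_positive(1)
    note gap = local_op_positive(2)
    show ?thesis
      unfolding step[OF x pos(1)] step[OF x pos(2)] step[OF x pos'] step[OF in_W(1) pos']
        step[OF in_W(1) pos(2)] step[OF in_W(2) pos'] step[OF in_W(2) pos(1)] step[OF in_W(3) pos(1)]
        step[OF in_W(3) pos(2)] step[OF in_W(4) pos(2)] step[OF in_W(5) pos(1)]
        moves moves' invs hts
    proof (rule dihedral_identity)
      show "1 \<le> \<bar>height a\<bar>" "1 \<le> \<bar>height b\<bar>" "1 \<le> \<bar>height a + height b\<bar>"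
        using height_abs ab hts(1) by metis+
    qed (use gap[OF x pos(1)] gap[OF x pos(2)] gap[OF x pos'] gap[OF in_W(1) pos'] gap[OF in_W(1) pos(2)]
        gap[OF in_W(2) pos'] gap[OF in_W(2) pos(1)] gap[OF in_W(4) pos(2)] gap[OF in_W(5) pos(1)]
        in \<open>simp_all only: moves moves' invs hts\<close>)
  qed (simp add: local_op_def)
qed

text \<open>
  Going forth and back through a wall cancels: the two crossings that change the end point have
  opposite signs, and a closed walk crossing twice needs both an upward and a downward edge, hence a
  simple root, where it cancels the decorated stay.
\<close>

lemma local_op_inverse:
  assumes \<gamma>: "\<gamma> \<in> \<Delta>"
  shows "local_op \<gamma> (local_op (- \<gamma>) G) = G"
proof (intro ext)
  fix x q
  show "local_op \<gamma> (local_op (- \<gamma>) G) x q = G x q"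
  proof (cases "x \<in> W")
    case x: True
    define \<delta> y where "\<delta> = inv x \<gamma>" and "y = s \<gamma> \<circ> x"
    have y: "y \<in> W" unfolding y_def using x \<gamma> weyl_comp weyl_refl by auto
    have cross_again: "s \<gamma> \<circ> y = x" unfolding y_def comp_assoc[symmetric] using refl_comp_refl[OF \<gamma>] by simp
    have invs: "inv y \<gamma> = - \<delta>" "inv y (- \<gamma>) = \<delta>" "inv x (- \<gamma>) = - \<delta>" "inv x \<gamma> = \<delta>"
      unfolding y_def \<delta>_def using x \<gamma>
      by (simp_all add: inv_refl_comp refl_self linear_neg[OF linear_refl] inv_linear)
    note fx = cross_facts[OF x \<gamma>, folded y_def, unfolded invs]
    note fy = cross_facts[OF y \<gamma>, unfolded cross_again invs]
    have \<delta>: "\<delta> \<in> \<Delta>" "- \<delta> \<in> \<Delta>" using fx(1) fy(1) by auto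
    have abs: "root_abs \<Delta> B (- \<delta>) = root_abs \<Delta> B \<delta>" "root_abs \<Delta> B \<delta> = (if \<delta> \<in> P then \<delta> else - \<delta>)"
      using neg_pos_iff[OF \<delta>(1)] by (auto simp: root_abs_def root_sgn_def)
    have both: "edge x y \<and> edge y x \<longleftrightarrow> \<bar>height \<delta>\<bar> = 1"
      using fx(3) fy(3) neg_pos_iff[OF \<delta>(1)] height_abs[OF \<delta>(1)] height_uminus[OF \<delta>(1)]
      by (auto split: if_splits)
    have simple: "- \<delta> \<in> B \<longleftrightarrow> height \<delta> = - 1" "\<delta> \<in> B \<longleftrightarrow> height \<delta> = 1"
      using neg_simple_iff[OF \<delta>(1)] neg_simple_iff[OF \<delta>(2)] height_uminus[OF \<delta>(1)] by auto
    have sign: "\<delta> \<in> P \<longleftrightarrow> height \<delta> > 0" "- \<delta> \<in> P \<longleftrightarrow> height \<delta> < 0"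
      using height_pos_iff[OF \<delta>(1)] height_pos_iff[OF \<delta>(2)] height_uminus[OF \<delta>(1)] by auto
    have lens: "len x < len y \<longleftrightarrow> \<not> len y < len x" using fx(3) by (auto split: if_splits)
    consider "height \<delta> > 1" | "height \<delta> = 1" | "height \<delta> = - 1" | "height \<delta> < - 1"
      using height_abs[OF \<delta>(1)] by linarith
    then show ?thesis
      using x y both lens unfolding local_op_def crossing_sign_def descent_root_def refl_uminus invs
        y_def[symmetric] cross_again simple minus_minus abs sign
      by cases (auto simp: algebra_simps)
  qed (simp add: local_op_def)
qed

text \<open>
  Multiply the equation for the rotated base from both sides by the inverse of the operator of
  \<open>- \<alpha>\<close>.
\<close>

lemma braided_rotate:
  assumes \<alpha>: "\<alpha> \<in> \<Delta>" and rot: "braided (\<alpha> + \<beta>) (- \<alpha>)"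
  shows "braided \<alpha> \<beta>"
  unfolding braided_def
proof
  fix G
  note inv1 = local_op_inverse[OF \<alpha>]
  note inv2 = local_op_inverse[OF uminus_root[OF \<alpha>], unfolded minus_minus]
  have "local_op (\<alpha> + \<beta>) (local_op \<beta> (local_op (- \<alpha>) (local_op \<alpha> G)))
      = local_op (- \<alpha>) (local_op \<beta> (local_op (\<alpha> + \<beta>) (local_op \<alpha> G)))"
    using rot unfolding braided_def by simp
  then show "local_op \<alpha> (local_op (\<alpha> + \<beta>) (local_op \<beta> G)) = local_op \<beta> (local_op (\<alpha> + \<beta>) (local_op \<alpha> G))"
    unfolding inv2 by (simp add: inv1)
qed

text \<open>
  The six rotations of the base \<open>\<alpha>, \<beta>\<close> of the hexagon of roots include one that consists of
  positive roots.
\<close>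

lemma braided_roots:
  assumes roots: "\<alpha> \<in> \<Delta>" "\<beta> \<in> \<Delta>" and pairing: "\<alpha> \<bullet> coroot \<beta> = - 1"
  shows "braided \<alpha> \<beta>"
proof -
  have sum: "\<alpha> + \<beta> \<in> \<Delta>" using dihedral_relations(1)[OF assms] .
  note neg = uminus_root[OF roots(1)] uminus_root[OF roots(2)] uminus_root[OF sum]
  note pr = pairing pairing_sym[OF roots] coroot_self[OF roots(1)] coroot_self[OF roots(2)]
  note inner = pr[unfolded inner_coroot[OF roots(1)] inner_coroot[OF roots(2)]]
  have base: "\<alpha> \<in> P \<Longrightarrow> \<beta> \<in> P \<Longrightarrow> braided \<alpha> \<beta>"
    "\<alpha> + \<beta> \<in> P \<Longrightarrow> - \<alpha> \<in> P \<Longrightarrow> braided (\<alpha> + \<beta>) (- \<alpha>)"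
    "\<beta> \<in> P \<Longrightarrow> - (\<alpha> + \<beta>) \<in> P \<Longrightarrow> braided \<beta> (- (\<alpha> + \<beta>))"
    "- \<alpha> \<in> P \<Longrightarrow> - \<beta> \<in> P \<Longrightarrow> braided (- \<alpha>) (- \<beta>)"
    "- (\<alpha> + \<beta>) \<in> P \<Longrightarrow> \<alpha> \<in> P \<Longrightarrow> braided (- (\<alpha> + \<beta>)) \<alpha>"
    "- \<beta> \<in> P \<Longrightarrow> \<alpha> + \<beta> \<in> P \<Longrightarrow> braided (- \<beta>) (\<alpha> + \<beta>)"
    using inner
    by (auto intro!: braided_positive
        simp: inner_coroot[OF roots(1)] inner_coroot[OF roots(2)] inner_coroot[OF sum] inner_coroot[OF neg(1)]
          inner_coroot[OF neg(2)] inner_coroot[OF neg(3), simplified] inner_add_left inner_add_right inner_diff_left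
          inner_diff_right distrib_left right_diff_distrib)
  have rot: "braided (\<alpha> + \<beta>) (- \<alpha>) \<Longrightarrow> braided \<alpha> \<beta>"
    "braided \<beta> (- (\<alpha> + \<beta>)) \<Longrightarrow> braided (\<alpha> + \<beta>) (- \<alpha>)"
    "braided (- \<alpha>) (- \<beta>) \<Longrightarrow> braided \<beta> (- (\<alpha> + \<beta>))"
    "braided (- (\<alpha> + \<beta>)) \<alpha> \<Longrightarrow> braided (- \<alpha>) (- \<beta>)"
    "braided (- \<beta>) (\<alpha> + \<beta>) \<Longrightarrow> braided (- (\<alpha> + \<beta>)) \<alpha>"
    using braided_rotate[OF roots(1), of \<beta>] braided_rotate[OF sum, of "- \<alpha>"]
      braided_rotate[OF roots(2), of "- (\<alpha> + \<beta>)"] braided_rotate[OF neg(1), of "- \<beta>"]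
      braided_rotate[OF neg(3), of \<alpha>] by (simp_all add: add.commute[of \<beta> \<alpha>])
  show ?thesis
    using base rot pos_or_neg[OF roots(1)] pos_or_neg[OF roots(2)] pos_or_neg[OF sum] by blast
qed

lemma orthogonal_relations:
  assumes roots: "\<alpha> \<in> \<Delta>" "\<beta> \<in> \<Delta>" and pairing: "\<alpha> \<bullet> coroot \<beta> = 0"
  shows "s \<alpha> \<beta> = \<beta>" "s \<beta> \<alpha> = \<alpha>" "s \<alpha> \<circ> s \<beta> = s \<beta> \<circ> s \<alpha>"
proof -
  show sab: "s \<alpha> \<beta> = \<beta>" "s \<beta> \<alpha> = \<alpha>"
    using pairing pairing_sym[OF roots] by (simp_all add: refl_eq roots)
  show "s \<alpha> \<circ> s \<beta> = s \<beta> \<circ> s \<alpha>" using weyl_conj_refl[OF weyl_refl[OF roots(1)] roots(2)] sab by simp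
qed

text \<open>
  Both orders of two orthogonal crossings change the length by the same total, and every edge changes
  it by the least amount possible in its direction.
\<close>

lemma orthogonal_edges:
  assumes x: "x \<in> W" and roots: "\<alpha> \<in> \<Delta>" "\<beta> \<in> \<Delta>" and pairing: "\<alpha> \<bullet> coroot \<beta> = 0"
    and e: "edge x (s \<alpha> \<circ> x)" "edge (s \<alpha> \<circ> x) (s \<beta> \<circ> (s \<alpha> \<circ> x))"
  shows "edge x (s \<beta> \<circ> x) \<and> edge (s \<beta> \<circ> x) (s \<alpha> \<circ> (s \<beta> \<circ> x))"
proof -
  note D = orthogonal_relations[OF roots pairing]
  have xa: "s \<alpha> \<circ> x \<in> W" and xb: "s \<beta> \<circ> x \<in> W" using x roots weyl_comp weyl_refl by auto
  have top: "s \<alpha> \<circ> (s \<beta> \<circ> x) = s \<beta> \<circ> (s \<alpha> \<circ> x)" unfolding comp_assoc[symmetric] D(3) by simp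
  have invs: "inv (s \<alpha> \<circ> x) \<beta> = inv x \<beta>" "inv (s \<beta> \<circ> x) \<alpha> = inv x \<alpha>"
    using x roots D by (simp_all add: inv_refl_comp)
  show ?thesis
    using e cross_facts(3)[OF x roots(1)] cross_facts(3)[OF x roots(2)]
      cross_facts(3)[OF xa roots(2)] cross_facts(3)[OF xb roots(1)]
    unfolding invs top
    by (cases "(inv x \<alpha> \<in> P) = (\<alpha> \<in> P)"; cases "(inv x \<beta> \<in> P) = (\<beta> \<in> P)") auto
qed

text \<open>
  The direction, the sign and the decoration of a step along one root are unaffected by a crossing along an
  orthogonal one; only the existence of two consecutive crossings has to be compared.
\<close>

lemma orthogonal_local_ops:
  assumes roots: "\<alpha> \<in> \<Delta>" "\<beta> \<in> \<Delta>" and pairing: "\<alpha> \<bullet> coroot \<beta> = 0"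
  shows "local_op \<alpha> (local_op \<beta> G) = local_op \<beta> (local_op \<alpha> G)"
proof (intro ext)
  fix x q
  note D = orthogonal_relations[OF roots pairing]
  have pairing': "\<beta> \<bullet> coroot \<alpha> = 0" using pairing pairing_sym[OF roots] by simp
  show "local_op \<alpha> (local_op \<beta> G) x q = local_op \<beta> (local_op \<alpha> G) x q"
  proof (cases "x \<in> W")
    case x: True
    define a b where "a = inv x \<alpha>" and "b = inv x \<beta>"
    define xa xb xab where "xa = s \<alpha> \<circ> x" and "xb = s \<beta> \<circ> x" and "xab = s \<alpha> \<circ> xb"
    have in_W: "xa \<in> W" "xb \<in> W" unfolding xa_def xb_def using x weyl_comp weyl_refl roots by auto
    have moves: "s \<alpha> \<circ> x = xa" "s \<beta> \<circ> x = xb" "s \<alpha> \<circ> xb = xab" "s \<beta> \<circ> xa = xab"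
      unfolding xa_def xb_def xab_def comp_assoc[symmetric] D(3) by simp_all
    have invs: "inv x \<alpha> = a" "inv x \<beta> = b" "inv xa \<beta> = b" "inv xb \<alpha> = a"
      unfolding xa_def xb_def a_def b_def using x roots D by (simp_all add: inv_refl_comp)
    have edges: "edge x xa \<and> edge xa xab \<longleftrightarrow> edge x xb \<and> edge xb xab"
      using orthogonal_edges[OF x roots pairing] orthogonal_edges[OF x roots(2,1) pairing']
      unfolding moves by blast
    have signs: "crossing_sign \<alpha> xb = crossing_sign \<alpha> x" "crossing_sign \<beta> xa = crossing_sign \<beta> x"
      unfolding crossing_sign_def invs by simp_all
    have "len xab < len xb \<longleftrightarrow> len xa < len x" "len xab < len xa \<longleftrightarrow> len xb < len x"
      using cross_facts(2)[OF x roots(1)] cross_facts(2)[OF x roots(2)]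
        cross_facts(2)[OF in_W(1) roots(2)] cross_facts(2)[OF in_W(2) roots(1)]
      unfolding moves invs by simp_all
    then have drops: "descent_root \<alpha> xb = descent_root \<alpha> x" "descent_root \<beta> xa = descent_root \<beta> x"
      unfolding descent_root_def moves invs by simp_all
    show ?thesis
      using x in_W edges unfolding local_op_def signs drops moves invs
      by (cases "edge x xa"; cases "edge x xb"; cases "edge xa xab"; cases "edge xb xab";
          cases "- a \<in> B"; cases "- b \<in> B") (simp_all add: algebra_simps)
  qed (simp add: local_op_def)
qed

section \<open>Weights and degrees\<close>

text \<open>
  The state of a walk also records its weight \<open>\<omega>\<close> and the part \<open>D\<close> of its degree that is summed
  step by step; \<open>k\<close> is the colevel of the step.
\<close>

type_synonym 'b walk_functional = "('b \<Rightarrow> 'b) \<Rightarrow> 'b \<Rightarrow> 'b \<Rightarrow> real \<Rightarrow> int"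

definition step_op :: "'a \<Rightarrow> real \<Rightarrow> 'a walk_functional \<Rightarrow> 'a walk_functional" where
  "step_op \<gamma> k F x q \<omega> D =
     (if x \<in> W then
        F x q \<omega> D - (if - inv x \<gamma> \<in> B then F x (q - inv x \<gamma>) \<omega> (D - k) else 0)
        + (if edge x (s \<gamma> \<circ> x) then
             crossing_sign \<gamma> x * F (s \<gamma> \<circ> x) (q + descent_root \<gamma> x) (\<omega> - k *\<^sub>R inv x \<gamma>)
               (D - k * (inv x \<gamma> \<bullet> (coscale *\<^sub>R (q + descent_root \<gamma> x)))
                - (if len (s \<gamma> \<circ> x) < len x then root_sgn \<Delta> B \<gamma> * k else 0))
           else 0)
      else F x q \<omega> D)"

definition potential_lift :: "'a \<Rightarrow> 'a \<Rightarrow> real \<Rightarrow> 'a walk_functional \<Rightarrow> ('a \<Rightarrow> 'a) \<Rightarrow> 'a \<Rightarrow> int" where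
  "potential_lift N c d F x q = F x q (c + inv x N) (d + inv x N \<bullet> (coscale *\<^sub>R q))"

text \<open>
  If all walls met in a segment pass through one point, then along the segment the weight and the
  degree are functions of the current \<open>x\<close> and \<open>q\<close>: both differ by constants from a potential built
  from a vector \<open>N\<close> whose pairings with the coroots of the segment are the colevels.  Indeed, a stay decorated
  by \<open>1\<close> changes both the degree and the potential by \<open>- k\<close>, and a crossing changes the weight by the
  difference of \<open>inv y N\<close> and \<open>inv x N\<close>, while in the degree the term with the sign of \<open>\<gamma>\<close> accounts for the quantum
  weight that is added at the crossing.
\<close>

lemma potential_lift_step_op:
  assumes \<gamma>: "\<gamma> \<in> \<Delta>" and N: "N \<bullet> coroot \<gamma> = k"
  shows "potential_lift N c d (step_op \<gamma> k F) = local_op \<gamma> (potential_lift N c d F)"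
proof (intro ext)
  fix x q
  show "potential_lift N c d (step_op \<gamma> k F) x q = local_op \<gamma> (potential_lift N c d F) x q"
  proof (cases "x \<in> W")
    case x: True
    define \<delta> y where "\<delta> = inv x \<gamma>" and "y = s \<gamma> \<circ> x"
    note facts = cross_facts[OF x \<gamma>, folded \<delta>_def y_def]
    have iN: "inv x N \<bullet> (coscale *\<^sub>R \<delta>) = k"
      using weyl_pairing[OF weyl_inv[OF x] \<gamma>, of N] coroot_eq[OF facts(1)] N unfolding \<delta>_def by simp
    have \<delta>2: "\<delta> \<bullet> (coscale *\<^sub>R \<delta>) = 2" using coroot_self[OF facts(1)] coroot_eq[OF facts(1)] by simp
    have yN: "inv y N = inv x N - k *\<^sub>R \<delta>"
      unfolding y_def \<delta>_def using x \<gamma> N by (simp add: inv_refl_comp refl_eq inv_linear)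
    have stay: "d + inv x N \<bullet> (coscale *\<^sub>R q) - k = d + inv x N \<bullet> (coscale *\<^sub>R (q - \<delta>))"
      using iN by (simp add: scaleR_diff_right inner_diff_right)
    define r where "r = descent_root \<gamma> x"
    have r: "r = (if len y < len x then root_sgn \<Delta> B \<delta> *\<^sub>R \<delta> else 0)"
      unfolding r_def descent_root_def root_abs_def y_def \<delta>_def ..
    have signs: "root_sgn \<Delta> B \<gamma> = - root_sgn \<Delta> B \<delta>" if "len y < len x"
      using facts(2) that unfolding root_sgn_def by auto
    have "inv x N \<bullet> (coscale *\<^sub>R r) = (if len y < len x then root_sgn \<Delta> B \<delta> * k else 0)"
      "\<delta> \<bullet> (coscale *\<^sub>R r) = (if len y < len x then root_sgn \<Delta> B \<delta> * 2 else 0)"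
      using iN \<delta>2 unfolding r by (simp_all add: mult.left_commute)
    then have cross: "d + inv x N \<bullet> (coscale *\<^sub>R q) - k * (\<delta> \<bullet> (coscale *\<^sub>R (q + r)))
        - (if len y < len x then root_sgn \<Delta> B \<gamma> * k else 0)
        = d + inv y N \<bullet> (coscale *\<^sub>R (q + r))"
      unfolding yN using signs
      by (auto simp: scaleR_add_right inner_add_right inner_diff_left algebra_simps)
    show ?thesis
      using x unfolding potential_lift_def step_op_def local_op_def \<delta>_def[symmetric] y_def[symmetric]
        r_def[symmetric] stay cross yN by (simp add: algebra_simps)
  qed (simp add: potential_lift_def step_op_def local_op_def)
qed

text \<open>
  Every state is reached by a suitable choice of the constants of the lift.
\<close>

lemma walk_functional_eqI:
  assumes "\<And>c d. potential_lift N c d F = potential_lift N c d F'"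
  shows "F = F'"
proof (intro ext)
  fix x q \<omega> D
  show "F x q \<omega> D = F' x q \<omega> D"
    using fun_cong[OF fun_cong[OF assms[of "\<omega> - inv x N" "D - inv x N \<bullet> (coscale *\<^sub>R q)"], of x], of q]
    by (simp add: potential_lift_def)
qed

lemma step_op_orthogonal:
  assumes roots: "\<alpha> \<in> \<Delta>" "\<beta> \<in> \<Delta>" and pairing: "\<alpha> \<bullet> coroot \<beta> = 0"
  shows "step_op \<alpha> k (step_op \<beta> l F) = step_op \<beta> l (step_op \<alpha> k F)"
proof -
  (* the vector with pairings k and l with the two coroots *)
  define N where "N = (k / 2) *\<^sub>R \<alpha> + (l / 2) *\<^sub>R \<beta>"
  have "\<beta> \<bullet> coroot \<alpha> = 0" using pairing pairing_sym[OF roots] by simp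
  then have N: "N \<bullet> coroot \<alpha> = k" "N \<bullet> coroot \<beta> = l"
    using pairing coroot_self roots unfolding N_def by (simp_all add: inner_add_left)
  show ?thesis
    by (rule walk_functional_eqI[of N])
      (simp add: potential_lift_step_op roots N orthogonal_local_ops[OF roots pairing])
qed

lemma step_op_braid:
  assumes roots: "\<alpha> \<in> \<Delta>" "\<beta> \<in> \<Delta>" and pairing: "\<alpha> \<bullet> coroot \<beta> = - 1"
  shows "step_op \<alpha> k (step_op (\<alpha> + \<beta>) (k + l) (step_op \<beta> l F))
    = step_op \<beta> l (step_op (\<alpha> + \<beta>) (k + l) (step_op \<alpha> k F))"
proof -
  (* the vector with pairings k and l with the two coroots, by the inverse Cartan matrix of type A2;
     its pairing with the third coroot is k + l *)
  define N where "N = ((2 * k + l) / 3) *\<^sub>R \<alpha> + ((k + 2 * l) / 3) *\<^sub>R \<beta>"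
  have sum: "\<alpha> + \<beta> \<in> \<Delta>" using dihedral_relations(1)[OF assms] .
  have "\<beta> \<bullet> coroot \<alpha> = - 1" using pairing pairing_sym[OF roots] by simp
  then have N: "N \<bullet> coroot \<alpha> = k" "N \<bullet> coroot \<beta> = l"
    using pairing coroot_self[OF roots(1)] coroot_self[OF roots(2)] unfolding N_def
    by (simp_all add: inner_add_left field_simps)
  then have N3: "N \<bullet> coroot (\<alpha> + \<beta>) = k + l"
    by (simp add: coroot_eq roots sum scaleR_add_right inner_add_right)
  show ?thesis
    by (rule walk_functional_eqI[of N])
      (use braided_roots[OF assms] in \<open>simp add: potential_lift_step_op roots sum N N3 braided_def\<close>)
qed

end

section \<open>Levels of the walls of an alcove path\<close>

context simply_laced_base
begin

definition level :: "'a set \<Rightarrow> 'a \<Rightarrow> int" where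
  "level C \<gamma> = \<lfloor>(SOME \<nu>. \<nu> \<in> C) \<bullet> coroot \<gamma>\<rfloor>"

definition strip :: "'a \<Rightarrow> int \<Rightarrow> 'a set" where
  "strip \<gamma> k = {\<nu>. of_int k < coroot \<gamma> \<bullet> \<nu> \<and> coroot \<gamma> \<bullet> \<nu> < of_int k + 1}"

text \<open>
  An alcove is connected and avoids the hyperplanes for \<open>\<gamma>\<close>, so the pairing with the coroot of \<open>\<gamma>\<close> stays between
  two consecutive integers.
\<close>

lemma alcove_subset_strip:
  assumes C: "C \<in> alcoves \<Delta>" and \<gamma>: "\<gamma> \<in> \<Delta>"
  shows "C \<subseteq> strip \<gamma> (level C \<gamma>)"
proof
  fix \<nu> assume \<nu>: "\<nu> \<in> C"
  define f where "f = (\<lambda>\<nu>::'a. \<nu> \<bullet> coroot \<gamma>)"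
  define \<nu>0 where "\<nu>0 = (SOME \<nu>. \<nu> \<in> C)"
  have \<nu>0: "\<nu>0 \<in> C" unfolding \<nu>0_def using \<nu> by (rule someI)
  have comp: "C \<in> components (UNIV - (\<Union>\<alpha>\<in>\<Delta>. \<Union>k. root_hyperplane \<alpha> k))"
    using C unfolding alcoves_def .
  have "connected (f ` C)"
    using in_components_connected[OF comp] unfolding f_def
    by (intro connected_continuous_image) (auto intro!: continuous_intros)
  then have between: "z \<in> f ` C" if "x \<in> f ` C" "y \<in> f ` C" "x \<le> z" "z \<le> y" for x y z
    using that connected_contains_Icc[of "f ` C" x y] by auto
  have no_int: "of_int k \<notin> f ` C" for k :: int
  proof
    assume "of_int k \<in> f ` C"
    then obtain \<mu> where "\<mu> \<in> C" "\<mu> \<in> root_hyperplane \<gamma> k" unfolding f_def root_hyperplane_def by force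
    then show False using in_components_subset[OF comp] \<gamma> by blast
  qed
  have lev: "level C \<gamma> = \<lfloor>f \<nu>0\<rfloor>" unfolding level_def f_def \<nu>0_def ..
  have im: "f \<nu> \<in> f ` C" "f \<nu>0 \<in> f ` C" using \<nu> \<nu>0 by auto
  have fl: "of_int (level C \<gamma>) \<le> f \<nu>0" "f \<nu>0 < of_int (level C \<gamma> + 1)"
    unfolding lev by (simp_all add: of_int_floor_le)
  have "of_int (level C \<gamma>) < f \<nu>"
    using between[OF im(1,2), of "of_int (level C \<gamma>)"] no_int[of "level C \<gamma>"] fl(1) by linarith
  moreover have "f \<nu> < of_int (level C \<gamma> + 1)"
    using between[OF im(2,1), of "of_int (level C \<gamma> + 1)"] no_int[of "level C \<gamma> + 1"] fl(2) by linarith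
  ultimately show "\<nu> \<in> strip \<gamma> (level C \<gamma>)" unfolding strip_def f_def by (simp add: inner_commute)
qed

lemma alcove_nonempty: "C \<in> alcoves \<Delta> \<Longrightarrow> C \<noteq> {}"
  unfolding alcoves_def by (rule in_components_nonempty)

lemma convex_strip: "convex (strip \<gamma> k)"
proof -
  have "strip \<gamma> k = {\<nu>. coroot \<gamma> \<bullet> \<nu> > of_int k} \<inter> {\<nu>. coroot \<gamma> \<bullet> \<nu> < of_int k + 1}"
    unfolding strip_def by auto
  then show ?thesis by (simp add: convex_Int convex_halfspace_lt convex_halfspace_gt)
qed

text \<open>
  The intersection of the strips is convex and avoids all hyperplanes, so it lies in a single alcove.  Hence an
  alcove is determined by its levels.
\<close>

lemma alcove_eq_strips:
  assumes C: "C \<in> alcoves \<Delta>"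
  shows "C = (\<Inter>\<gamma>\<in>\<Delta>. strip \<gamma> (level C \<gamma>))" (is "C = ?R")
proof
  show "C \<subseteq> ?R" using alcove_subset_strip[OF C] by auto
  have "\<nu> \<notin> root_hyperplane \<gamma> k" if "\<nu> \<in> ?R" "\<gamma> \<in> \<Delta>" for \<nu> \<gamma> k
  proof
    assume "\<nu> \<in> root_hyperplane \<gamma> k"
    moreover have "\<nu> \<in> strip \<gamma> (level C \<gamma>)" using that by auto
    ultimately have "of_int (level C \<gamma>) < real_of_int k" "real_of_int k < of_int (level C \<gamma> + 1)"
      unfolding strip_def root_hyperplane_def by (auto simp: inner_commute)
    then show False unfolding of_int_less_iff by simp
  qed
  then have sub: "?R \<subseteq> UNIV - (\<Union>\<alpha>\<in>\<Delta>. \<Union>k. root_hyperplane \<alpha> k)" by blast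
  have conn: "connected ?R" by (intro convex_connected convex_INT convex_strip)
  have meet: "C \<inter> ?R \<noteq> {}" using \<open>C \<subseteq> ?R\<close> alcove_nonempty[OF C] by (simp add: Int_absorb2)
  show "?R \<subseteq> C" by (rule components_maximal[OF C[unfolded alcoves_def] conn sub meet])
qed

lemma alcove_eqI:
  assumes "C \<in> alcoves \<Delta>" "D \<in> alcoves \<Delta>" "\<And>\<gamma>. \<gamma> \<in> \<Delta> \<Longrightarrow> level C \<gamma> = level D \<gamma>"
  shows "C = D"
  using alcove_eq_strips[OF assms(1)] alcove_eq_strips[OF assms(2)] assms(3) by simp

lemma level_uminus:
  assumes C: "C \<in> alcoves \<Delta>" and \<gamma>: "\<gamma> \<in> \<Delta>"
  shows "level C (- \<gamma>) = - level C \<gamma> - 1"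
proof -
  obtain \<nu> where "\<nu> \<in> C" using alcove_nonempty[OF C] by auto
  then have "\<nu> \<in> strip \<gamma> (level C \<gamma>)" "\<nu> \<in> strip (- \<gamma>) (level C (- \<gamma>))"
    using alcove_subset_strip[OF C] \<gamma> uminus_root by blast+
  moreover have "coroot (- \<gamma>) = - coroot \<gamma>" unfolding coroot_def by simp
  ultimately show ?thesis unfolding strip_def by simp
qed

text \<open>
  The change of the level for \<open>\<delta>\<close> caused by crossing a wall in direction \<open>\<gamma>\<close>.
\<close>

definition jump :: "'a \<Rightarrow> 'a \<Rightarrow> int" where
  "jump \<gamma> \<delta> = (if \<delta> = \<gamma> then 1 else if \<delta> = - \<gamma> then - 1 else 0)"

text \<open>
  The closures of two alcoves with different levels for \<open>\<delta>\<close> meet inside a hyperplane for \<open>\<delta>\<close>; if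
  \<open>\<delta>\<close> is not proportional to \<open>\<gamma>\<close>, the intersection with the wall has codimension two.
\<close>

lemma alcove_cross_level:
  assumes cross: "alcove_cross \<Delta> C \<gamma> k D"
  shows "k = level C \<gamma> + 1" and "\<delta> \<in> \<Delta> \<Longrightarrow> level D \<delta> = level C \<delta> + jump \<gamma> \<delta>"
proof -
  note def = cross[unfolded alcove_cross_def]
  have C: "C \<in> alcoves \<Delta>" and D: "D \<in> alcoves \<Delta>" and \<gamma>: "\<gamma> \<in> \<Delta>" using def by auto
  define X where "X = closure C \<inter> closure D"
  have dim: "aff_dim X = int DIM('a) - 1" and wall: "X \<subseteq> root_hyperplane \<gamma> k"
    using def unfolding X_def by auto
  have "X \<noteq> {}"
  proof
    assume "X = {}"
    then have "aff_dim X = - 1" by simp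
    then show False using dim DIM_positive[where 'a = 'a] by simp
  qed
  then obtain p where p: "p \<in> X" by auto
  have closed_strip: "of_int (level A \<delta>) \<le> coroot \<delta> \<bullet> \<nu> \<and> coroot \<delta> \<bullet> \<nu> \<le> of_int (level A \<delta>) + 1"
    if "A \<in> alcoves \<Delta>" "\<delta> \<in> \<Delta>" "\<nu> \<in> closure A" for A \<delta> \<nu>
  proof -
    have "closed ({\<nu>. coroot \<delta> \<bullet> \<nu> \<ge> of_int (level A \<delta>)} \<inter> {\<nu>. coroot \<delta> \<bullet> \<nu> \<le> of_int (level A \<delta>) + 1})"
      by (intro closed_Int closed_halfspace_le closed_halfspace_ge)
    moreover have "A \<subseteq> {\<nu>. coroot \<delta> \<bullet> \<nu> \<ge> of_int (level A \<delta>)} \<inter> {\<nu>. coroot \<delta> \<bullet> \<nu> \<le> of_int (level A \<delta>) + 1}"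
      using alcove_subset_strip[OF that(1,2)] unfolding strip_def by auto
    ultimately show ?thesis using closure_minimal that(3) by blast
  qed
  have pk: "coroot \<gamma> \<bullet> p = of_int k" using p wall unfolding root_hyperplane_def by (auto simp: inner_commute)
  obtain \<nu> \<nu>' where \<nu>: "\<nu> \<in> C" "\<nu>' \<in> D" using alcove_nonempty C D by blast
  have "of_int (level C \<gamma>) < real_of_int k"
    using \<nu>(1) def alcove_subset_strip[OF C \<gamma>] unfolding strip_def by (force simp: inner_commute)
  moreover have "real_of_int k \<le> of_int (level C \<gamma>) + 1"
    using closed_strip[OF C \<gamma>, of p] p pk unfolding X_def by auto
  ultimately show k: "k = level C \<gamma> + 1" by linarith
  have "real_of_int k < of_int (level D \<gamma>) + 1"
    using \<nu>(2) def alcove_subset_strip[OF D \<gamma>] unfolding strip_def by (force simp: inner_commute)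
  moreover have "of_int (level D \<gamma>) \<le> real_of_int k"
    using closed_strip[OF D \<gamma>, of p] p pk unfolding X_def by auto
  ultimately have D\<gamma>: "level D \<gamma> = k" by linarith
  show "level D \<delta> = level C \<delta> + jump \<gamma> \<delta>" if \<delta>: "\<delta> \<in> \<Delta>"
  proof -
    consider "\<delta> = \<gamma>" | "\<delta> = - \<gamma>" "\<delta> \<noteq> \<gamma>" | "\<delta> \<noteq> \<gamma>" "\<delta> \<noteq> - \<gamma>" by auto
    then show ?thesis
    proof cases
      case 1
      then show ?thesis using D\<gamma> k unfolding jump_def by simp
    next
      case 2
      then show ?thesis using D\<gamma> k level_uminus[OF C \<gamma>] level_uminus[OF D \<gamma>] unfolding jump_def by simp
    next
      case 3
      have "level D \<delta> = level C \<delta>"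
      proof (rule ccontr)
        assume ne: "level D \<delta> \<noteq> level C \<delta>"
        define c where "c = max (level C \<delta>) (level D \<delta>)"
        have const: "coroot \<delta> \<bullet> \<nu> = of_int c" if "\<nu> \<in> X" for \<nu>
        proof -
          have "\<nu> \<in> closure C" "\<nu> \<in> closure D" using that unfolding X_def by auto
          note b = closed_strip[OF C \<delta> this(1)] closed_strip[OF D \<delta> this(2)]
          consider "level C \<delta> + 1 \<le> level D \<delta>" "c = level D \<delta>" | "level D \<delta> + 1 \<le> level C \<delta>" "c = level C \<delta>"
            using ne unfolding c_def by linarith
          then show ?thesis using b by cases linarith+
        qed
        define S where "S = {\<nu>. coroot \<gamma> \<bullet> \<nu> = of_int k}"
        have "coroot \<gamma> \<noteq> 0" using coroot_self[OF \<gamma>] by auto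
        then have S: "affine S" "aff_dim S = int DIM('a) - 1"
          unfolding S_def by (simp_all add: affine_hyperplane aff_dim_hyperplane)
        have XS: "X \<subseteq> S \<inter> {\<nu>. coroot \<delta> \<bullet> \<nu> = of_int c}"
          using wall const unfolding S_def root_hyperplane_def by (auto simp: inner_commute)
        define t where "t = \<delta> \<bullet> coroot \<gamma>"
        define u where "u = \<delta> - (t / 2) *\<^sub>R \<gamma>"
        have t: "t \<in> {-1, 0, 1}" unfolding t_def using pairing_cases[OF \<delta> \<gamma>] 3 by auto
        have "u \<bullet> coroot \<gamma> = 0" "u \<bullet> coroot \<delta> = 2 - (t / 2) * t"
          unfolding u_def t_def using coroot_self \<gamma> \<delta> pairing_sym[OF \<delta> \<gamma>]
          by (simp_all add: inner_diff_left)
        then have u: "coroot \<gamma> \<bullet> u = 0" "coroot \<delta> \<bullet> u \<noteq> 0" using t by (auto simp: inner_commute)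
        have "p + u \<in> S" "p + u \<notin> {\<nu>. coroot \<delta> \<bullet> \<nu> = of_int c}"
          using pk u const[OF p] unfolding S_def by (auto simp: inner_add_right)
        then have "\<not> S \<subseteq> {\<nu>. coroot \<delta> \<bullet> \<nu> = of_int c}" by blast
        then have "aff_dim (S \<inter> {\<nu>. coroot \<delta> \<bullet> \<nu> = of_int c}) < int DIM('a) - 1"
          using aff_dim_affine_Int_hyperplane[OF S(1), of "coroot \<delta>" "of_int c"] S(2) p XS by auto
        then show False using aff_dim_subset[OF XS] dim by linarith
      qed
      then show ?thesis using 3 unfolding jump_def by simp
    qed
  qed
qed

lemma alcove_arrow_facts:
  assumes "alcove_arrow \<Delta> C \<gamma> D"
  shows "C \<in> alcoves \<Delta>" "D \<in> alcoves \<Delta>" "\<gamma> \<in> \<Delta>"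
    and "(THE k. alcove_cross \<Delta> C \<gamma> k D) = level C \<gamma> + 1"
    and "\<And>\<delta>. \<delta> \<in> \<Delta> \<Longrightarrow> level D \<delta> = level C \<delta> + jump \<gamma> \<delta>"
proof -
  obtain k where k: "alcove_cross \<Delta> C \<gamma> k D" using assms unfolding alcove_arrow_def by auto
  then show "C \<in> alcoves \<Delta>" "D \<in> alcoves \<Delta>" "\<gamma> \<in> \<Delta>" unfolding alcove_cross_def by auto
  show "(THE k. alcove_cross \<Delta> C \<gamma> k D) = level C \<gamma> + 1"
    by (rule the_equality) (use k alcove_cross_level(1)[OF k] alcove_cross_level(1) in blast)+
  show "\<And>\<delta>. \<delta> \<in> \<Delta> \<Longrightarrow> level D \<delta> = level C \<delta> + jump \<gamma> \<delta>" using alcove_cross_level(2)[OF k] .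
qed

lemma alcove_at_append: "t \<le> length us \<Longrightarrow> alcove_at \<Delta> B (us @ vs) t = alcove_at \<Delta> B us t"
  by (induction t) (simp_all add: nth_append)

lemma alcove_at_same_suffix:
  assumes "length us = length us'" and "alcove_at \<Delta> B us (length us) = alcove_at \<Delta> B us' (length us')"
    and "length us \<le> t"
  shows "alcove_at \<Delta> B (us @ vs) t = alcove_at \<Delta> B (us' @ vs) t"
  using assms(3)
proof (induction t rule: dec_induct)
  case base
  then show ?case using assms(1,2) by (simp add: alcove_at_append)
next
  case (step t)
  then show ?case using assms(1) by (simp add: nth_append)
qed

lemma path_arrow:
  assumes "alcove_path \<Delta> B lam \<Gamma>" "Suc t \<le> length \<Gamma>"
  shows "alcove_arrow \<Delta> (alcove_at \<Delta> B \<Gamma> t) (\<Gamma> ! t) (alcove_at \<Delta> B \<Gamma> (Suc t))"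
  using assms unfolding alcove_path_def by simp

lemma path_level_eq:
  assumes "alcove_path \<Delta> B lam \<Gamma>" "t < length \<Gamma>"
  shows "path_level \<Delta> B \<Gamma> (Suc t) = level (alcove_at \<Delta> B \<Gamma> t) (\<Gamma> ! t) + 1"
  using alcove_arrow_facts(4)[OF path_arrow[OF assms(1), of t]] assms(2)
  unfolding path_level_def path_root_def by simp

lemma path_subset_roots:
  assumes "alcove_path \<Delta> B lam \<Gamma>"
  shows "set \<Gamma> \<subseteq> \<Delta>"
proof
  fix \<gamma> assume "\<gamma> \<in> set \<Gamma>"
  then obtain t where "t < length \<Gamma>" "\<gamma> = \<Gamma> ! t" by (auto simp: in_set_conv_nth)
  then show "\<gamma> \<in> \<Delta>" using alcove_arrow_facts(3)[OF path_arrow[OF assms, of t]] by auto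
qed

text \<open>
  The levels met in a segment depend only on the alcove before it, since each step changes the
  level for its own root and the negative of this root only; and the total change does not depend on the order of the steps.
\<close>

lemma orthogonal_segment_levels:
  assumes \<Gamma>: "alcove_path \<Delta> B lam (us @ [\<alpha>, \<beta>] @ vs)" and ne: "\<beta> \<noteq> \<alpha>" "\<beta> \<noteq> - \<alpha>"
  defines "n \<equiv> length us" and "A \<equiv> alcove_at \<Delta> B us (length us)"
  shows "path_level \<Delta> B (us @ [\<alpha>, \<beta>] @ vs) (n + 1) = level A \<alpha> + 1"
    and "path_level \<Delta> B (us @ [\<alpha>, \<beta>] @ vs) (n + 2) = level A \<beta> + 1"
    and "alcove_at \<Delta> B (us @ [\<alpha>, \<beta>]) (n + 2) \<in> alcoves \<Delta>"
    and "\<And>\<delta>. \<delta> \<in> \<Delta> \<Longrightarrow> level (alcove_at \<Delta> B (us @ [\<alpha>, \<beta>]) (n + 2)) \<delta> = level A \<delta> + jump \<alpha> \<delta> + jump \<beta> \<delta>"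
proof -
  define \<Gamma>' where "\<Gamma>' = us @ [\<alpha>, \<beta>] @ vs"
  have nth: "\<Gamma>' ! n = \<alpha>" "\<Gamma>' ! (Suc n) = \<beta>" "n + 2 \<le> length \<Gamma>'"
    unfolding \<Gamma>'_def n_def by (simp_all add: nth_append)
  have A: "alcove_at \<Delta> B \<Gamma>' n = A" unfolding \<Gamma>'_def n_def A_def by (simp add: alcove_at_append)
  have end': "alcove_at \<Delta> B (us @ [\<alpha>, \<beta>]) (n + 2) = alcove_at \<Delta> B \<Gamma>' (Suc (Suc n))"
    using alcove_at_append[of "n + 2" "us @ [\<alpha>, \<beta>]" vs] unfolding \<Gamma>'_def n_def by simp
  note path = \<Gamma>[folded \<Gamma>'_def]
  note f1 = alcove_arrow_facts[OF path_arrow[OF path, of n], unfolded nth A]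
  note f2 = alcove_arrow_facts[OF path_arrow[OF path, of "Suc n"], unfolded nth]
  show "path_level \<Delta> B (us @ [\<alpha>, \<beta>] @ vs) (n + 1) = level A \<alpha> + 1"
    using path_level_eq[OF path, of n] nth A unfolding \<Gamma>'_def by simp
  have "level (alcove_at \<Delta> B \<Gamma>' (Suc n)) \<beta> = level A \<beta>"
    using f1(5)[of \<beta>] f2(3) nth ne unfolding jump_def by simp
  then show "path_level \<Delta> B (us @ [\<alpha>, \<beta>] @ vs) (n + 2) = level A \<beta> + 1"
    using path_level_eq[OF path, of "Suc n"] nth unfolding \<Gamma>'_def by simp
  show "alcove_at \<Delta> B (us @ [\<alpha>, \<beta>]) (n + 2) \<in> alcoves \<Delta>" using f2(2) nth end' by simp
  show "level (alcove_at \<Delta> B (us @ [\<alpha>, \<beta>]) (n + 2)) \<delta> = level A \<delta> + jump \<alpha> \<delta> + jump \<beta> \<delta>"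
    if "\<delta> \<in> \<Delta>" for \<delta>
    using f1(5)[OF _ that] f2(5)[OF _ that] nth end' by simp
qed

text \<open>
  In type \<open>A\<^sub>2\<close> the order in which the three walls are met forces them to pass through a common point, that
  is, the level of the middle wall is the sum of the other two.
\<close>

lemma braid_segment_levels:
  assumes \<Gamma>: "alcove_path \<Delta> B lam (us @ [\<alpha>, \<alpha> + \<beta>, \<beta>] @ vs)"
    and roots: "\<alpha> \<in> \<Delta>" "\<beta> \<in> \<Delta>" and pairing: "\<alpha> \<bullet> coroot \<beta> = - 1"
  defines "n \<equiv> length us" and "A \<equiv> alcove_at \<Delta> B us (length us)"
    and "\<Gamma>' \<equiv> us @ [\<alpha>, \<alpha> + \<beta>, \<beta>] @ vs" and "C \<equiv> alcove_at \<Delta> B (us @ [\<alpha>, \<alpha> + \<beta>, \<beta>]) (length us + 3)"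
  shows "path_level \<Delta> B \<Gamma>' (n + 1) = level A \<alpha> + 1"
    and "path_level \<Delta> B \<Gamma>' (n + 2) = level A \<alpha> + level A \<beta> + 2"
    and "path_level \<Delta> B \<Gamma>' (n + 3) = level A \<beta> + 1"
    and "C \<in> alcoves \<Delta>"
    and "\<And>\<delta>. \<delta> \<in> \<Delta> \<Longrightarrow> level C \<delta> = level A \<delta> + jump \<alpha> \<delta> + jump (\<alpha> + \<beta>) \<delta> + jump \<beta> \<delta>"
proof -
  have sum: "\<alpha> + \<beta> \<in> \<Delta>" using dihedral_relations(1)[OF roots pairing] .
  have nz: "\<alpha> \<noteq> 0" "\<beta> \<noteq> 0" "\<alpha> + \<beta> \<noteq> 0" using roots sum zero_notin_roots by auto
  have ne: "\<beta> \<noteq> \<alpha>" "\<beta> \<noteq> - \<alpha>" "\<alpha> + \<beta> \<noteq> \<alpha>" "\<alpha> + \<beta> \<noteq> - \<alpha>" "\<beta> \<noteq> \<alpha> + \<beta>" "\<beta> \<noteq> - (\<alpha> + \<beta>)"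
  proof -
    show "\<beta> \<noteq> \<alpha>" "\<beta> \<noteq> - \<alpha>" "\<alpha> + \<beta> \<noteq> \<alpha>" "\<beta> \<noteq> \<alpha> + \<beta>"
      using pairing coroot_self[OF roots(2)] nz by auto
    have "(\<alpha> + \<beta>) \<bullet> coroot \<beta> = 1" using pairing coroot_self[OF roots(2)] by (simp add: inner_add_left)
    moreover have "\<alpha> \<bullet> coroot \<beta> = - 1" "\<beta> \<bullet> coroot \<beta> = 2" using pairing coroot_self[OF roots(2)] by auto
    moreover have "(\<alpha> + \<beta>) \<bullet> coroot \<alpha> = 1" "\<alpha> \<bullet> coroot \<alpha> = 2"
      using pairing pairing_sym[OF roots] coroot_self[OF roots(1)] by (simp_all add: inner_add_left)
    ultimately show "\<alpha> + \<beta> \<noteq> - \<alpha>" "\<beta> \<noteq> - (\<alpha> + \<beta>)"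
      by (metis inner_minus_left minus_equation_iff one_neq_neg_numeral numeral_eq_one_iff
          neg_equal_iff_equal semiring_norm(85) one_eq_numeral_iff neg_numeral_neq_numeral)+
  qed
  have nth: "\<Gamma>' ! n = \<alpha>" "\<Gamma>' ! (Suc n) = \<alpha> + \<beta>" "\<Gamma>' ! (Suc (Suc n)) = \<beta>" "n + 3 \<le> length \<Gamma>'"
    unfolding \<Gamma>'_def n_def by (simp_all add: nth_append)
  have A: "alcove_at \<Delta> B \<Gamma>' n = A" unfolding \<Gamma>'_def n_def A_def by (simp add: alcove_at_append)
  have C: "C = alcove_at \<Delta> B \<Gamma>' (Suc (Suc (Suc n)))"
    using alcove_at_append[of "n + 3" "us @ [\<alpha>, \<alpha> + \<beta>, \<beta>]" vs] unfolding \<Gamma>'_def n_def C_def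
    by (simp add: eval_nat_numeral)
  define A1 A2 where "A1 = alcove_at \<Delta> B \<Gamma>' (Suc n)" and "A2 = alcove_at \<Delta> B \<Gamma>' (Suc (Suc n))"
  note path = \<Gamma>[folded \<Gamma>'_def]
  have len: "Suc n \<le> length \<Gamma>'" "Suc (Suc n) \<le> length \<Gamma>'" "Suc (Suc (Suc n)) \<le> length \<Gamma>'" using nth(4) by auto
  note f1 = alcove_arrow_facts[OF path_arrow[OF path len(1)], unfolded nth A, folded A1_def]
  note f2 = alcove_arrow_facts[OF path_arrow[OF path len(2)], unfolded nth, folded A1_def A2_def]
  note f3 = alcove_arrow_facts[OF path_arrow[OF path len(3)], unfolded nth, folded A2_def C]
  show "path_level \<Delta> B \<Gamma>' (n + 1) = level A \<alpha> + 1" using path_level_eq[OF path, of n] nth A by simp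
  have l1: "level A1 \<alpha> = level A \<alpha> + 1" "level A1 \<beta> = level A \<beta>" "level A1 (\<alpha> + \<beta>) = level A (\<alpha> + \<beta>)"
    using f1(5) roots sum ne unfolding jump_def by simp_all
  have l2: "level A2 \<alpha> = level A \<alpha> + 1" "level A2 \<beta> = level A \<beta>" "level A2 (\<alpha> + \<beta>) = level A (\<alpha> + \<beta>) + 1"
    using f2(5) roots sum ne l1 unfolding jump_def by (simp_all add: equation_minus_iff)
  have additive: "level D \<alpha> + level D \<beta> \<le> level D (\<alpha> + \<beta>) \<and> level D (\<alpha> + \<beta>) \<le> level D \<alpha> + level D \<beta> + 1"
    if D: "D \<in> alcoves \<Delta>" for D
  proof -
    obtain \<nu> where \<nu>: "\<nu> \<in> D" using alcove_nonempty[OF D] by auto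
    have "coroot (\<alpha> + \<beta>) = coroot \<alpha> + coroot \<beta>"
      by (simp add: coroot_eq roots sum scaleR_add_right)
    then have "coroot (\<alpha> + \<beta>) \<bullet> \<nu> = coroot \<alpha> \<bullet> \<nu> + coroot \<beta> \<bullet> \<nu>" by (simp add: inner_add_left)
    moreover have "\<nu> \<in> strip \<alpha> (level D \<alpha>)" "\<nu> \<in> strip \<beta> (level D \<beta>)" "\<nu> \<in> strip (\<alpha> + \<beta>) (level D (\<alpha> + \<beta>))"
      using \<nu> alcove_subset_strip[OF D] roots sum by auto
    ultimately show ?thesis unfolding strip_def by auto
  qed
  (* additivity up to 1 leaves two values for the level of alpha + beta before the second wall and two
     values after it; only one value is compatible with both *)
  have mid: "level A (\<alpha> + \<beta>) = level A \<alpha> + level A \<beta> + 1"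
    using additive[OF f1(2)] additive[OF f2(2)] l1 l2 by linarith
  show "path_level \<Delta> B \<Gamma>' (n + 2) = level A \<alpha> + level A \<beta> + 2"
    using path_level_eq[OF path, of "Suc n"] nth l1 mid unfolding A1_def by simp
  show "path_level \<Delta> B \<Gamma>' (n + 3) = level A \<beta> + 1"
    using path_level_eq[OF path, of "Suc (Suc n)"] nth l2 unfolding A2_def by (simp add: eval_nat_numeral)
  show "C \<in> alcoves \<Delta>" using f3(2) .
  show "level C \<delta> = level A \<delta> + jump \<alpha> \<delta> + jump (\<alpha> + \<beta>) \<delta> + jump \<beta> \<delta>" if "\<delta> \<in> \<Delta>" for \<delta>
    using f1(5)[OF that] f2(5)[OF that] f3(5)[OF that] by simp
qed

end

section \<open>Signed sums over decorated walks\<close>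

context simply_laced_base
begin

text \<open>
  The degree without half the pairing of \<open>qwt\<close> with \<open>qwt_co\<close>; unlike that term it is a sum of contributions of the
  steps.  The quantum coweight has been replaced by its multiple of the quantum weight.
\<close>

definition walk_acc :: "'a \<Rightarrow> 'a list \<Rightarrow> 'a decorated_walk \<Rightarrow> real" where
  "walk_acc lam \<Gamma> = (\<lambda>(ws, b).
     (\<Sum>t=1..length \<Gamma>. wt_step \<Delta> B lam \<Gamma> t (ws, b) \<bullet> (coscale *\<^sub>R qwt_upto \<Delta> B \<Gamma> t (ws, b))) -
     (\<Sum>t\<in>Tminus_set \<Delta> B \<Gamma> ws. root_sgn \<Delta> B (path_root \<Gamma> t) * path_colevel \<Delta> B lam \<Gamma> t) -
     (\<Sum>t\<in>S_set B \<Gamma> ws. real (b t) * path_colevel \<Delta> B lam \<Gamma> t))"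

text \<open>
  The signed sum of a function of the final state; for the indicator function of a state it is the signed number of
  walks with this final state.
\<close>

definition walk_sum :: "'a \<Rightarrow> ('a \<Rightarrow> 'a) \<Rightarrow> 'a list \<Rightarrow> 'a walk_functional \<Rightarrow> int" where
  "walk_sum lam w \<Gamma> F = (\<Sum>p\<in>decorated_walks \<Delta> B w \<Gamma>.
     walk_sign \<Delta> B \<Gamma> p * F (walk_end p) (qwt \<Delta> B \<Gamma> p) (wt \<Delta> B lam \<Gamma> p) (walk_acc lam \<Gamma> p))"

lemma walk_nth:
  assumes "ws \<in> quantum_walks \<Delta> B w \<Gamma>"
  shows "length ws = Suc (length \<Gamma>)" "\<And>t. t \<le> length \<Gamma> \<Longrightarrow> ws ! t \<in> W" "last ws = ws ! length \<Gamma>" "ws \<noteq> []"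
proof -
  show len: "length ws = Suc (length \<Gamma>)" using assms unfolding quantum_walks_def by simp
  then show "ws \<noteq> []" by auto
  then show "last ws = ws ! length \<Gamma>" using len by (simp add: last_conv_nth)
  show "ws ! t \<in> W" if "t \<le> length \<Gamma>" for t
    using assms len that nth_mem[of t ws] unfolding quantum_walks_def by auto
qed

lemma path_root_snoc:
  "1 \<le> t \<Longrightarrow> t \<le> length \<Gamma> \<Longrightarrow> path_root (\<Gamma> @ \<Xi>) t = path_root \<Gamma> t"
  "path_root (\<Gamma> @ [\<gamma>]) (Suc (length \<Gamma>)) = \<gamma>"
  unfolding path_root_def by (auto simp: nth_append)

lemma path_level_append:
  "1 \<le> t \<Longrightarrow> t \<le> length \<Gamma> \<Longrightarrow> path_level \<Delta> B (\<Gamma> @ \<Xi>) t = path_level \<Delta> B \<Gamma> t"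
  unfolding path_level_def by (simp add: path_root_snoc alcove_at_append)

lemma path_colevel_append:
  "1 \<le> t \<Longrightarrow> t \<le> length \<Gamma> \<Longrightarrow> path_colevel \<Delta> B lam (\<Gamma> @ \<Xi>) t = path_colevel \<Delta> B lam \<Gamma> t"
  unfolding path_colevel_def by (simp add: path_root_snoc path_level_append)

lemma quantum_walks_snoc:
  "ws' \<in> quantum_walks \<Delta> B w (\<Gamma> @ [\<gamma>]) \<longleftrightarrow>
    (\<exists>ws y. ws' = ws @ [y] \<and> ws \<in> quantum_walks \<Delta> B w \<Gamma>
      \<and> (y = last ws \<or> y = s \<gamma> \<circ> last ws \<and> edge (last ws) y))" (is "?L \<longleftrightarrow> ?R")
proof -
  define n where "n = length \<Gamma>"
  define good where "good ws t \<longleftrightarrow> ws ! t = ws ! (t - 1) \<or>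
      ws ! t = s (path_root (\<Gamma> @ [\<gamma>]) t) \<circ> ws ! (t - 1) \<and> edge (ws ! (t - 1)) (ws ! t)" for ws t
  have L: "ws \<in> quantum_walks \<Delta> B w (\<Gamma> @ [\<gamma>]) \<longleftrightarrow>
      length ws = n + 2 \<and> set ws \<subseteq> W \<and> ws ! 0 = w \<and> (\<forall>t\<in>{1..n}. good ws t) \<and> good ws (Suc n)" for ws
    unfolding quantum_walks_def good_def n_def edge_def[symmetric]
    by (auto simp: atLeastAtMostSuc_conv)
  have R: "ws \<in> quantum_walks \<Delta> B w \<Gamma> \<longleftrightarrow>
      length ws = n + 1 \<and> set ws \<subseteq> W \<and> ws ! 0 = w \<and> (\<forall>t\<in>{1..n}. good ws t)" for ws
    unfolding quantum_walks_def good_def n_def edge_def[symmetric]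
    by (auto simp: path_root_snoc)
  have snoc: "ws @ [y] \<in> quantum_walks \<Delta> B w (\<Gamma> @ [\<gamma>]) \<longleftrightarrow> ws \<in> quantum_walks \<Delta> B w \<Gamma>
      \<and> (y = last ws \<or> y = s \<gamma> \<circ> last ws \<and> edge (last ws) y)" if len: "length ws = n + 1" for ws y
  proof -
    have low: "good (ws @ [y]) t \<longleftrightarrow> good ws t" if "t \<in> {1..n}" for t
      using that len unfolding good_def by (auto simp: nth_append)
    have "ws ! n = last ws" using len by (subst last_conv_nth) auto
    then have top: "good (ws @ [y]) (Suc n) \<longleftrightarrow> y = last ws \<or> y = s \<gamma> \<circ> last ws \<and> edge (last ws) y"
      using len path_root_snoc(2)[of \<Gamma> \<gamma>] unfolding good_def n_def by (simp add: nth_append)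
    have "y \<in> W" if "set ws \<subseteq> W" "y = last ws \<or> y = s \<gamma> \<circ> last ws \<and> edge (last ws) y"
    proof -
      have "last ws \<in> set ws" using len by (intro last_in_set) auto
      then show ?thesis using that unfolding edge_def qbg_edge_def by auto
    qed
    then show ?thesis unfolding L R using len low top by (auto simp: nth_append)
  qed
  show ?thesis
  proof
    assume l: ?L
    then have len: "length ws' = n + 2" unfolding L by simp
    then have "ws' \<noteq> []" by auto
    then have "ws' = butlast ws' @ [last ws']" "length (butlast ws') = n + 1" using len by auto
    then show ?R using l snoc[of "butlast ws'" "last ws'"] by metis
  next
    assume ?R
    then show ?L using snoc R by auto
  qed
qed

lemma refl_comp_neq:
  assumes "x \<in> W" "\<gamma> \<in> \<Delta>"
  shows "s \<gamma> \<circ> x \<noteq> x"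
proof
  assume "s \<gamma> \<circ> x = x"
  then have "s \<gamma> (x (inv x \<gamma>)) = x (inv x \<gamma>)" by (metis comp_apply)
  then have "- \<gamma> = \<gamma>" using assms by (simp add: weyl_inv_apply refl_self)
  then have "2 *\<^sub>R \<gamma> = 0" by (metis scaleR_2 add.left_inverse)
  then have "\<gamma> = 0" by simp
  then show False using assms zero_notin_roots by auto
qed

context
  fixes \<Gamma> :: "'a list" and \<gamma> lam :: 'a and w :: "'a \<Rightarrow> 'a" and ws :: "('a \<Rightarrow> 'a) list"
    and b b' :: "nat \<Rightarrow> nat" and y x :: "'a \<Rightarrow> 'a" and k :: real
  assumes roots: "set \<Gamma> \<subseteq> \<Delta>" "\<gamma> \<in> \<Delta>" and ws: "ws \<in> quantum_walks \<Delta> B w \<Gamma>"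
    and agree: "\<And>t. t \<in> S_set B \<Gamma> ws \<Longrightarrow> b' t = b t"
  defines "x \<equiv> last ws" and "k \<equiv> path_colevel \<Delta> B lam (\<Gamma> @ [\<gamma>]) (Suc (length \<Gamma>))"
  assumes y: "y = x \<or> y = s \<gamma> \<circ> x"
begin

lemma snoc_nth:
  "t \<le> length \<Gamma> \<Longrightarrow> (ws @ [z]) ! t = ws ! t" "(ws @ [z]) ! Suc (length \<Gamma>) = z" "ws ! length \<Gamma> = x" "x \<in> W"
  using walk_nth[OF ws] unfolding x_def by (auto simp: nth_append)

lemma snoc_sets:
  "T_set (\<Gamma> @ [\<gamma>]) (ws @ [y]) = T_set \<Gamma> ws \<union> (if y = x then {} else {Suc (length \<Gamma>)})"
  "Tminus_set \<Delta> B (\<Gamma> @ [\<gamma>]) (ws @ [y]) = Tminus_set \<Delta> B \<Gamma> ws \<union> (if len y < len x then {Suc (length \<Gamma>)} else {})"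
  "S_set B (\<Gamma> @ [\<gamma>]) (ws @ [y]) = S_set B \<Gamma> ws \<union> (if y = x \<and> - inv x \<gamma> \<in> B then {Suc (length \<Gamma>)} else {})"
proof -
  have split: "{t \<in> {1..length (\<Gamma> @ [\<gamma>])}. Q t} = {t \<in> {1..length \<Gamma>}. Q' t} \<union> (if c then {Suc (length \<Gamma>)} else {})"
    if "\<And>t. t \<in> {1..length \<Gamma>} \<Longrightarrow> Q t \<longleftrightarrow> Q' t" "Q (Suc (length \<Gamma>)) \<longleftrightarrow> c" for Q Q' c
    using that by (auto simp: atLeastAtMostSuc_conv)
  note simps = snoc_nth path_root_snoc
  have "T_set (\<Gamma> @ [\<gamma>]) (ws @ [y]) = T_set \<Gamma> ws \<union> (if y \<noteq> x then {Suc (length \<Gamma>)} else {})"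
    unfolding T_set_def using y refl_comp_neq[OF snoc_nth(4) roots(2)]
    by (intro split) (auto simp: simps)
  then show "T_set (\<Gamma> @ [\<gamma>]) (ws @ [y]) = T_set \<Gamma> ws \<union> (if y = x then {} else {Suc (length \<Gamma>)})" by simp
  have "bruhat_less \<Delta> B y x \<longleftrightarrow> len y < len x"
    using y bruhat_less_refl_iff[OF snoc_nth(4) roots(2)] bruhat_less_len[of x x] by auto
  then show "Tminus_set \<Delta> B (\<Gamma> @ [\<gamma>]) (ws @ [y]) = Tminus_set \<Delta> B \<Gamma> ws \<union> (if len y < len x then {Suc (length \<Gamma>)} else {})"
    unfolding Tminus_set_def by (intro split) (auto simp: simps)
  show "S_set B (\<Gamma> @ [\<gamma>]) (ws @ [y]) = S_set B \<Gamma> ws \<union> (if y = x \<and> - inv x \<gamma> \<in> B then {Suc (length \<Gamma>)} else {})"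
    unfolding S_set_def by (intro split) (auto simp: simps)
qed

lemma step_sets_bounded:
  "T_set \<Gamma> ws \<subseteq> {1..length \<Gamma>}" "Tminus_set \<Delta> B \<Gamma> ws \<subseteq> {1..length \<Gamma>}" "S_set B \<Gamma> ws \<subseteq> {1..length \<Gamma>}"
  unfolding T_set_def Tminus_set_def S_set_def by auto

lemma sum_snoc:
  fixes f f' :: "nat \<Rightarrow> 'z::comm_monoid_add"
  assumes "A \<subseteq> {1..length \<Gamma>}" "\<And>t. t \<in> A \<Longrightarrow> f' t = f t"
  shows "(\<Sum>t\<in>A \<union> (if c then {Suc (length \<Gamma>)} else {}). f' t) = (\<Sum>t\<in>A. f t) + (if c then f' (Suc (length \<Gamma>)) else 0)"
proof -
  have "Suc (length \<Gamma>) \<notin> A" "finite A" using assms(1) finite_subset[OF assms(1)] by auto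
  moreover have "sum f' A = sum f A" using assms(2) by (intro sum.cong) auto
  ultimately show ?thesis by (simp add: add.commute)
qed

lemma prod_snoc:
  fixes f f' :: "nat \<Rightarrow> int"
  assumes "A \<subseteq> {1..length \<Gamma>}" "\<And>t. t \<in> A \<Longrightarrow> f' t = f t"
  shows "(\<Prod>t\<in>A \<union> (if c then {Suc (length \<Gamma>)} else {}). f' t) = (\<Prod>t\<in>A. f t) * (if c then f' (Suc (length \<Gamma>)) else 1)"
proof -
  have "Suc (length \<Gamma>) \<notin> A" "finite A" using assms(1) finite_subset[OF assms(1)] by auto
  moreover have "prod f' A = prod f A" using assms(2) by (intro prod.cong) auto
  ultimately show ?thesis by (simp add: mult.commute)
qed

lemma qwt_upto_snoc_low:
  assumes "t \<le> length \<Gamma>"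
  shows "qwt_upto \<Delta> B (\<Gamma> @ [\<gamma>]) t (ws @ [y], b') = qwt_upto \<Delta> B \<Gamma> t (ws, b)"
proof -
  have "{u \<in> A \<union> (if c then {Suc (length \<Gamma>)} else {}). u \<le> t} = {u\<in>A. u \<le> t}" for A c
    using assms by auto
  moreover have "u \<in> {1..length \<Gamma>}" if "u \<in> Tminus_set \<Delta> B \<Gamma> ws \<or> u \<in> S_set B \<Gamma> ws" for u
    using that step_sets_bounded by auto
  ultimately show ?thesis
    unfolding qwt_upto_def snoc_sets prod.case
    by (intro arg_cong2[of _ _ _ _ "(-)"] sum.cong) (auto simp: snoc_nth path_root_snoc agree)
qed

lemma qwt_snoc:
  "qwt \<Delta> B (\<Gamma> @ [\<gamma>]) (ws @ [y], b') = qwt \<Delta> B \<Gamma> (ws, b)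
    + (if len y < len x then root_abs \<Delta> B (inv x \<gamma>) else 0)
    - (if y = x \<and> - inv x \<gamma> \<in> B then real (b' (Suc (length \<Gamma>))) *\<^sub>R inv x \<gamma> else 0)"
proof -
  have all: "{u \<in> A. u \<le> length \<Gamma>} = A" if "A \<subseteq> {1..length \<Gamma>}" for A :: "nat set"
    using that by auto
  have all': "{u \<in> A \<union> (if c then {Suc (length \<Gamma>)} else {}). u \<le> length (\<Gamma> @ [\<gamma>])}
      = A \<union> (if c then {Suc (length \<Gamma>)} else {})" if "A \<subseteq> {1..length \<Gamma>}" for A :: "nat set" and c
    using that by (auto split: if_splits)
  have abs: "root_abs \<Delta> B (inv y \<gamma>) = root_abs \<Delta> B (inv x \<gamma>)" if "len y < len x"
  proof -
    have "y = s \<gamma> \<circ> x" using y that by auto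
    then have "inv y \<gamma> = - inv x \<gamma>"
      using inv_refl_comp[OF snoc_nth(4) roots(2)] refl_self[OF roots(2)] inv_linear(3)[OF snoc_nth(4)] by simp
    moreover have "inv x \<gamma> \<in> \<Delta>" using cross_facts(1)[OF snoc_nth(4) roots(2)] .
    ultimately show ?thesis using neg_pos_iff[of "inv x \<gamma>"] by (auto simp: root_abs_def root_sgn_def)
  qed
  have T: "u \<in> {1..length \<Gamma>}" if "u \<in> Tminus_set \<Delta> B \<Gamma> ws" for u using that step_sets_bounded by auto
  have S: "u \<in> {1..length \<Gamma>}" if "u \<in> S_set B \<Gamma> ws" for u using that step_sets_bounded by auto
  have 1: "(\<Sum>u\<in>Tminus_set \<Delta> B (\<Gamma> @ [\<gamma>]) (ws @ [y]). root_abs \<Delta> B (inv ((ws @ [y]) ! u) (path_root (\<Gamma> @ [\<gamma>]) u)))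
      = (\<Sum>u\<in>Tminus_set \<Delta> B \<Gamma> ws. root_abs \<Delta> B (inv (ws ! u) (path_root \<Gamma> u)))
        + (if len y < len x then root_abs \<Delta> B (inv x \<gamma>) else 0)"
    unfolding snoc_sets
    by (subst sum_snoc[OF step_sets_bounded(2), where f = "\<lambda>u. root_abs \<Delta> B (inv (ws ! u) (path_root \<Gamma> u))"])
      (use T in \<open>auto simp: snoc_nth path_root_snoc abs\<close>)
  have 2: "(\<Sum>u\<in>S_set B (\<Gamma> @ [\<gamma>]) (ws @ [y]). real (b' u) *\<^sub>R inv ((ws @ [y]) ! u) (path_root (\<Gamma> @ [\<gamma>]) u))
      = (\<Sum>u\<in>S_set B \<Gamma> ws. real (b u) *\<^sub>R inv (ws ! u) (path_root \<Gamma> u))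
        + (if y = x \<and> - inv x \<gamma> \<in> B then real (b' (Suc (length \<Gamma>))) *\<^sub>R inv x \<gamma> else 0)"
    unfolding snoc_sets
    by (subst sum_snoc[OF step_sets_bounded(3), where f = "\<lambda>u. real (b u) *\<^sub>R inv (ws ! u) (path_root \<Gamma> u)"])
      (use S in \<open>auto simp: snoc_nth path_root_snoc agree\<close>)
  show ?thesis
    using 1 2 unfolding qwt_def qwt_upto_def prod.case all[OF step_sets_bounded(2)] all[OF step_sets_bounded(3)]
    unfolding snoc_sets all'[OF step_sets_bounded(2)] all'[OF step_sets_bounded(3)]
    by (simp add: algebra_simps)
qed

lemma rhat_snoc_low: "t \<le> length \<Gamma> \<Longrightarrow> rhat \<Delta> B (\<Gamma> @ [\<gamma>]) (ws @ [y]) t = rhat \<Delta> B \<Gamma> ws t"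
proof (induction t)
  case 0
  then show ?case by (simp add: snoc_nth)
next
  case (Suc t)
  then have "Suc t \<in> T_set (\<Gamma> @ [\<gamma>]) (ws @ [y]) \<longleftrightarrow> Suc t \<in> T_set \<Gamma> ws" unfolding snoc_sets by auto
  then show ?case using Suc by (simp add: path_root_snoc path_level_append o_def)
qed

text \<open>
  The linear part of the affine map after \<open>t\<close> steps is the inverse of the current element of the Weyl group.
\<close>

lemma rhat_add: "t \<le> length \<Gamma> \<Longrightarrow> rhat \<Delta> B \<Gamma> ws t (u + v) = rhat \<Delta> B \<Gamma> ws t u + inv (ws ! t) v"
proof (induction t arbitrary: u v)
  case 0
  then show ?case using walk_nth(2)[OF ws, of 0] by (simp add: inv_linear)
next
  case (Suc t)
  have x: "ws ! t \<in> W" and \<gamma>: "path_root \<Gamma> (Suc t) \<in> \<Delta>"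
    using walk_nth(2)[OF ws, of t] Suc.prems roots(1) unfolding path_root_def by auto
  have step: "ws ! Suc t = ws ! t \<or> ws ! Suc t = s (path_root \<Gamma> (Suc t)) \<circ> ws ! t"
  proof -
    have "\<forall>t\<in>{1..length \<Gamma>}. ws ! t = ws ! (t - 1) \<or> ws ! t = s (path_root \<Gamma> t) \<circ> ws ! (t - 1)"
      using ws unfolding quantum_walks_def by blast
    from bspec[OF this, of "Suc t"] show ?thesis using Suc.prems by simp
  qed
  have mem: "Suc t \<in> T_set \<Gamma> ws \<longleftrightarrow> ws ! Suc t = s (path_root \<Gamma> (Suc t)) \<circ> ws ! t"
    using Suc.prems unfolding T_set_def by auto
  have aff: "aff_refl g l (u + v) = aff_refl g l u + s g v" for g l
    unfolding aff_refl_def by (simp add: linear_add[OF linear_refl] algebra_simps)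
  show ?case
    using step mem Suc.IH Suc.prems by (auto simp: aff inv_refl_comp[OF x \<gamma>] inv_refl_comp[OF x \<gamma>, unfolded o_def])
qed

text \<open>
  A crossing moves \<open>lam\<close> by \<open>- k \<gamma>\<close> before the affine map of the previous steps is applied, and the linear part
  of that map is \<open>inv x\<close>.
\<close>

lemma wt_snoc:
  "wt \<Delta> B lam (\<Gamma> @ [\<gamma>]) (ws @ [y], b') = wt \<Delta> B lam \<Gamma> (ws, b) - (if y = x then 0 else k *\<^sub>R inv x \<gamma>)"
proof -
  define l where "l = path_level \<Delta> B (\<Gamma> @ [\<gamma>]) (Suc (length \<Gamma>))"
  have "aff_refl \<gamma> l lam = lam + - k *\<^sub>R \<gamma>"
    unfolding aff_refl_def root_refl_def k_def path_colevel_def l_def path_root_snoc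
    by (simp add: algebra_simps)
  then have "rhat \<Delta> B \<Gamma> ws (length \<Gamma>) (aff_refl \<gamma> l lam) = rhat \<Delta> B \<Gamma> ws (length \<Gamma>) lam + inv x (- k *\<^sub>R \<gamma>)"
    by (simp only: rhat_add[OF order_refl] snoc_nth)
  also have "\<dots> = rhat \<Delta> B \<Gamma> ws (length \<Gamma>) lam - k *\<^sub>R inv x \<gamma>"
    using inv_linear[OF snoc_nth(4)] by simp
  finally have cross: "rhat \<Delta> B \<Gamma> ws (length \<Gamma>) (aff_refl \<gamma> l lam) = \<dots>" .
  have "Suc (length \<Gamma>) \<in> T_set (\<Gamma> @ [\<gamma>]) (ws @ [y]) \<longleftrightarrow> y \<noteq> x"
    unfolding snoc_sets using step_sets_bounded(1) by auto
  then have "rhat \<Delta> B (\<Gamma> @ [\<gamma>]) (ws @ [y]) (Suc (length \<Gamma>)) lam =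
      (if y = x then rhat \<Delta> B \<Gamma> ws (length \<Gamma>) lam
       else rhat \<Delta> B \<Gamma> ws (length \<Gamma>) (aff_refl \<gamma> l lam))"
    unfolding rhat.simps rhat_snoc_low[OF order_refl] path_root_snoc(2) l_def[symmetric] by simp
  then show ?thesis using cross unfolding wt_def by (simp del: rhat.simps)
qed

lemma walk_acc_snoc:
  "walk_acc lam (\<Gamma> @ [\<gamma>]) (ws @ [y], b') = walk_acc lam \<Gamma> (ws, b)
    - (if y = x then 0 else k * (inv x \<gamma> \<bullet> (coscale *\<^sub>R qwt \<Delta> B (\<Gamma> @ [\<gamma>]) (ws @ [y], b'))))
    - (if len y < len x then root_sgn \<Delta> B \<gamma> * k else 0)
    - (if y = x \<and> - inv x \<gamma> \<in> B then real (b' (Suc (length \<Gamma>))) * k else 0)"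
proof -
  let ?G = "\<Gamma> @ [\<gamma>]" and ?p = "(ws @ [y], b')" and ?n = "length \<Gamma>"
  have low: "wt_step \<Delta> B lam ?G t ?p \<bullet> (coscale *\<^sub>R qwt_upto \<Delta> B ?G t ?p)
      = wt_step \<Delta> B lam \<Gamma> t (ws, b) \<bullet> (coscale *\<^sub>R qwt_upto \<Delta> B \<Gamma> t (ws, b))" if "t \<in> {1..?n}" for t
  proof -
    have "t \<le> ?n" "t - 1 \<le> ?n" using that by auto
    then show ?thesis by (simp add: wt_step_def rhat_snoc_low qwt_upto_snoc_low del: One_nat_def)
  qed
  have "wt_step \<Delta> B lam ?G (Suc ?n) ?p = wt \<Delta> B lam ?G ?p - wt \<Delta> B lam \<Gamma> (ws, b)"
    unfolding wt_step_def wt_def by (simp add: rhat_snoc_low del: rhat.simps(2))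
  then have top: "wt_step \<Delta> B lam ?G (Suc ?n) ?p = - (if y = x then 0 else k *\<^sub>R inv x \<gamma>)"
    unfolding wt_snoc by simp
  have last: "sum f {1..length ?G} = sum f {1..?n} + f (Suc ?n)" for f :: "nat \<Rightarrow> real" by simp
  have lows: "(\<Sum>t=1..?n. wt_step \<Delta> B lam ?G t ?p \<bullet> (coscale *\<^sub>R qwt_upto \<Delta> B ?G t ?p))
      = (\<Sum>t=1..?n. wt_step \<Delta> B lam \<Gamma> t (ws, b) \<bullet> (coscale *\<^sub>R qwt_upto \<Delta> B \<Gamma> t (ws, b)))"
    by (rule sum.cong[OF refl low])
  have "qwt \<Delta> B ?G ?p = qwt_upto \<Delta> B ?G (Suc ?n) ?p" unfolding qwt_def by simp
  then have "(\<Sum>t=1..length ?G. wt_step \<Delta> B lam ?G t ?p \<bullet> (coscale *\<^sub>R qwt_upto \<Delta> B ?G t ?p))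
      = (\<Sum>t=1..?n. wt_step \<Delta> B lam \<Gamma> t (ws, b) \<bullet> (coscale *\<^sub>R qwt_upto \<Delta> B \<Gamma> t (ws, b)))
        + wt_step \<Delta> B lam ?G (Suc ?n) ?p \<bullet> (coscale *\<^sub>R qwt \<Delta> B ?G ?p)"
    unfolding last lows by simp
  then have 1: "(\<Sum>t=1..length ?G. wt_step \<Delta> B lam ?G t ?p \<bullet> (coscale *\<^sub>R qwt_upto \<Delta> B ?G t ?p))
      = (\<Sum>t=1..?n. wt_step \<Delta> B lam \<Gamma> t (ws, b) \<bullet> (coscale *\<^sub>R qwt_upto \<Delta> B \<Gamma> t (ws, b)))
        - (if y = x then 0 else k * (inv x \<gamma> \<bullet> (coscale *\<^sub>R qwt \<Delta> B ?G ?p)))"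
    unfolding top by simp
  have T: "u \<in> {1..length \<Gamma>}" if "u \<in> Tminus_set \<Delta> B \<Gamma> ws" for u using that step_sets_bounded by auto
  have S: "u \<in> {1..length \<Gamma>}" if "u \<in> S_set B \<Gamma> ws" for u using that step_sets_bounded by auto
  have 2: "(\<Sum>t\<in>Tminus_set \<Delta> B ?G (ws @ [y]). root_sgn \<Delta> B (path_root ?G t) * path_colevel \<Delta> B lam ?G t)
      = (\<Sum>t\<in>Tminus_set \<Delta> B \<Gamma> ws. root_sgn \<Delta> B (path_root \<Gamma> t) * path_colevel \<Delta> B lam \<Gamma> t)
        + (if len y < len x then root_sgn \<Delta> B \<gamma> * k else 0)"
    unfolding snoc_sets
    by (subst sum_snoc[OF step_sets_bounded(2),
          where f = "\<lambda>t. root_sgn \<Delta> B (path_root \<Gamma> t) * path_colevel \<Delta> B lam \<Gamma> t"])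
      (use T in \<open>auto simp: path_root_snoc path_colevel_append k_def\<close>)
  have 3: "(\<Sum>t\<in>S_set B ?G (ws @ [y]). real (b' t) * path_colevel \<Delta> B lam ?G t)
      = (\<Sum>t\<in>S_set B \<Gamma> ws. real (b t) * path_colevel \<Delta> B lam \<Gamma> t)
        + (if y = x \<and> - inv x \<gamma> \<in> B then real (b' (Suc ?n)) * k else 0)"
    unfolding snoc_sets
    by (subst sum_snoc[OF step_sets_bounded(3), where f = "\<lambda>t. real (b t) * path_colevel \<Delta> B lam \<Gamma> t"])
      (use S in \<open>auto simp: path_colevel_append k_def agree\<close>)
  show ?thesis unfolding walk_acc_def prod.case 1 2 3 by simp
qed

lemma walk_sign_snoc:
  "walk_sign \<Delta> B (\<Gamma> @ [\<gamma>]) (ws @ [y], b') = walk_sign \<Delta> B \<Gamma> (ws, b)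
    * (if y = x then 1 else crossing_sign \<gamma> x)
    * (if y = x \<and> - inv x \<gamma> \<in> B then (- 1) ^ b' (Suc (length \<Gamma>)) else 1)"
proof -
  have T: "u \<in> {1..length \<Gamma>}" if "u \<in> T_set \<Gamma> ws" for u using that step_sets_bounded by auto
  have S: "u \<in> {1..length \<Gamma>}" if "u \<in> S_set B \<Gamma> ws" for u using that step_sets_bounded by auto
  define A where "A = {t \<in> T_set \<Gamma> ws. inv (ws ! (t - 1)) (path_root \<Gamma> t) \<in> P}"
  have "{t \<in> T_set (\<Gamma> @ [\<gamma>]) (ws @ [y]). inv ((ws @ [y]) ! (t - 1)) (path_root (\<Gamma> @ [\<gamma>]) t) \<in> P}
      = A \<union> (if y \<noteq> x \<and> inv x \<gamma> \<in> P then {Suc (length \<Gamma>)} else {})"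
  proof -
    have "(ws @ [z]) ! (t - 1) = ws ! (t - 1)" if "t \<in> T_set \<Gamma> ws" for t z
      using T[OF that] by (intro snoc_nth(1)) auto
    then show ?thesis unfolding snoc_sets A_def using T by (auto simp: snoc_nth path_root_snoc)
  qed
  moreover have "A \<subseteq> {1..length \<Gamma>}" unfolding A_def using T by auto
  ultimately have 1: "(\<Prod>t\<in>{t \<in> T_set (\<Gamma> @ [\<gamma>]) (ws @ [y]). inv ((ws @ [y]) ! (t - 1)) (path_root (\<Gamma> @ [\<gamma>]) t) \<in> P}. - 1)
      = (\<Prod>t\<in>A. - 1) * (if y = x then 1 else crossing_sign \<gamma> x)"
    using prod_snoc[of A "\<lambda>_. - 1" "\<lambda>_. - 1"] unfolding crossing_sign_def by auto
  have 2: "(\<Prod>t\<in>S_set B (\<Gamma> @ [\<gamma>]) (ws @ [y]). (- 1) ^ b' t)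
      = (\<Prod>t\<in>S_set B \<Gamma> ws. (- 1) ^ b t)
        * (if y = x \<and> - inv x \<gamma> \<in> B then (- 1) ^ b' (Suc (length \<Gamma>)) else (1::int))"
    unfolding snoc_sets
    by (subst prod_snoc[OF step_sets_bounded(3), where f = "\<lambda>t. (- 1) ^ b t"]) (simp_all add: agree)
  show ?thesis unfolding walk_sign_def prod.case 1 2 A_def by simp
qed

end

text \<open>
  The decorated walks over \<open>\<Gamma> @ [\<gamma>]\<close> that restrict to a given decorated walk over \<open>\<Gamma>\<close>; \<open>retraction\<close> below is the
  restriction map.
\<close>

definition extensions :: "'a list \<Rightarrow> 'a \<Rightarrow> 'a decorated_walk \<Rightarrow> 'a decorated_walk set" where
  "extensions \<Gamma> \<gamma> = (\<lambda>(ws, b).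
     (if - inv (last ws) \<gamma> \<in> B
      then {(ws @ [last ws], b(Suc (length \<Gamma>) := 0)), (ws @ [last ws], b(Suc (length \<Gamma>) := 1))}
      else {(ws @ [last ws], b)})
     \<union> (if edge (last ws) (s \<gamma> \<circ> last ws) then {(ws @ [s \<gamma> \<circ> last ws], b)} else {}))"

definition retraction :: "'a list \<Rightarrow> 'a decorated_walk \<Rightarrow> 'a decorated_walk" where
  "retraction \<Gamma> = (\<lambda>(ws, b). (butlast ws, restrict b (S_set B \<Gamma> (butlast ws))))"

lemma S_set_bounded: "S_set B \<Gamma> ws \<subseteq> {1..length \<Gamma>}"
  unfolding S_set_def by auto

lemma decorated_walks_snoc:
  assumes roots: "set \<Gamma> \<subseteq> \<Delta>" "\<gamma> \<in> \<Delta>"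
  shows "decorated_walks \<Delta> B w (\<Gamma> @ [\<gamma>]) = (\<Union>p\<in>decorated_walks \<Delta> B w \<Gamma>. extensions \<Gamma> \<gamma> p)"
    and "p \<in> decorated_walks \<Delta> B w \<Gamma> \<Longrightarrow> p' \<in> extensions \<Gamma> \<gamma> p \<Longrightarrow> retraction \<Gamma> p' = p"
proof -
  let ?m = "Suc (length \<Gamma>)"
  have m: "?m \<notin> S_set B \<Gamma> ws" for ws using S_set_bounded[of \<Gamma> ws] by auto
  show retr: "retraction \<Gamma> p' = p" if p: "p \<in> decorated_walks \<Delta> B w \<Gamma>" and p': "p' \<in> extensions \<Gamma> \<gamma> p" for p p'
  proof -
    obtain ws b where eq: "p = (ws, b)" by (cases p)
    then have b: "b \<in> S_set B \<Gamma> ws \<rightarrow>\<^sub>E {0, 1}" using p unfolding decorated_walks_def by auto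
    then have "restrict b (S_set B \<Gamma> ws) = b" by (rule PiE_restrict)
    moreover from this have "restrict (b(?m := e)) (S_set B \<Gamma> ws) = b" for e
      using m[of ws] by (metis restrict_upd fun_upd_triv restrict_fupd)
    ultimately show ?thesis
      using p' unfolding eq extensions_def retraction_def by (auto split: if_splits)
  qed
  have S: "S_set B (\<Gamma> @ [\<gamma>]) (ws @ [y]) = S_set B \<Gamma> ws \<union> (if y = last ws \<and> - inv (last ws) \<gamma> \<in> B then {?m} else {})"
    if "ws \<in> quantum_walks \<Delta> B w \<Gamma>" "y = last ws \<or> y = s \<gamma> \<circ> last ws" for ws y
    by (rule snoc_sets(3)[OF roots that(1) refl that(2)])
  have ne: "s \<gamma> \<circ> last ws \<noteq> last ws" if "ws \<in> quantum_walks \<Delta> B w \<Gamma>" for ws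
    using walk_nth[OF that] refl_comp_neq[OF _ roots(2)] by simp
  show "decorated_walks \<Delta> B w (\<Gamma> @ [\<gamma>]) = (\<Union>p\<in>decorated_walks \<Delta> B w \<Gamma>. extensions \<Gamma> \<gamma> p)"
  proof (intro equalityI subsetI)
    fix p' assume p': "p' \<in> decorated_walks \<Delta> B w (\<Gamma> @ [\<gamma>])"
    obtain ws' b' where eq: "p' = (ws', b')" by (cases p')
    then obtain ws y where ws: "ws' = ws @ [y]" "ws \<in> quantum_walks \<Delta> B w \<Gamma>"
        "y = last ws \<or> y = s \<gamma> \<circ> last ws \<and> edge (last ws) y"
      using p' quantum_walks_snoc[of ws' w \<Gamma> \<gamma>] unfolding decorated_walks_def by auto
    then have y: "y = last ws \<or> y = s \<gamma> \<circ> last ws" by auto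
    have b': "b' \<in> S_set B (\<Gamma> @ [\<gamma>]) (ws @ [y]) \<rightarrow>\<^sub>E {0, 1}"
      using p' unfolding eq ws(1) decorated_walks_def by auto
    define b where "b = restrict b' (S_set B \<Gamma> ws)"
    have mem: "(ws, b) \<in> decorated_walks \<Delta> B w \<Gamma>"
    proof -
      have "b' t \<in> {0, 1}" if "t \<in> S_set B \<Gamma> ws" for t
        using PiE_mem[OF b', of t] that unfolding S[OF ws(2) y] by simp
      then show ?thesis using ws(2) unfolding decorated_walks_def b_def by auto
    qed
    have "p' \<in> extensions \<Gamma> \<gamma> (ws, b)"
    proof (cases "y = last ws \<and> - inv (last ws) \<gamma> \<in> B")
      case True
      then have "b' \<in> insert ?m (S_set B \<Gamma> ws) \<rightarrow>\<^sub>E {0, 1}" using b' unfolding S[OF ws(2) y] by simp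
      then have "b' = b(?m := b' ?m)" "b' ?m \<in> {0, 1}"
        unfolding b_def by (auto simp: fun_eq_iff PiE_def Pi_def extensional_def restrict_def)
      then show ?thesis using True unfolding eq ws(1) extensions_def by auto
    next
      case False
      have "b' \<in> S_set B \<Gamma> ws \<rightarrow>\<^sub>E {0, 1}" using b' unfolding S[OF ws(2) y] if_not_P[OF False] by simp
      then have "b' = b" unfolding b_def by (simp add: PiE_restrict)
      then show ?thesis using False ws(3) unfolding eq ws(1) extensions_def by auto
    qed
    then show "p' \<in> (\<Union>p\<in>decorated_walks \<Delta> B w \<Gamma>. extensions \<Gamma> \<gamma> p)" using mem by blast
  next
    fix p' assume "p' \<in> (\<Union>p\<in>decorated_walks \<Delta> B w \<Gamma>. extensions \<Gamma> \<gamma> p)"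
    then obtain ws b where wb: "(ws, b) \<in> decorated_walks \<Delta> B w \<Gamma>" "p' \<in> extensions \<Gamma> \<gamma> (ws, b)" by auto
    then have ws: "ws \<in> quantum_walks \<Delta> B w \<Gamma>" and b: "b \<in> S_set B \<Gamma> ws \<rightarrow>\<^sub>E {0, 1}"
      unfolding decorated_walks_def by auto
    have b1: "b(?m := e) \<in> insert ?m (S_set B \<Gamma> ws) \<rightarrow>\<^sub>E {0, 1}" if "e \<in> {0, 1}" for e
      using b that by (auto simp: PiE_def Pi_def extensional_def)
    define D where "D = (\<lambda>S::nat set. S \<rightarrow>\<^sub>E {0::nat, 1})"
    have member: "(ws @ [y], c) \<in> decorated_walks \<Delta> B w (\<Gamma> @ [\<gamma>])"
      if "y = last ws \<or> y = s \<gamma> \<circ> last ws \<and> edge (last ws) y"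
        "c \<in> D (S_set B \<Gamma> ws \<union> (if y = last ws \<and> - inv (last ws) \<gamma> \<in> B then {?m} else {}))" for y c
    proof -
      have "ws @ [y] \<in> quantum_walks \<Delta> B w (\<Gamma> @ [\<gamma>])" using that(1) ws quantum_walks_snoc by blast
      moreover have "y = last ws \<or> y = s \<gamma> \<circ> last ws" using that(1) by blast
      ultimately show ?thesis using that(2) S[OF ws] unfolding decorated_walks_def D_def by simp
    qed
    have "b \<in> D (S_set B \<Gamma> ws)" "b(?m := 0) \<in> D (insert ?m (S_set B \<Gamma> ws))"
        "b(?m := 1) \<in> D (insert ?m (S_set B \<Gamma> ws))"
      using b b1[of 0] b1[of 1] unfolding D_def by simp_all
    then show "p' \<in> decorated_walks \<Delta> B w (\<Gamma> @ [\<gamma>])"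
      using wb(2) ne[OF ws] unfolding extensions_def
      by (auto intro!: member split: if_splits)
  qed
qed

lemma decorated_walks_Nil:
  assumes "w \<in> W"
  shows "decorated_walks \<Delta> B w [] = {([w], \<lambda>_. undefined)}"
proof -
  have "ws \<in> quantum_walks \<Delta> B w [] \<longleftrightarrow> ws = [w]" for ws
    using assms unfolding quantum_walks_def by (auto simp: length_Suc_conv)
  moreover have "S_set B [] ws = {}" for ws :: "('a \<Rightarrow> 'a) list" unfolding S_set_def by simp
  ultimately show ?thesis unfolding decorated_walks_def by auto
qed

lemma finite_extensions: "finite (extensions \<Gamma> \<gamma> p)"
  unfolding extensions_def by (cases p) simp

lemma finite_decorated_walks:
  assumes "set \<Gamma> \<subseteq> \<Delta>" "w \<in> W"
  shows "finite (decorated_walks \<Delta> B w \<Gamma>)"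
  using assms(1)
proof (induction \<Gamma> rule: rev_induct)
  case Nil
  then show ?case by (simp add: decorated_walks_Nil assms)
next
  case (snoc \<gamma> \<Gamma>)
  then show ?case by (simp add: decorated_walks_snoc(1) finite_extensions)
qed

text \<open>
  Every walk with one more step extends a unique walk, and the new state depends on the old one and on the
  choice made at this step only.
\<close>

lemma walk_sum_snoc:
  assumes roots: "set \<Gamma> \<subseteq> \<Delta>" "\<gamma> \<in> \<Delta>" and w: "w \<in> W"
  shows "walk_sum lam w (\<Gamma> @ [\<gamma>]) F
    = walk_sum lam w \<Gamma> (step_op \<gamma> (path_colevel \<Delta> B lam (\<Gamma> @ [\<gamma>]) (Suc (length \<Gamma>))) F)"
proof -
  let ?m = "Suc (length \<Gamma>)"
  define k where "k = path_colevel \<Delta> B lam (\<Gamma> @ [\<gamma>]) ?m"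
  define contrib where "contrib \<Gamma> F p = walk_sign \<Delta> B \<Gamma> p * F (walk_end p) (qwt \<Delta> B \<Gamma> p) (wt \<Delta> B lam \<Gamma> p) (walk_acc lam \<Gamma> p)"
    for \<Gamma> F p
  have step: "(\<Sum>p'\<in>extensions \<Gamma> \<gamma> p. contrib (\<Gamma> @ [\<gamma>]) F p') = contrib \<Gamma> (step_op \<gamma> k F) p"
    if p: "p \<in> decorated_walks \<Delta> B w \<Gamma>" for p
  proof -
    obtain ws b where eq: "p = (ws, b)" by (cases p)
    then have ws: "ws \<in> quantum_walks \<Delta> B w \<Gamma>" using p unfolding decorated_walks_def by auto
    define x y where "x = last ws" and "y = s \<gamma> \<circ> x"
    have x: "x \<in> W" using walk_nth[OF ws] unfolding x_def by simp
    have ne: "y \<noteq> x" unfolding y_def using refl_comp_neq[OF x roots(2)] .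
    have agree: "(b(?m := e)) t = b t" if "t \<in> S_set B \<Gamma> ws" for t e
      using that S_set_bounded[of \<Gamma> ws] by auto
    define q \<omega> D where "q = qwt \<Delta> B \<Gamma> p" and "\<omega> = wt \<Delta> B lam \<Gamma> p" and "D = walk_acc lam \<Gamma> p"
    have fin: "walk_end (ws @ [z], b') = z" "walk_end p = x" for z b'
      unfolding walk_end_def eq x_def by simp_all
    note snoc = qwt_snoc[OF roots ws] wt_snoc[OF roots ws] walk_acc_snoc[OF roots ws] walk_sign_snoc[OF roots ws]
    have stay: "contrib (\<Gamma> @ [\<gamma>]) F (ws @ [x], b) = walk_sign \<Delta> B \<Gamma> p * F x q \<omega> D" if "- inv x \<gamma> \<notin> B"
      using that snoc[OF refl, of x] unfolding contrib_def q_def \<omega>_def D_def eq fin x_def[symmetric] by simp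
    have stay': "contrib (\<Gamma> @ [\<gamma>]) F (ws @ [x], b(?m := e))
        = walk_sign \<Delta> B \<Gamma> p * (- 1) ^ e * F x (q - real e *\<^sub>R inv x \<gamma>) \<omega> (D - real e * k)"
      if "- inv x \<gamma> \<in> B" for e
      using that snoc[of "b(?m := e)" b x, OF agree]
      unfolding contrib_def q_def \<omega>_def D_def eq fin x_def[symmetric] k_def by simp
    have cross: "contrib (\<Gamma> @ [\<gamma>]) F (ws @ [y], b) = walk_sign \<Delta> B \<Gamma> p * (crossing_sign \<gamma> x
        * F y (q + descent_root \<gamma> x) (\<omega> - k *\<^sub>R inv x \<gamma>)
            (D - k * (inv x \<gamma> \<bullet> (coscale *\<^sub>R (q + descent_root \<gamma> x)))
             - (if len y < len x then root_sgn \<Delta> B \<gamma> * k else 0)))"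
      using ne snoc[OF refl, of y, folded x_def, unfolded y_def, OF disjI2[OF refl], folded y_def]
      unfolding contrib_def q_def \<omega>_def D_def eq fin k_def descent_root_def y_def[symmetric]
      by (simp add: mult.assoc)
    have differ: "b(?m := 0) \<noteq> b(?m := 1)"
    proof
      assume "b(?m := 0) = b(?m := 1)"
      from fun_cong[OF this, of ?m] show False by simp
    qed
    let ?c = "contrib (\<Gamma> @ [\<gamma>]) F"
    have "extensions \<Gamma> \<gamma> p = (if - inv x \<gamma> \<in> B then {(ws @ [x], b(?m := 0)), (ws @ [x], b(?m := 1))} else {(ws @ [x], b)})
        \<union> (if edge x y then {(ws @ [y], b)} else {})"
      unfolding eq extensions_def prod.case x_def[symmetric] y_def ..
    then have "sum ?c (extensions \<Gamma> \<gamma> p)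
        = (if - inv x \<gamma> \<in> B then ?c (ws @ [x], b(?m := 0)) + ?c (ws @ [x], b(?m := 1)) else ?c (ws @ [x], b))
          + (if edge x y then ?c (ws @ [y], b) else 0)"
      using differ ne by (cases "- inv x \<gamma> \<in> B"; cases "edge x y") (simp_all add: add.assoc)
    also have "\<dots> = walk_sign \<Delta> B \<Gamma> p * step_op \<gamma> k F x q \<omega> D"
      using x by (simp add: stay stay'[of 0, simplified] stay'[of 1, simplified] cross step_op_def
          y_def[symmetric] distrib_left right_diff_distrib)
    also have "\<dots> = contrib \<Gamma> (step_op \<gamma> k F) p"
      unfolding contrib_def fin q_def \<omega>_def D_def ..
    finally show ?thesis .
  qed
  have "walk_sum lam w (\<Gamma> @ [\<gamma>]) F = (\<Sum>p'\<in>(\<Union>p\<in>decorated_walks \<Delta> B w \<Gamma>. extensions \<Gamma> \<gamma> p). contrib (\<Gamma> @ [\<gamma>]) F p')"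
    unfolding walk_sum_def contrib_def decorated_walks_snoc(1)[OF roots] ..
  also have "\<dots> = (\<Sum>p\<in>decorated_walks \<Delta> B w \<Gamma>. \<Sum>p'\<in>extensions \<Gamma> \<gamma> p. contrib (\<Gamma> @ [\<gamma>]) F p')"
  proof (rule sum.UNION_disjoint)
    show "\<forall>p\<in>decorated_walks \<Delta> B w \<Gamma>. \<forall>p'\<in>decorated_walks \<Delta> B w \<Gamma>. p \<noteq> p' \<longrightarrow> extensions \<Gamma> \<gamma> p \<inter> extensions \<Gamma> \<gamma> p' = {}"
      using decorated_walks_snoc(2)[OF roots] by blast
  qed (use finite_decorated_walks[OF roots(1) w] finite_extensions in auto)
  also have "\<dots> = (\<Sum>p\<in>decorated_walks \<Delta> B w \<Gamma>. contrib \<Gamma> (step_op \<gamma> k F) p)"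
    using step by (rule sum.cong[OF refl])
  finally show ?thesis unfolding walk_sum_def contrib_def k_def .
qed

end

section \<open>Invariance under Yang-Baxter transformations\<close>

context simply_laced_base
begin

text \<open>
  Once two paths have reached the same alcove, the same roots lead through the same walls, so the operators of the
  common suffix agree.
\<close>

lemma walk_sum_same_suffix:
  assumes w: "w \<in> W" and same: "length us = length us'" "alcove_at \<Delta> B us (length us) = alcove_at \<Delta> B us' (length us')"
    and start: "\<And>F. walk_sum lam w us F = walk_sum lam w us' F"
    and roots: "set us \<subseteq> \<Delta>" "set us' \<subseteq> \<Delta>" "set vs \<subseteq> \<Delta>"
  shows "walk_sum lam w (us @ vs) F = walk_sum lam w (us' @ vs) F"
  using roots(3)
proof (induction vs arbitrary: F rule: rev_induct)
  case Nil
  then show ?case using start by simp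
next
  case (snoc v vs)
  let ?n = "length us + length vs"
  have at: "alcove_at \<Delta> B (us @ vs @ [v]) t = alcove_at \<Delta> B (us' @ vs @ [v]) t" if "length us \<le> t" for t
    using alcove_at_same_suffix[OF same that] .
  have "path_root (us @ vs @ [v]) (Suc ?n) = v" "path_root (us' @ vs @ [v]) (Suc ?n) = v"
    using path_root_snoc(2)[of "us @ vs" v] path_root_snoc(2)[of "us' @ vs" v] same(1) by simp_all
  then have "path_colevel \<Delta> B lam (us @ vs @ [v]) (Suc ?n) = path_colevel \<Delta> B lam (us' @ vs @ [v]) (Suc ?n)"
    unfolding path_colevel_def path_level_def using at[of ?n] at[of "Suc ?n"] by (simp del: alcove_at.simps)
  then show ?case
    using walk_sum_snoc[of "us @ vs" v w lam F] walk_sum_snoc[of "us' @ vs" v w lam F] roots snoc w same(1)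
    by simp
qed

lemma walk_sum_two:
  assumes "set us \<subseteq> \<Delta>" "\<alpha> \<in> \<Delta>" "\<beta> \<in> \<Delta>" "w \<in> W"
  shows "walk_sum lam w (us @ [\<alpha>, \<beta>]) F
    = walk_sum lam w us (step_op \<alpha> (path_colevel \<Delta> B lam (us @ [\<alpha>, \<beta>] @ vs) (length us + 1))
        (step_op \<beta> (path_colevel \<Delta> B lam (us @ [\<alpha>, \<beta>] @ vs) (length us + 2)) F))"
  using walk_sum_snoc[of us \<alpha> w lam] walk_sum_snoc[of "us @ [\<alpha>]" \<beta> w lam] assms
    path_colevel_append[of "length us + 1" "us @ [\<alpha>]" lam "\<beta> # vs"]
    path_colevel_append[of "length us + 2" "us @ [\<alpha>, \<beta>]" lam vs]
  by simp

lemma walk_sum_three: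
  assumes "set us \<subseteq> \<Delta>" "\<alpha> \<in> \<Delta>" "\<beta> \<in> \<Delta>" "\<gamma> \<in> \<Delta>" "w \<in> W"
  shows "walk_sum lam w (us @ [\<alpha>, \<beta>, \<gamma>]) F
    = walk_sum lam w us (step_op \<alpha> (path_colevel \<Delta> B lam (us @ [\<alpha>, \<beta>, \<gamma>] @ vs) (length us + 1))
        (step_op \<beta> (path_colevel \<Delta> B lam (us @ [\<alpha>, \<beta>, \<gamma>] @ vs) (length us + 2))
          (step_op \<gamma> (path_colevel \<Delta> B lam (us @ [\<alpha>, \<beta>, \<gamma>] @ vs) (length us + 3)) F)))"
  using walk_sum_two[of us \<alpha> \<beta> w lam _ "\<gamma> # vs"] walk_sum_snoc[of "us @ [\<alpha>, \<beta>]" \<gamma> w lam F] assms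
    path_colevel_append[of "length us + 3" "us @ [\<alpha>, \<beta>, \<gamma>]" lam vs]
  by (simp add: eval_nat_numeral)

text \<open>
  The levels of the walls of the segment are determined by the alcove before it, so the two segments give the same
  factors in opposite order, and the Yang-Baxter equations for the step operators apply.
\<close>

lemma walk_sum_yang_baxter:
  assumes w: "w \<in> W" and paths: "alcove_path \<Delta> B lam \<Gamma>" "alcove_path \<Delta> B lam \<Xi>" and yb: "yang_baxter \<Delta> \<Gamma> \<Xi>"
  shows "walk_sum lam w \<Gamma> F = walk_sum lam w \<Xi> F"
proof -
  obtain us vs \<alpha> \<beta> where roots: "\<alpha> \<in> \<Delta>" "\<beta> \<in> \<Delta>" and
    cases: "\<alpha> \<bullet> coroot \<beta> = 0 \<and> \<Gamma> = us @ [\<alpha>, \<beta>] @ vs \<and> \<Xi> = us @ [\<beta>, \<alpha>] @ vs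
      \<or> \<alpha> \<bullet> coroot \<beta> = - 1 \<and> \<Gamma> = us @ [\<alpha>, \<alpha> + \<beta>, \<beta>] @ vs \<and> \<Xi> = us @ [\<beta>, \<alpha> + \<beta>, \<alpha>] @ vs"
    using yb unfolding yang_baxter_def by auto
  have sets: "set us \<subseteq> \<Delta>" "set vs \<subseteq> \<Delta>" using path_subset_roots[OF paths(1)] cases by auto
  define A where "A = alcove_at \<Delta> B us (length us)"
  from cases show ?thesis
  proof
    assume c: "\<alpha> \<bullet> coroot \<beta> = 0 \<and> \<Gamma> = us @ [\<alpha>, \<beta>] @ vs \<and> \<Xi> = us @ [\<beta>, \<alpha>] @ vs"
    then have pairing: "\<alpha> \<bullet> coroot \<beta> = 0" and \<Gamma>: "\<Gamma> = us @ [\<alpha>, \<beta>] @ vs" and \<Xi>: "\<Xi> = us @ [\<beta>, \<alpha>] @ vs" by auto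
    have ne: "\<beta> \<noteq> \<alpha>" "\<beta> \<noteq> - \<alpha>" "\<alpha> \<noteq> \<beta>" "\<alpha> \<noteq> - \<beta>" using pairing coroot_self[OF roots(2)] by auto
    note lev\<Gamma> = orthogonal_segment_levels[OF paths(1)[unfolded \<Gamma>] ne(1,2), folded A_def]
    note lev\<Xi> = orthogonal_segment_levels[OF paths(2)[unfolded \<Xi>] ne(3,4), folded A_def]
    have "alcove_at \<Delta> B (us @ [\<alpha>, \<beta>]) (length us + 2) = alcove_at \<Delta> B (us @ [\<beta>, \<alpha>]) (length us + 2)"
      using lev\<Gamma>(3,4) lev\<Xi>(3,4) by (intro alcove_eqI) auto
    moreover have "walk_sum lam w (us @ [\<alpha>, \<beta>]) F' = walk_sum lam w (us @ [\<beta>, \<alpha>]) F'" for F'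
    proof -
      define k l where "k = lam \<bullet> coroot \<alpha> - of_int (level A \<alpha> + 1)" and "l = lam \<bullet> coroot \<beta> - of_int (level A \<beta> + 1)"
      have "path_colevel \<Delta> B lam (us @ [\<alpha>, \<beta>] @ vs) (length us + 1) = k"
        "path_colevel \<Delta> B lam (us @ [\<alpha>, \<beta>] @ vs) (length us + 2) = l"
        "path_colevel \<Delta> B lam (us @ [\<beta>, \<alpha>] @ vs) (length us + 1) = l"
        "path_colevel \<Delta> B lam (us @ [\<beta>, \<alpha>] @ vs) (length us + 2) = k"
        using lev\<Gamma>(1,2) lev\<Xi>(1,2) unfolding k_def l_def path_colevel_def path_root_def by (simp_all add: nth_append)
      then show ?thesis
        using walk_sum_two[OF sets(1) roots w, of lam F' vs] walk_sum_two[OF sets(1) roots(2,1) w, of lam F' vs]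
          step_op_orthogonal[OF roots pairing] by simp
    qed
    ultimately show ?thesis
      using walk_sum_same_suffix[OF w, of "us @ [\<alpha>, \<beta>]" "us @ [\<beta>, \<alpha>]" lam vs F] roots sets
      unfolding \<Gamma> \<Xi> by (simp del: alcove_at.simps)
  next
    assume c: "\<alpha> \<bullet> coroot \<beta> = - 1 \<and> \<Gamma> = us @ [\<alpha>, \<alpha> + \<beta>, \<beta>] @ vs \<and> \<Xi> = us @ [\<beta>, \<alpha> + \<beta>, \<alpha>] @ vs"
    then have pairing: "\<alpha> \<bullet> coroot \<beta> = - 1" and \<Gamma>: "\<Gamma> = us @ [\<alpha>, \<alpha> + \<beta>, \<beta>] @ vs"
      and \<Xi>: "\<Xi> = us @ [\<beta>, \<beta> + \<alpha>, \<alpha>] @ vs" by (auto simp: add.commute)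
    have pairing': "\<beta> \<bullet> coroot \<alpha> = - 1" using pairing pairing_sym[OF roots] by simp
    have sum: "\<alpha> + \<beta> \<in> \<Delta>" "\<beta> + \<alpha> \<in> \<Delta>"
      using dihedral_relations(1)[OF roots pairing] by (simp_all add: add.commute)
    note lev\<Gamma> = braid_segment_levels[OF paths(1)[unfolded \<Gamma>] roots pairing, folded A_def]
    note lev\<Xi> = braid_segment_levels[OF paths(2)[unfolded \<Xi>] roots(2,1) pairing', folded A_def]
    have "alcove_at \<Delta> B (us @ [\<alpha>, \<alpha> + \<beta>, \<beta>]) (length us + 3) = alcove_at \<Delta> B (us @ [\<beta>, \<beta> + \<alpha>, \<alpha>]) (length us + 3)"
      using lev\<Gamma>(4,5) lev\<Xi>(4,5) by (intro alcove_eqI) (auto simp: add.commute[of \<beta> \<alpha>])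
    then have "alcove_at \<Delta> B (us @ [\<alpha>, \<alpha> + \<beta>, \<beta>]) (length (us @ [\<alpha>, \<alpha> + \<beta>, \<beta>]))
        = alcove_at \<Delta> B (us @ [\<beta>, \<beta> + \<alpha>, \<alpha>]) (length (us @ [\<beta>, \<beta> + \<alpha>, \<alpha>]))"
      by (simp add: eval_nat_numeral del: alcove_at.simps)
    moreover have "walk_sum lam w (us @ [\<alpha>, \<alpha> + \<beta>, \<beta>]) F' = walk_sum lam w (us @ [\<beta>, \<beta> + \<alpha>, \<alpha>]) F'" for F'
    proof -
      define k l where "k = lam \<bullet> coroot \<alpha> - of_int (level A \<alpha> + 1)" and "l = lam \<bullet> coroot \<beta> - of_int (level A \<beta> + 1)"
      have "lam \<bullet> coroot (\<alpha> + \<beta>) = lam \<bullet> coroot \<alpha> + lam \<bullet> coroot \<beta>"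
        by (simp add: coroot_eq roots sum scaleR_add_right inner_add_right)
      then have "path_colevel \<Delta> B lam (us @ [\<alpha>, \<alpha> + \<beta>, \<beta>] @ vs) (length us + 1) = k"
        "path_colevel \<Delta> B lam (us @ [\<alpha>, \<alpha> + \<beta>, \<beta>] @ vs) (length us + 2) = k + l"
        "path_colevel \<Delta> B lam (us @ [\<alpha>, \<alpha> + \<beta>, \<beta>] @ vs) (length us + 3) = l"
        "path_colevel \<Delta> B lam (us @ [\<beta>, \<beta> + \<alpha>, \<alpha>] @ vs) (length us + 1) = l"
        "path_colevel \<Delta> B lam (us @ [\<beta>, \<beta> + \<alpha>, \<alpha>] @ vs) (length us + 2) = k + l"
        "path_colevel \<Delta> B lam (us @ [\<beta>, \<beta> + \<alpha>, \<alpha>] @ vs) (length us + 3) = k"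
        using lev\<Gamma>(1,2,3) lev\<Xi>(1,2,3) unfolding k_def l_def path_colevel_def path_root_def
        by (simp_all add: nth_append eval_nat_numeral add.commute[of \<beta> \<alpha>])
      then show ?thesis
        using walk_sum_three[OF sets(1) roots(1) sum(1) roots(2) w, of lam F' vs]
          walk_sum_three[OF sets(1) roots(2) sum(2) roots(1) w, of lam F' vs]
          step_op_braid[OF roots pairing, of k l] by (simp add: add.commute[of \<beta> \<alpha>])
    qed
    ultimately show ?thesis
      using walk_sum_same_suffix[OF w, of "us @ [\<alpha>, \<alpha> + \<beta>, \<beta>]" "us @ [\<beta>, \<beta> + \<alpha>, \<alpha>]" lam vs F] roots sets sum
      unfolding \<Gamma> \<Xi> by (simp del: alcove_at.simps)
  qed
qed

definition walk_state :: "'a \<Rightarrow> 'a list \<Rightarrow> 'a decorated_walk \<Rightarrow> ('a \<Rightarrow> 'a) \<times> 'a \<times> 'a \<times> real" where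
  "walk_state lam \<Gamma> p = (walk_end p, qwt \<Delta> B \<Gamma> p, wt \<Delta> B lam \<Gamma> p, walk_acc lam \<Gamma> p)"

lemma qwt_co_upto_eq:
  assumes roots: "set \<Gamma> \<subseteq> \<Delta>" and p: "p \<in> decorated_walks \<Delta> B w \<Gamma>"
  shows "qwt_co_upto \<Delta> B \<Gamma> t p = coscale *\<^sub>R qwt_upto \<Delta> B \<Gamma> t p"
proof -
  obtain ws b where eq: "p = (ws, b)" by (cases p)
  then have ws: "ws \<in> quantum_walks \<Delta> B w \<Gamma>" using p unfolding decorated_walks_def by auto
  have facts: "path_root \<Gamma> u \<in> \<Delta>" "ws ! u \<in> W" if "u \<in> {1..length \<Gamma>}" for u
  proof -
    have "\<Gamma> ! (u - 1) \<in> set \<Gamma>" using that by (intro nth_mem) auto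
    then show "path_root \<Gamma> u \<in> \<Delta>" using roots unfolding path_root_def by auto
    show "ws ! u \<in> W" using walk_nth(2)[OF ws] that by auto
  qed
  have "coroot (root_abs \<Delta> B (inv (ws ! u) (path_root \<Gamma> u))) = coscale *\<^sub>R root_abs \<Delta> B (inv (ws ! u) (path_root \<Gamma> u))"
    if "u \<in> {1..length \<Gamma>}" for u
  proof -
    have "inv (ws ! u) (path_root \<Gamma> u) \<in> \<Delta>" using cross_facts(1) facts[OF that] by auto
    then show ?thesis by (auto simp: root_abs_def root_sgn_def coroot_eq uminus_root)
  qed
  moreover have "inv (ws ! u) (coroot (path_root \<Gamma> u)) = coscale *\<^sub>R inv (ws ! u) (path_root \<Gamma> u)"
    if "u \<in> {1..length \<Gamma>}" for u
    using facts[OF that] by (simp add: coroot_eq inv_linear)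
  moreover have "u \<in> {1..length \<Gamma>}" if "u \<in> Tminus_set \<Delta> B \<Gamma> ws \<or> u \<in> S_set B \<Gamma> ws" for u
    using that unfolding Tminus_set_def S_set_def by auto
  ultimately show ?thesis
    unfolding eq qwt_co_upto_def qwt_upto_def prod.case scaleR_diff_right scaleR_sum_right
    by (intro arg_cong2[of _ _ _ _ "(-)"] sum.cong) auto
qed

lemma walk_deg_eq:
  assumes roots: "set \<Gamma> \<subseteq> \<Delta>" and p: "p \<in> decorated_walks \<Delta> B w \<Gamma>"
  shows "walk_deg \<Delta> B lam \<Gamma> p = 1/2 * (qwt \<Delta> B \<Gamma> p \<bullet> (coscale *\<^sub>R qwt \<Delta> B \<Gamma> p)) + walk_acc lam \<Gamma> p"
proof -
  obtain ws b where eq: "p = (ws, b)" by (cases p)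
  show ?thesis
    using qwt_co_upto_eq[OF roots p] unfolding eq walk_deg_def walk_acc_def qwt_co_def qwt_def by simp
qed

text \<open>
  The quantum coweight is a multiple of the quantum weight, and the degree is the accumulated part plus a function
  of the quantum weight.
\<close>

lemma same_stats_if_same_state:
  assumes "set \<Gamma> \<subseteq> \<Delta>" "set \<Xi> \<subseteq> \<Delta>" "p \<in> decorated_walks \<Delta> B w \<Gamma>" "p' \<in> decorated_walks \<Delta> B w \<Xi>"
    and "walk_state lam \<Xi> p' = walk_state lam \<Gamma> p"
  shows "same_stats \<Delta> B lam \<Gamma> p \<Xi> p'"
  using assms qwt_co_upto_eq[OF assms(1,3)] qwt_co_upto_eq[OF assms(2,4)]
    walk_deg_eq[OF assms(1,3)] walk_deg_eq[OF assms(2,4)]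
  unfolding same_stats_def walk_state_def qwt_co_def qwt_def by simp

lemma walk_sign_cases: "walk_sign \<Delta> B \<Gamma> p = 1 \<or> walk_sign \<Delta> B \<Gamma> p = - 1"
proof -
  have "(- 1 :: int) ^ n = 1 \<or> (- 1 :: int) ^ n = - 1" for n by (cases "even n") auto
  then show ?thesis unfolding walk_sign_def
    by (cases p) (simp add: power_sum[symmetric] flip: power_add)
qed

lemma signed_count_eq_walk_sum:
  assumes "set \<Gamma> \<subseteq> \<Delta>" "w \<in> W"
  shows "(\<Sum>p\<in>{p \<in> decorated_walks \<Delta> B w \<Gamma>. walk_state lam \<Gamma> p = v}. walk_sign \<Delta> B \<Gamma> p)
    = walk_sum lam w \<Gamma> (\<lambda>x q \<omega> D. if (x, q, \<omega>, D) = v then 1 else 0)"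
  unfolding walk_sum_def walk_state_def
  by (subst sum.inter_filter[OF finite_decorated_walks[OF assms]]) (auto intro!: sum.cong)

end

theorem theorem3p12:
  fixes \<Delta> B :: "'a::euclidean_space set"
    and lam :: 'a and w :: "'a \<Rightarrow> 'a" and \<Gamma> \<Xi> :: "'a list"
  assumes "root_system \<Delta>" and "irreducible_roots \<Delta>" and "simply_laced \<Delta>"
    and "root_base \<Delta> B" and "\<not> type_E8 B"
    and "lam \<in> weight_lattice \<Delta>" and "w \<in> weyl_group \<Delta>"
    and "alcove_path \<Delta> B lam \<Gamma>" and "alcove_path \<Delta> B lam \<Xi>"
    and "yang_baxter \<Delta> \<Gamma> \<Xi>"
  shows "\<exists>QG QX. QG \<subseteq> decorated_walks \<Delta> B w \<Gamma> \<and> QX \<subseteq> decorated_walks \<Delta> B w \<Xi> \<and>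
    (\<exists>YB. bij_betw YB QG QX \<and>
       (\<forall>p\<in>QG. walk_sign \<Delta> B \<Xi> (YB p) = walk_sign \<Delta> B \<Gamma> p \<and> same_stats \<Delta> B lam \<Gamma> p \<Xi> (YB p))) \<and>
    (\<exists>YB. sign_reversing_involution \<Delta> B lam \<Gamma> (decorated_walks \<Delta> B w \<Gamma> - QG) YB) \<and>
    (\<exists>YB. sign_reversing_involution \<Delta> B lam \<Xi> (decorated_walks \<Delta> B w \<Xi> - QX) YB)"
proof -
  interpret simply_laced_base \<Delta> B using assms by unfold_locales
  let ?X = "decorated_walks \<Delta> B w \<Gamma>" and ?Y = "decorated_walks \<Delta> B w \<Xi>"
  have sets: "set \<Gamma> \<subseteq> \<Delta>" "set \<Xi> \<subseteq> \<Delta>" using path_subset_roots assms by auto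
  have signs: "\<forall>p\<in>?X. walk_sign \<Delta> B \<Gamma> p = 1 \<or> walk_sign \<Delta> B \<Gamma> p = - 1"
      "\<forall>p\<in>?Y. walk_sign \<Delta> B \<Xi> p = 1 \<or> walk_sign \<Delta> B \<Xi> p = - 1"
    using walk_sign_cases by blast+
  have counts: "(\<Sum>p\<in>{p \<in> ?X. walk_state lam \<Gamma> p = v}. walk_sign \<Delta> B \<Gamma> p)
      = (\<Sum>p\<in>{p \<in> ?Y. walk_state lam \<Xi> p = v}. walk_sign \<Delta> B \<Xi> p)" for v
    unfolding signed_count_eq_walk_sum[OF sets(1) assms(7)] signed_count_eq_walk_sum[OF sets(2) assms(7)]
    by (rule walk_sum_yang_baxter[OF assms(7-10)])
  obtain QG QX h \<phi> \<psi> where sub: "QG \<subseteq> ?X" "QX \<subseteq> ?Y"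
    and h: "bij_betw h QG QX"
      "\<forall>p\<in>QG. walk_sign \<Delta> B \<Xi> (h p) = walk_sign \<Delta> B \<Gamma> p \<and> walk_state lam \<Xi> (h p) = walk_state lam \<Gamma> p"
    and \<phi>: "\<forall>p\<in>?X - QG. \<phi> p \<in> ?X - QG \<and> \<phi> (\<phi> p) = p \<and> walk_sign \<Delta> B \<Gamma> (\<phi> p) = - walk_sign \<Delta> B \<Gamma> p
        \<and> walk_state lam \<Gamma> (\<phi> p) = walk_state lam \<Gamma> p"
    and \<psi>: "\<forall>p\<in>?Y - QX. \<psi> p \<in> ?Y - QX \<and> \<psi> (\<psi> p) = p \<and> walk_sign \<Delta> B \<Xi> (\<psi> p) = - walk_sign \<Delta> B \<Xi> p
        \<and> walk_state lam \<Xi> (\<psi> p) = walk_state lam \<Xi> p"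
    using bijection_and_involutions_from_signed_counts[OF finite_decorated_walks[OF sets(1) assms(7)]
        finite_decorated_walks[OF sets(2) assms(7)] signs counts]
    by (elim exE conjE) (rule that)
  have "same_stats \<Delta> B lam \<Gamma> p \<Xi> (h p)" if "p \<in> QG" for p
    using same_stats_if_same_state[OF sets] h sub bij_betwE[OF h(1)] that by blast
  then have "\<exists>YB. bij_betw YB QG QX \<and>
      (\<forall>p\<in>QG. walk_sign \<Delta> B \<Xi> (YB p) = walk_sign \<Delta> B \<Gamma> p \<and> same_stats \<Delta> B lam \<Gamma> p \<Xi> (YB p))"
    using h by blast
  moreover have "sign_reversing_involution \<Delta> B lam \<Gamma> (?X - QG) \<phi>"
    unfolding sign_reversing_involution_def using \<phi> same_stats_if_same_state[OF sets(1,1)] by blast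
  moreover have "sign_reversing_involution \<Delta> B lam \<Xi> (?Y - QX) \<psi>"
    unfolding sign_reversing_involution_def using \<psi> same_stats_if_same_state[OF sets(2,2)] by blast
  ultimately show ?thesis using sub by blast
qed

end
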